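(* Let $\gamma\ge1$ and let $K$ be a compact subset of $\{\lambda\in\mathbb{C}:\operatorname{Re}\lambda\ge0\}$. (i) Let $\epsilon\in(0,1)$. There are factors $c_{\rm in}(\lambda)=c_{\rm in}(\lambda;v_0,v_+)$, nonvanishing and analytic in $\lambda$, such that as $v_0\to1^-$ the functions $c_{\rm in}(\lambda)D_{\rm in}(\lambda)$ converge, uniformly for $\lambda\in K$ and $v_+\in(0,1-\epsilon]$, to the Evans function $\mathcal{D}(\lambda)=\mathcal{D}(\lambda;v_+)$ of the (unintegrated) eigenvalue equations of the viscous shock wave connecting $v_-=1$ to $v_+$. (ii) Let $r>0$. There are factors $c_{\rm out}(\lambda)=c_{\rm out}(\lambda;v_0)$, nonvanishing and analytic in $\lambda$, such that as $v_0\to0^+$ the functions $c_{\rm out}(\lambda)D^0_{\rm out}(\lambda)$ converge, uniformly for $\lambda\in K$ with $|\lambda|\ge r$, to the Evans function $\mathcal{D}^0(\lambda)$ of the limiting ($v_+=0$) viscous shock wave.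
   Context: Parameters: $\gamma\ge1$, $0<v_+<v_0<1$, $a:=v_+^\gamma\frac{1-v_+}{1-v_+^\gamma}$. The profile $\hat v$ is the (monotone decreasing) solution on $\mathbb{R}$ of $\hat v'=\hat v\big(\hat v-1+a(\hat v^{-\gamma}-1)\big)$ with $\hat v(0)=v_0$; $\hat v(-\infty)=1$, $\hat v(+\infty)=v_+$. Put $f(\hat v)=2\hat v-a(\gamma-1)\hat v^{-\gamma}-(a+1)$, $$A(x,\lambda)=\begin{pmatrix}0&\lambda&\lambda\\0&0&\lambda\\ \hat v&\hat v&f(\hat v)-\lambda\end{pmatrix},\qquad A_\pm(\lambda)=A(\pm\infty,\lambda).$$ For vectors in $\mathbb{C}^3$, $x\cdot y=\sum_ix_i\bar y_i$. Inflow Evans function. For $\operatorname{Re}\lambda\ge0$, $\lambda\ne0$, $-A_+(\lambda)^*$ has exactly one eigenvalue $\tilde\mu_1^+(\lambda)$ of negative real part; it and an eigenvector $\widetilde V_1^+(\lambda)$ can be chosen analytic in $\bar\lambda$ and extend so to $\lambda=0$. $\widetilde V_1^+$ is chosen continuous in $v_+$ and normalized so that $\widetilde V_1^+\to(0,-1,-\bar\lambda/(\gamma+\bar\lambda))^T$ as $v_+\to0$, locally uniformly in $\lambda$. $\widetilde W_1^+$ is the solution of $\widetilde W'=-A(x,\lambda)^*\widetilde W$ with $\widetilde W_1^+\sim e^{\tilde\mu_1^+x}\widetilde V_1^+$ as $x\to+\infty$ (extended to $\lambda=0$ by continuity), and $D_{\rm in}(\lambda):=(1,0,0)^T\cdot\widetilde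 W_1^+(0,\lambda)$. Shock Evans function. Let $\check v$ be the translate of $\hat v$ with $\check v(0)=(1+v_+)/2$ (the viscous shock profile), and $\check A(x,\lambda)$ the matrix $A$ with $\hat v$ replaced by $\check v$ (same limits $A_\pm$). For $\operatorname{Re}\lambda\ge0$, $A_-(\lambda)$ has exactly one eigenvalue $\mu_1^-(\lambda)$ of positive real part, with analytically chosen eigenvector $V_1^-(\lambda)$, continuous in $v_+$ down to $v_+=0$. $\mathcal{W}_1^-$ is the solution of $W'=\check AW$ with $\mathcal{W}_1^-\sim e^{\mu_1^-x}V_1^-$ as $x\to-\infty$; $\widetilde{\mathcal{W}}_1^+$ is the solution of $\widetilde W'=-\check A^*\widetilde W$ with $\widetilde{\mathcal{W}}_1^+\sim e^{\tilde\mu_1^+x}\widetilde V_1^+$ as $x\to+\infty$; $\mathcal{D}(\lambda;v_+):=\mathcal{W}_1^-(0,\lambda)\cdot\widetilde{\mathcal{W}}_1^+(0,\lambda)$. Limiting objects ($v_+=0$). $\hat v^0$ solves $(\hat v^0)'=\hat v^0(\hat v^0-1)$, $\hat v^0(0)=v_0$; $A^0(x,\lambda)$ is $A$ with $\hat v$ replaced by $\hat v^0$ and $f(\hat v)$ by $2\hat v^0-1$. $W_1^{0-}$ is the solution of $W'=A^0W$ with $W_1^{0-}\sim e^{\mu^{0-}x}V_1^{0-}$ as $x\to-\infty$, where $\mu^{0-},V_1^{0-}$ are the eigenvalue of positive real part of $A^0(-\infty,\lambda)$ and an analytically chosen eigenvector; $D^0_{\rm out}(\lambda):=W_1^{0-}(0,\lambda)\cdot\big(0,-1,-\bar\lambda/(\bar\lambda-(\hat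 v^0)'(0))\big)^T$. With $\check v^0$ the translate of $\hat v^0$ having $\check v^0(0)=1/2$ and $\check A^0$ the corresponding matrix, $\mathcal{D}^0(\lambda):=\mathcal{W}_1^{0-}(0)\cdot\widetilde{\mathcal{W}}_1^{0+}(0)$, where $\mathcal{W}_1^{0-}$ solves $W'=\check A^0W$ with $\mathcal{W}_1^{0-}\sim e^{\mu^{0-}x}V_1^{0-}$ as $x\to-\infty$ and $\widetilde{\mathcal{W}}_1^{0+}$ solves $\widetilde W'=-(\check A^0)^*\widetilde W$ and tends as $x\to+\infty$ to $(0,-1,\bar\lambda/\bar\mu)^T$, $\mu:=-1-\lambda$. *)

theory Defs
  imports "HOL-Complex_Analysis.Complex_Analysis"
begin

definition cdot :: "complex^3 \<Rightarrow> complex^3 \<Rightarrow> complex" where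
  "cdot x y = (\<Sum>i\<in>UNIV. x $ i * cnj (y $ i))"

definition cadj :: "complex^3^3 \<Rightarrow> complex^3^3" where
  "cadj A = (\<chi> i j. cnj (A $ j $ i))"

definition eigenpair :: "complex^3^3 \<Rightarrow> complex \<Rightarrow> complex^3 \<Rightarrow> bool" where
  "eigenpair A \<mu> V \<longleftrightarrow> V \<noteq> 0 \<and> A *v V = \<mu> *s V"

definition eigenvalues :: "complex^3^3 \<Rightarrow> complex set" where
  "eigenvalues A = {\<mu>. \<exists>V. eigenpair A \<mu> V}"

text \<open>The closed right half-plane, over which the spectral parameter ranges. Note that
  \<open>analytic_on RHP\<close> means holomorphic on some open neighbourhood of it.\<close>

definition RHP :: "complex set" where
  "RHP = {z. 0 \<le> Re z}"

definition acoef :: "real \<Rightarrow> real \<Rightarrow> real" where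
  "acoef \<gamma> vp = vp powr \<gamma> * ((1 - vp) / (1 - vp powr \<gamma>))"

definition profile :: "real \<Rightarrow> real \<Rightarrow> real \<Rightarrow> (real \<Rightarrow> real) \<Rightarrow> bool" where
  "profile \<gamma> vp v0 v \<longleftrightarrow>
     (\<forall>x. (v has_real_derivative
            v x * (v x - 1 + acoef \<gamma> vp * (v x powr (-\<gamma>) - 1))) (at x)) \<and>
     v 0 = v0 \<and> antimono v \<and> (v \<longlongrightarrow> 1) at_bot \<and> (v \<longlongrightarrow> vp) at_top"

text \<open>The profile equation at \<open>v\<^sub>+ = 0\<close>.\<close>

definition profile0 :: "real \<Rightarrow> (real \<Rightarrow> real) \<Rightarrow> bool" where
  "profile0 v0 v \<longleftrightarrow>
     (\<forall>x. (v has_real_derivative v x * (v x - 1)) (at x)) \<and> v 0 = v0"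

definition translate_of :: "(real \<Rightarrow> real) \<Rightarrow> (real \<Rightarrow> real) \<Rightarrow> bool" where
  "translate_of u v \<longleftrightarrow> (\<exists>s. \<forall>x. u x = v (x + s))"

text \<open>The matrices depend on \<open>x\<close> only through the profile value, so they are written as functions
  of a number \<open>v\<close>: \<open>A(x,\<lambda>)\<close> is obtained at \<open>v = v(x)\<close>, and \<open>A\<^sub>+\<close>, \<open>A\<^sub>-\<close> at the
  profile limits \<open>v = v\<^sub>+\<close> and \<open>v = 1\<close>.\<close>

definition fcoef :: "real \<Rightarrow> real \<Rightarrow> real \<Rightarrow> real" where
  "fcoef \<gamma> vp v = 2 * v - acoef \<gamma> vp * (\<gamma> - 1) * v powr (-\<gamma>) - (acoef \<gamma> vp + 1)"

definition coef_matrix :: "real \<Rightarrow> real \<Rightarrow> complex \<Rightarrow> complex^3^3" where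
  "coef_matrix v fv z = vector
     [vector [0, z, z],
      vector [0, 0, z],
      vector [of_real v, of_real v, of_real fv - z]]"

definition Amat :: "real \<Rightarrow> real \<Rightarrow> real \<Rightarrow> complex \<Rightarrow> complex^3^3" where
  "Amat \<gamma> vp v z = coef_matrix v (fcoef \<gamma> vp v) z"

definition Amat0 :: "real \<Rightarrow> complex \<Rightarrow> complex^3^3" where
  "Amat0 v z = coef_matrix v (2 * v - 1) z"

definition solves :: "(real \<Rightarrow> complex^3^3) \<Rightarrow> (real \<Rightarrow> complex^3) \<Rightarrow> bool" where
  "solves B W \<longleftrightarrow> (\<forall>x. (W has_vector_derivative B x *v W x) (at x))"

text \<open>\<open>W \<sim> e\<^bsup>\<mu>x\<^esup> V\<close> along the filter \<open>F\<close> (\<open>at_top\<close> or \<open>at_bot\<close>).\<close>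

definition asymp_exp ::
  "complex \<Rightarrow> complex^3 \<Rightarrow> real filter \<Rightarrow> (real \<Rightarrow> complex^3) \<Rightarrow> bool" where
  "asymp_exp \<mu> V F W \<longleftrightarrow> ((\<lambda>x. exp (- \<mu> * of_real x) *s W x) \<longlongrightarrow> V) F"

text \<open>The eigendata at \<open>+\<infinity>\<close> of the adjoint system. Both \<open>\<mu>\<close> and \<open>V\<close> take
  \<open>v\<^sub>+\<close> and then \<open>\<lambda>\<close>. Analyticity in the conjugate of \<open>\<lambda>\<close> is expressed by precomposing with
  \<open>cnj\<close>, which maps \<open>RHP\<close> onto itself. At \<open>\<lambda> = 0\<close> the real part of \<open>\<mu>\<close> need not be negative.
  Continuity in \<open>v\<^sub>+\<close> is understood locally uniformly in \<open>\<lambda>\<close>, i.e. jointly.\<close>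

definition adjoint_eigendata ::
  "real \<Rightarrow> (real \<Rightarrow> complex \<Rightarrow> complex) \<Rightarrow> (real \<Rightarrow> complex \<Rightarrow> complex^3) \<Rightarrow> bool" where
  "adjoint_eigendata \<gamma> \<mu> V \<longleftrightarrow>
     (\<forall>vp\<in>{0<..<1}.
        (\<forall>z\<in>RHP. eigenpair (- cadj (Amat \<gamma> vp vp z)) (\<mu> vp z) (V vp z)) \<and>
        (\<forall>z\<in>RHP - {0}. {\<nu> \<in> eigenvalues (- cadj (Amat \<gamma> vp vp z)). Re \<nu> < 0} = {\<mu> vp z}) \<and>
        (\<lambda>z. \<mu> vp (cnj z)) analytic_on RHP \<and>
        (\<forall>i. (\<lambda>z. V vp (cnj z) $ i) analytic_on RHP)) \<and>
     continuous_on ({0<..<1} \<times> RHP) (\<lambda>(vp, z). V vp z) \<and>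
     (\<forall>C. compact C \<and> C \<subseteq> RHP \<longrightarrow>
        uniform_limit C V (\<lambda>z. vector [0, - 1, - cnj z / (of_real \<gamma> + cnj z)]) (at_right 0))"

text \<open>The eigendata at \<open>-\<infinity>\<close>, for \<open>v\<^sub>+\<close> down to and including \<open>0\<close>
  (where \<open>acoef \<gamma> 0 = 0\<close>).\<close>

definition shock_eigendata ::
  "real \<Rightarrow> (real \<Rightarrow> complex \<Rightarrow> complex) \<Rightarrow> (real \<Rightarrow> complex \<Rightarrow> complex^3) \<Rightarrow> bool" where
  "shock_eigendata \<gamma> \<mu> V \<longleftrightarrow>
     (\<forall>vp\<in>{0..<1}.
        (\<forall>z\<in>RHP. eigenpair (Amat \<gamma> vp 1 z) (\<mu> vp z) (V vp z) \<and>
                  {\<nu> \<in> eigenvalues (Amat \<gamma> vp 1 z). 0 < Re \<nu>} = {\<mu> vp z}) \<and>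
        (\<forall>i. (\<lambda>z. V vp z $ i) analytic_on RHP)) \<and>
     continuous_on ({0..<1} \<times> RHP) (\<lambda>(vp, z). V vp z)"

definition limit_eigendata :: "(complex \<Rightarrow> complex) \<Rightarrow> (complex \<Rightarrow> complex^3) \<Rightarrow> bool" where
  "limit_eigendata \<mu> V \<longleftrightarrow>
     (\<forall>z\<in>RHP. eigenpair (Amat0 1 z) (\<mu> z) (V z) \<and>
               {\<nu> \<in> eigenvalues (Amat0 1 z). 0 < Re \<nu>} = {\<mu> z}) \<and>
     (\<forall>i. (\<lambda>z. V z $ i) analytic_on RHP)"

text \<open>The adjoint solution decaying at \<open>+\<infinity>\<close>, extended to \<open>\<lambda> = 0\<close> by continuity.\<close>

definition adjoint_solution ::
  "real \<Rightarrow> real \<Rightarrow> (real \<Rightarrow> real) \<Rightarrow> (complex \<Rightarrow> complex) \<Rightarrow> (complex \<Rightarrow> complex^3) \<Rightarrow>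
    (complex \<Rightarrow> real \<Rightarrow> complex^3) \<Rightarrow> bool" where
  "adjoint_solution \<gamma> vp v \<mu> V W \<longleftrightarrow>
     (\<forall>z\<in>RHP. solves (\<lambda>x. - cadj (Amat \<gamma> vp (v x) z)) (W z)) \<and>
     (\<forall>z\<in>RHP - {0}. asymp_exp (\<mu> z) (V z) at_top (W z)) \<and>
     (\<forall>x. continuous (at 0 within RHP) (\<lambda>z. W z x))"

definition shock_solution ::
  "real \<Rightarrow> real \<Rightarrow> (real \<Rightarrow> real) \<Rightarrow> (complex \<Rightarrow> complex) \<Rightarrow> (complex \<Rightarrow> complex^3) \<Rightarrow>
    (complex \<Rightarrow> real \<Rightarrow> complex^3) \<Rightarrow> bool" where
  "shock_solution \<gamma> vp v \<mu> V W \<longleftrightarrow>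
     (\<forall>z\<in>RHP. solves (\<lambda>x. Amat \<gamma> vp (v x) z) (W z) \<and> asymp_exp (\<mu> z) (V z) at_bot (W z))"

definition limit_solution ::
  "(real \<Rightarrow> real) \<Rightarrow> (complex \<Rightarrow> complex) \<Rightarrow> (complex \<Rightarrow> complex^3) \<Rightarrow>
    (complex \<Rightarrow> real \<Rightarrow> complex^3) \<Rightarrow> bool" where
  "limit_solution v \<mu> V W \<longleftrightarrow>
     (\<forall>z\<in>RHP. solves (\<lambda>x. Amat0 (v x) z) (W z) \<and> asymp_exp (\<mu> z) (V z) at_bot (W z))"

definition limit_adjoint_solution ::
  "(real \<Rightarrow> real) \<Rightarrow> (complex \<Rightarrow> real \<Rightarrow> complex^3) \<Rightarrow> bool" where
  "limit_adjoint_solution v W \<longleftrightarrow>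
     (\<forall>z\<in>RHP. solves (\<lambda>x. - cadj (Amat0 (v x) z)) (W z) \<and>
               (W z \<longlongrightarrow> vector [0, - 1, cnj z / cnj (- 1 - z)]) at_top)"

definition D_in :: "(complex \<Rightarrow> real \<Rightarrow> complex^3) \<Rightarrow> complex \<Rightarrow> complex" where
  "D_in W z = cdot (vector [1, 0, 0]) (W z 0)"

definition D_shock ::
  "(complex \<Rightarrow> real \<Rightarrow> complex^3) \<Rightarrow> (complex \<Rightarrow> real \<Rightarrow> complex^3) \<Rightarrow> complex \<Rightarrow> complex" where
  "D_shock W Wt z = cdot (W z 0) (Wt z 0)"

definition D0_out ::
  "(real \<Rightarrow> real) \<Rightarrow> (complex \<Rightarrow> real \<Rightarrow> complex^3) \<Rightarrow> complex \<Rightarrow> complex" where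
  "D0_out v W z = cdot (W z 0) (vector [0, - 1, - cnj z / (cnj z - of_real (deriv v 0))])"

end

theory Submission
  imports Defs
begin

text \<open>
  Write \<open>Y\<close> for the complex conjugate of a solution of the adjoint system. It solves a linear system
  whose matrix is analytic in the spectral parameter, and the pairing \<open>cdot\<close> of a solution of
  \<open>W' = A W\<close> with an adjoint solution does not depend on \<open>x\<close>. Hence every Evans function may be read
  off at whichever point is convenient, and both parts of the theorem come from moving that point to
  infinity.

  Part (i). The inflow profile is the shock profile shifted by \<open>t\<close>, the point at which the shock
  profile has the value \<open>v\<^sub>0\<close>, and \<open>v\<^sub>0 \<rightarrow> 1\<close> means \<open>t \<rightarrow> -\<infinity>\<close>
  at a rate that does not depend on \<open>v\<^sub>+\<close>. Since the decaying adjoint solution is unique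
  (\<open>adjoint_solution_unique\<close>), \<open>D_in\<close> is up to an exponential factor the first component of the shock
  solution \<open>Y\<close> at \<open>t\<close>. As \<open>x \<rightarrow> -\<infinity>\<close>, \<open>exp (\<mu> x) Y x\<close> converges exponentially to a multiple
  \<open>c L\<close> of the left eigenvector \<open>L = (1, 1 + z / \<mu>, \<mu>)\<close> of the matrix at \<open>-\<infinity>\<close>
  (\<open>dual_solution_limit_at_bot\<close>); so the first component of \<open>Y\<close> determines \<open>c\<close> in the limit, while the
  shock Evans function is \<open>c\<close> times the pairing of \<open>L\<close> with the right eigenvector. That pairing is the
  \<open>shock_weight\<close>, nonzero because \<open>\<mu>\<close> is a simple root of the characteristic polynomial
  (\<open>no_double_root\<close>). With an exponential it makes up \<open>c_in\<close>.

  What makes this uniform down to \<open>v\<^sub>+ = 0\<close> is a bound on the shock adjoint solution at \<open>0\<close>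
  (\<open>adjoint_solution_value_bounded\<close>), and this is the main difficulty: as \<open>v\<^sub>+ \<rightarrow> 0\<close> or \<open>z \<rightarrow> 0\<close>
  two eigenvalues of the matrix at \<open>+\<infinity>\<close> collide at zero. They are however of the form
  \<open>z s \<sigma>\<^sub>1\<close> and \<open>z s \<sigma>\<^sub>2\<close> with \<open>s = sqrt v\<^sub>+\<close> and \<open>\<sigma>\<^sub>1, \<sigma>\<^sub>2\<close> uniformly separated, and
  dividing the first component by \<open>s\<close> makes the spectral projections bounded
  (\<open>decaying_root_spectral_data\<close>). This controls the solution where \<open>v \<le> (1 + \<kappa>) v\<^sub>+\<close>
  (\<open>adjoint_tail_bound\<close>). The remaining interval has unbounded length, but on it \<open>v\<close> decays
  exponentially, and a weighted energy costs only the integral of \<open>v\<close> to the power \<open>1/4\<close>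
  (\<open>adjoint_transition_bound\<close>).

  Part (ii). Here the profile is \<open>1 / (1 + exp x)\<close> exactly, shifted by \<open>t \<rightarrow> \<infinity>\<close> as
  \<open>v\<^sub>0 \<rightarrow> 0\<close>. With \<open>c_out = exp (\<mu> t)\<close>, the outflow Evans function is a combination
  of the second and third components at \<open>t\<close> of the one solution \<open>W\<close> that grows from \<open>-\<infinity>\<close>. As
  \<open>x \<rightarrow> \<infinity>\<close> the third component tends to zero and the second one converges, both exponentially and
  uniformly (\<open>limit_solution_forward\<close>). The shock Evans function is minus the limit of the second
  component as well (\<open>limit_shock_evans_value\<close>), because the first component grows more slowly than the
  first component of the adjoint solution decays.
\<close>

(* Frees the symbol for vector components. *)
no_notation fps_nth (infixl "$" 75)

section \<open>Vector-valued calculus\<close>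

lemma norm_smult_vec: "norm (c *s (x :: complex^'n)) = cmod c * norm x"
proof -
  have "norm (c *s x) = L2_set (\<lambda>i. cmod c * norm (x $ i)) UNIV"
    by (simp add: norm_vec_def norm_mult)
  also have "\<dots> = cmod c * norm x"
    by (simp add: norm_vec_def L2_set_right_distrib)
  finally show ?thesis .
qed

lemma inner_smult_self: "inner x (c *s (x :: complex^'n)) = Re c * (norm x)\<^sup>2"
proof -
  have "inner (x $ i) (c * x $ i) = Re c * (cmod (x $ i))\<^sup>2" for i
    unfolding cmod_power2 by (simp add: inner_complex_def algebra_simps power2_eq_square)
  then show ?thesis
    by (simp add: inner_vec_def norm_vec_def L2_set_def sum_nonneg sum_distrib_left)
qed

lemma has_vector_derivative_vec:
  fixes f :: "real \<Rightarrow> complex^'n"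
  assumes "\<And>i. ((\<lambda>x. f x $ i) has_vector_derivative f' $ i) (at x within S)"
  shows "(f has_vector_derivative f') (at x within S)"
proof -
  have "(f has_derivative (\<lambda>h. h *\<^sub>R f')) (at x within S)"
  proof (subst has_derivative_componentwise_within)
    show "\<forall>b\<in>Basis. ((\<lambda>y. inner (f y) b) has_derivative (\<lambda>h. inner (h *\<^sub>R f') b)) (at x within S)"
    proof
      fix b :: "complex^'n"
      assume "b \<in> Basis"
      then obtain i c where b: "b = axis i c" "c \<in> Basis"
        by (auto simp: Basis_vec_def)
      have "((\<lambda>y. f y $ i) has_derivative (\<lambda>h. h *\<^sub>R (f' $ i))) (at x within S)"
        using assms[of i] by (simp add: has_vector_derivative_def)
      then have "((\<lambda>y. inner (f y $ i) c) has_derivative (\<lambda>h. inner (h *\<^sub>R (f' $ i)) c)) (at x within S)"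
        by (rule has_derivative_inner_left)
      then show "((\<lambda>y. inner (f y) b) has_derivative (\<lambda>h. inner (h *\<^sub>R f') b)) (at x within S)"
        by (simp add: b inner_axis)
    qed
  qed
  then show ?thesis by (simp add: has_vector_derivative_def)
qed

lemma has_vector_derivative_vec_nth:
  fixes f :: "real \<Rightarrow> complex^'n"
  assumes "(f has_vector_derivative f') (at x within S)"
  shows "((\<lambda>x. f x $ i) has_vector_derivative f' $ i) (at x within S)"
  using bounded_linear.has_vector_derivative[OF bounded_linear_vec_nth assms, of i] by simp

lemma has_vector_derivative_smult:
  fixes f :: "real \<Rightarrow> complex^'n"
  assumes "(c has_vector_derivative c') (at x within S)" "(f has_vector_derivative f') (at x within S)"
  shows "((\<lambda>x. c x *s f x) has_vector_derivative (c x *s f' + c' *s f x)) (at x within S)"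
proof (rule has_vector_derivative_vec)
  fix i
  show "((\<lambda>x. (c x *s f x) $ i) has_vector_derivative (c x *s f' + c' *s f x) $ i) (at x within S)"
    using has_vector_derivative_mult[OF assms(1) has_vector_derivative_vec_nth[OF assms(2), of i]]
    by simp
qed

lemma has_vector_derivative_matrix:
  fixes f :: "real \<Rightarrow> complex^'n"
  assumes "(f has_vector_derivative f') (at x within S)"
  shows "((\<lambda>x. (B :: complex^'n^'m) *v f x) has_vector_derivative B *v f') (at x within S)"
proof (rule has_vector_derivative_vec)
  fix i
  show "((\<lambda>x. (B *v f x) $ i) has_vector_derivative (B *v f') $ i) (at x within S)"
    unfolding matrix_vector_mult_def
    by (auto intro!: derivative_eq_intros has_vector_derivative_vec_nth[OF assms] has_vector_derivative_sum
        has_vector_derivative_mult_right)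
qed

lemma has_vector_derivative_cexp:
  "((\<lambda>x. exp (\<beta> * complex_of_real (x - a))) has_vector_derivative \<beta> * exp (\<beta> * complex_of_real (x - a)))
     (at x within S)"
  by (rule has_vector_derivative_eq_rhs,
      rule has_vector_derivative_real_field | auto intro!: derivative_eq_intros)+

lemma norm_sq_has_real_derivative:
  fixes f :: "real \<Rightarrow> 'a::real_inner"
  assumes "(f has_vector_derivative f') (at x)"
  shows "((\<lambda>x. (norm (f x))\<^sup>2) has_real_derivative 2 * inner (f x) f') (at x)"
  using bounded_bilinear.has_vector_derivative[OF bounded_bilinear_inner assms assms]
  by (simp add: has_real_derivative_iff_has_vector_derivative power2_norm_eq_inner inner_commute)

lemma filterlim_shift_at_top: "filterlim (\<lambda>x. x + t) at_top (at_top :: real filter)"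
  unfolding filterlim_at_top
proof
  show "\<forall>\<^sub>F x in at_top. Z \<le> x + t" for Z :: real
    by (rule eventually_at_top_linorderI[of "Z - t"]) simp
qed

lemma filterlim_shift_at_bot: "filterlim (\<lambda>x. x + t) at_bot (at_bot :: real filter)"
  unfolding filterlim_at_bot
proof
  show "\<forall>\<^sub>F x in at_bot. x + t \<le> Z" for Z :: real
    by (rule eventually_at_bot_linorderI[of "Z - t"]) simp
qed

lemma has_vector_derivative_smult_const:
  fixes f :: "real \<Rightarrow> complex^'n"
  assumes "(f has_vector_derivative f') (at x within S)"
  shows "((\<lambda>x. c *s f x) has_vector_derivative c *s f') (at x within S)"
  using has_vector_derivative_smult[OF has_vector_derivative_const assms] by simp

lemma compact_norm_bound:
  fixes f :: "'a::topological_space \<Rightarrow> 'b::real_normed_vector"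
  assumes K: "compact K" and f: "continuous_on K f"
  obtains M where "0 \<le> M" "\<And>x. x \<in> K \<Longrightarrow> norm (f x) \<le> M"
proof -
  have "bounded (f ` K)" by (intro compact_imp_bounded compact_continuous_image f K)
  then obtain M where "\<forall>x\<in>f ` K. norm x \<le> M" by (auto simp: bounded_iff)
  then show ?thesis by (intro that[of "max 0 M"]) (auto simp: max.coboundedI2)
qed

lemma bounded_on_ray:
  fixes y :: "real \<Rightarrow> 'a::real_normed_vector"
  assumes cont: "\<And>x. X \<le> x \<Longrightarrow> isCont y x" and lim: "(y \<longlongrightarrow> V) at_top"
  obtains M where "\<And>x. X \<le> x \<Longrightarrow> norm (y x) \<le> M"
proof -
  have "\<forall>\<^sub>F x in at_top. norm (y x) < norm V + 1"
    using tendsto_norm[OF lim] by (rule order_tendstoD) simp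
  then obtain b where b: "\<And>x. b \<le> x \<Longrightarrow> norm (y x) < norm V + 1"
    by (auto simp: eventually_at_top_linorder)
  have "continuous_on {X..b} y" by (intro continuous_at_imp_continuous_on) (auto intro: cont)
  then obtain M where M: "\<And>x. x \<in> {X..b} \<Longrightarrow> norm (y x) \<le> M"
    using compact_norm_bound[OF compact_Icc] by blast
  have "norm (y x) \<le> max M (norm V + 1)" if "X \<le> x" for x
    using M[of x] b[of x] that by (cases "x \<le> b") (auto simp: max_def intro: order_trans less_imp_le)
  then show ?thesis by (rule that)
qed

lemma exp_decay_at_top:
  fixes k C :: real
  assumes "0 < k"
  shows "((\<lambda>x. C * exp (- k * x)) \<longlongrightarrow> 0) at_top"
proof -
  have "((\<lambda>x. C * exp (- k * x)) \<longlongrightarrow> C * 0) at_top"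
  proof (intro tendsto_mult tendsto_const filterlim_compose[OF exp_at_bot])
    have "LIM x at_top. k * x :> at_top"
      by (rule filterlim_tendsto_pos_mult_at_top[OF tendsto_const assms filterlim_ident])
    then show "LIM x at_top. - k * x :> at_bot" by (simp add: filterlim_uminus_at_bot)
  qed
  then show ?thesis by simp
qed

lemma exp_decay_at_bot:
  fixes k C :: real
  assumes "0 < k"
  shows "((\<lambda>x. C * exp (k * x)) \<longlongrightarrow> 0) at_bot"
  using filterlim_compose[OF exp_decay_at_top[OF assms, of C] filterlim_uminus_at_top_at_bot] by simp

section \<open>Linear systems near infinity\<close>

text \<open>Variation of constants on \<open>[x, b]\<close>: the damped solution \<open>exp (- \<beta> (s - x)) q s\<close> has derivative
  \<open>exp (- \<beta> (s - x)) g s\<close>, and \<open>\<phi>\<close> is a primitive of a bound for it. Stating the bound through a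
  primitive avoids integrals.\<close>

lemma backward_estimate:
  fixes q g :: "real \<Rightarrow> complex^'n"
  assumes xb: "x \<le> b"
    and q: "\<And>s. x \<le> s \<Longrightarrow> s \<le> b \<Longrightarrow> (q has_vector_derivative (\<beta> *s q s + g s)) (at s)"
    and \<phi>: "\<And>s. x \<le> s \<Longrightarrow> s \<le> b \<Longrightarrow> (\<phi> has_real_derivative \<phi>' s) (at s)"
    and bnd: "\<And>s. x \<le> s \<Longrightarrow> s \<le> b \<Longrightarrow> exp (- Re \<beta> * (s - x)) * norm (g s) \<le> \<phi>' s"
  shows "norm (q x) \<le> exp (- Re \<beta> * (b - x)) * norm (q b) + (\<phi> b - \<phi> x)"
proof (cases "x = b")
  case False
  define p where "p s = exp (- \<beta> * complex_of_real (s - x)) *s q s" for s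
  have p: "(p has_vector_derivative exp (- \<beta> * complex_of_real (s - x)) *s g s) (at s)"
    if "x \<le> s" "s \<le> b" for s
    unfolding p_def
    by (rule has_vector_derivative_eq_rhs[OF has_vector_derivative_smult[OF has_vector_derivative_cexp q[OF that]]])
      (simp add: vec_eq_iff algebra_simps)
  have "norm (p b - p x) \<le> \<phi> b - \<phi> x"
  proof (rule differentiable_bound_general[where f' = "\<lambda>s. exp (- \<beta> * complex_of_real (s - x)) *s g s" and \<phi>' = \<phi>'])
    show "x < b" using xb False by simp
    show "continuous_on {x..b} p"
      by (rule continuous_at_imp_continuous_on) (auto intro!: has_vector_derivative_continuous[OF p])
    show "continuous_on {x..b} \<phi>"
      by (rule continuous_at_imp_continuous_on) (auto intro!: DERIV_isCont[OF \<phi>])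
    show "(p has_vector_derivative exp (- \<beta> * complex_of_real (s - x)) *s g s) (at s)"
      if "x < s" "s < b" for s using p that by simp
    show "(\<phi> has_vector_derivative \<phi>' s) (at s)" if "x < s" "s < b" for s
      using \<phi>[of s] that by (simp add: has_real_derivative_iff_has_vector_derivative)
    show "norm (exp (- \<beta> * complex_of_real (s - x)) *s g s) \<le> \<phi>' s" if "x < s" "s < b" for s
      using bnd[of s] that by (simp add: norm_smult_vec)
  qed
  moreover have "norm (p x) \<le> norm (p b) + norm (p b - p x)"
    by (metis norm_minus_commute norm_triangle_sub)
  moreover have "norm (p b) = exp (- Re \<beta> * (b - x)) * norm (q b)" "p x = q x"
    by (simp_all add: p_def norm_smult_vec)
  ultimately show ?thesis by simp
qed simp

text \<open>With \<open>Re \<beta> \<ge> 0\<close> the homogeneous equation does not grow backwards, so the value at infinity and the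
  total mass of the source control \<open>q\<close>. No rate is gained from \<open>\<beta>\<close>, which may be arbitrarily small;
  this is what allows eigenvalues that collide at zero.\<close>

lemma backward_from_infinity:
  fixes q g :: "real \<Rightarrow> complex^'n"
  assumes q: "\<And>s. X \<le> s \<Longrightarrow> (q has_vector_derivative (\<beta> *s q s + g s)) (at s)"
    and \<beta>: "0 \<le> Re \<beta>" and \<theta>: "0 < \<theta>"
    and g: "\<And>s. X \<le> s \<Longrightarrow> norm (g s) \<le> G * exp (- \<theta> * (s - X))"
    and lim: "(q \<longlongrightarrow> L) at_top" and x: "X \<le> x"
  shows "norm (q x) \<le> norm L + G / \<theta>"
proof -
  have G: "0 \<le> G" using order_trans[OF norm_ge_zero g[of X]] by simp
  have "norm (q x) \<le> norm (q b) + G / \<theta>" if "x \<le> b" for b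
  proof -
    have "norm (q x) \<le> exp (- Re \<beta> * (b - x)) * norm (q b)
        + (- (G / \<theta>) * exp (- \<theta> * (b - X)) - (- (G / \<theta>) * exp (- \<theta> * (x - X))))"
    proof (rule backward_estimate[where g = g and \<phi>' = "\<lambda>s. G * exp (- \<theta> * (s - X))"])
      show "exp (- Re \<beta> * (s - x)) * norm (g s) \<le> G * exp (- \<theta> * (s - X))" if "x \<le> s" for s
      proof -
        have "exp (- Re \<beta> * (s - x)) \<le> 1" using \<beta> that by (simp add: mult_nonneg_nonneg)
        then have "exp (- Re \<beta> * (s - x)) * norm (g s) \<le> 1 * norm (g s)"
          by (rule mult_right_mono) simp
        with g[of s] x that show ?thesis by simp
      qed
      show "((\<lambda>b. - (G / \<theta>) * exp (- \<theta> * (b - X))) has_real_derivative G * exp (- \<theta> * (s - X))) (at s)" for s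
        using \<theta> by (auto intro!: derivative_eq_intros)
    qed (use that q x in auto)
    moreover have "exp (- Re \<beta> * (b - x)) * norm (q b) \<le> 1 * norm (q b)"
      using \<beta> that by (intro mult_right_mono) (auto simp: mult_nonneg_nonneg)
    moreover have "G / \<theta> * exp (- \<theta> * (x - X)) \<le> G / \<theta> * 1"
      using G \<theta> x by (intro mult_left_mono) auto
    moreover have "0 \<le> G / \<theta> * exp (- \<theta> * (b - X))"
      using G \<theta> by simp
    ultimately show ?thesis by linarith
  qed
  then have "\<forall>\<^sub>F b in at_top. norm (q x) \<le> norm (q b) + G / \<theta>"
    by (intro eventually_at_top_linorderI[of x])
  moreover have "((\<lambda>b. norm (q b) + G / \<theta>) \<longlongrightarrow> norm L + G / \<theta>) at_top"
    by (intro tendsto_intros lim)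
  ultimately show ?thesis
    by (intro tendsto_lowerbound) auto
qed

text \<open>If \<open>Re \<beta>\<close> is bounded below, a bounded source suffices, and the value at infinity is forgotten.\<close>

lemma backward_from_infinity_damped:
  fixes q g :: "real \<Rightarrow> complex^'n"
  assumes q: "\<And>s. X \<le> s \<Longrightarrow> (q has_vector_derivative (\<beta> *s q s + g s)) (at s)"
    and \<beta>: "c \<le> Re \<beta>" and c: "0 < c"
    and g: "\<And>s. X \<le> s \<Longrightarrow> norm (g s) \<le> G"
    and lim: "(q \<longlongrightarrow> L) at_top" and x: "X \<le> x"
  shows "norm (q x) \<le> G / c"
proof -
  have G: "0 \<le> G" using order_trans[OF norm_ge_zero g[of X]] by simp
  have "norm (q x) \<le> exp (- c * (b - x)) * norm (q b) + G / c" if "x \<le> b" for b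
  proof -
    have "norm (q x) \<le> exp (- Re \<beta> * (b - x)) * norm (q b)
        + (- (G / c) * exp (- c * (b - x)) - (- (G / c) * exp (- c * (x - x))))"
    proof (rule backward_estimate[where g = g and \<phi>' = "\<lambda>s. G * exp (- c * (s - x))"])
      show "exp (- Re \<beta> * (s - x)) * norm (g s) \<le> G * exp (- c * (s - x))" if "x \<le> s" for s
      proof -
        have "exp (- Re \<beta> * (s - x)) \<le> exp (- c * (s - x))" using \<beta> that by (simp add: mult_right_mono)
        then have "exp (- Re \<beta> * (s - x)) * norm (g s) \<le> exp (- c * (s - x)) * G"
          using g[of s] x that by (intro mult_mono) auto
        then show ?thesis by (simp add: mult.commute)
      qed
      show "((\<lambda>b. - (G / c) * exp (- c * (b - x))) has_real_derivative G * exp (- c * (s - x))) (at s)" for s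
        using c by (auto intro!: derivative_eq_intros)
    qed (use that q x in auto)
    moreover have "exp (- Re \<beta> * (b - x)) * norm (q b) \<le> exp (- c * (b - x)) * norm (q b)"
      using \<beta> that by (intro mult_right_mono) (auto simp: mult_right_mono)
    moreover have "0 \<le> G / c * exp (- c * (b - x))"
      using G c by simp
    ultimately show ?thesis by simp
  qed
  then have "\<forall>\<^sub>F b in at_top. norm (q x) \<le> exp (- c * (b - x)) * norm (q b) + G / c"
    by (intro eventually_at_top_linorderI[of x])
  moreover have "((\<lambda>b. exp (- c * (b - x)) * norm (q b) + G / c) \<longlongrightarrow> 0 * norm L + G / c) at_top"
  proof (intro tendsto_intros lim)
    show "((\<lambda>b. exp (- c * (b - x))) \<longlongrightarrow> 0) at_top"
      using exp_decay_at_top[OF c, of "exp (c * x)"] by (simp add: algebra_simps flip: exp_add)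
  qed
  ultimately show ?thesis
    by (intro tendsto_lowerbound[of _ "G / c"]) auto
qed

text \<open>A quantitative spectral decomposition of a matrix with eigenvalues \<open>0\<close>, \<open>\<beta>2\<close>, \<open>\<beta>3\<close>. The first
  clause is the Cayley-Hamilton identity. The last one bounds \<open>(B - \<beta>2)(B - \<beta>3)\<close>, which is
  \<open>\<beta>2 \<beta>3\<close> times the projection to the kernel, by a multiple of \<open>\<beta>2\<close>; this stays meaningful when
  \<open>\<beta>2\<close> approaches zero.\<close>

definition splitting :: "complex^'n^'n \<Rightarrow> complex \<Rightarrow> complex \<Rightarrow> real \<Rightarrow> bool" where
  "splitting B \<beta>2 \<beta>3 R \<longleftrightarrow>
     (\<forall>p. B *v (B *v (B *v p)) = (\<beta>2 + \<beta>3) *s (B *v (B *v p)) - (\<beta>2 * \<beta>3) *s (B *v p)) \<and>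
     (\<forall>p. norm (B *v p - \<beta>3 *s p) \<le> R * norm p) \<and>
     (\<forall>p. norm (B *v (B *v p) - (\<beta>2 + \<beta>3) *s (B *v p) + (\<beta>2 * \<beta>3) *s p) \<le> R * cmod \<beta>2 * norm p)"

definition shifted :: "complex^'n^'n \<Rightarrow> complex \<Rightarrow> complex^'n \<Rightarrow> complex^'n" where
  "shifted B \<beta> p = B *v p - \<beta> *s p"

text \<open>This is \<open>\<beta>3\<close> times the spectral projection to the kernel of \<open>B\<close>.\<close>

definition kernel_part :: "complex^'n^'n \<Rightarrow> complex \<Rightarrow> complex \<Rightarrow> complex^'n \<Rightarrow> complex^'n" where
  "kernel_part B \<beta>2 \<beta>3 p = (1 / \<beta>2) *s (B *v (B *v p) - (\<beta>2 + \<beta>3) *s (B *v p) + (\<beta>2 * \<beta>3) *s p)"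

lemma shifted_linear:
  "shifted B \<beta> (p + q) = shifted B \<beta> p + shifted B \<beta> q"
  "shifted B \<beta> (p - q) = shifted B \<beta> p - shifted B \<beta> q" "shifted B \<beta> (- p) = - shifted B \<beta> p"
  using matrix_vector_mult_diff_distrib[of B 0 p]
  by (simp_all add: shifted_def matrix_vector_right_distrib matrix_vector_mult_diff_distrib vec_eq_iff algebra_simps)

lemma kernel_part_linear:
  "kernel_part B \<beta>2 \<beta>3 (p + q) = kernel_part B \<beta>2 \<beta>3 p + kernel_part B \<beta>2 \<beta>3 q"
  "kernel_part B \<beta>2 \<beta>3 (p - q) = kernel_part B \<beta>2 \<beta>3 p - kernel_part B \<beta>2 \<beta>3 q"
  "kernel_part B \<beta>2 \<beta>3 (- p) = - kernel_part B \<beta>2 \<beta>3 p"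
proof -
  show add: "kernel_part B \<beta>2 \<beta>3 (p + q) = kernel_part B \<beta>2 \<beta>3 p + kernel_part B \<beta>2 \<beta>3 q" for p q
    by (simp add: kernel_part_def matrix_vector_right_distrib vec_eq_iff algebra_simps)
  show diff: "kernel_part B \<beta>2 \<beta>3 (p - q) = kernel_part B \<beta>2 \<beta>3 p - kernel_part B \<beta>2 \<beta>3 q" for p q
    using add[of "p - q" q] by (simp add: algebra_simps)
  show "kernel_part B \<beta>2 \<beta>3 (- p) = - kernel_part B \<beta>2 \<beta>3 p"
    using diff[of 0 p] diff[of 0 0] by simp
qed

lemma coordinates_has_vector_derivative:
  assumes "(f has_vector_derivative f') (at x)"
  shows "((\<lambda>x. shifted B \<beta> (f x)) has_vector_derivative shifted B \<beta> f') (at x)"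
    "((\<lambda>x. kernel_part B \<beta>2 \<beta>3 (f x)) has_vector_derivative kernel_part B \<beta>2 \<beta>3 f') (at x)"
  unfolding shifted_def kernel_part_def
  by (intro has_vector_derivative_smult_const has_vector_derivative_add has_vector_derivative_diff
      has_vector_derivative_matrix assms)+

text \<open>The two coordinates put \<open>y' = B y\<close> into triangular form: \<open>\<omega> = kernel_part y\<close> is constant,
  \<open>u = shifted y + \<omega>\<close> satisfies \<open>u' = \<beta>2 u\<close>, and \<open>y' = \<beta>3 y + u - \<omega>\<close>. Unlike
  eigencoordinates these remain bounded in terms of \<open>y\<close> when \<open>\<beta>2\<close> tends to zero or meets \<open>\<beta>3\<close>.\<close>

lemma splitting_coordinates:
  assumes split: "splitting B \<beta>2 \<beta>3 R" and \<beta>2: "\<beta>2 \<noteq> 0"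
  shows "norm (shifted B \<beta>3 p) \<le> R * norm p" "norm (kernel_part B \<beta>2 \<beta>3 p) \<le> R * norm p"
    "kernel_part B \<beta>2 \<beta>3 (B *v p) = 0" "B *v kernel_part B \<beta>2 \<beta>3 p = 0"
    "shifted B \<beta>3 (B *v p) = \<beta>2 *s (shifted B \<beta>3 p + kernel_part B \<beta>2 \<beta>3 p)"
proof -
  have CH: "B *v (B *v (B *v p)) = (\<beta>2 + \<beta>3) *s (B *v (B *v p)) - (\<beta>2 * \<beta>3) *s (B *v p)"
    and R: "norm (B *v (B *v p) - (\<beta>2 + \<beta>3) *s (B *v p) + (\<beta>2 * \<beta>3) *s p) \<le> R * cmod \<beta>2 * norm p"
    using split by (simp_all add: splitting_def)
  show "norm (shifted B \<beta>3 p) \<le> R * norm p" using split by (simp add: splitting_def shifted_def)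
  show "norm (kernel_part B \<beta>2 \<beta>3 p) \<le> R * norm p"
    using R \<beta>2 unfolding kernel_part_def norm_smult_vec norm_divide
    by (simp add: pos_divide_le_eq) (simp add: mult_ac)
  show "kernel_part B \<beta>2 \<beta>3 (B *v p) = 0" by (simp add: kernel_part_def CH vec_eq_iff algebra_simps)
  show "B *v kernel_part B \<beta>2 \<beta>3 p = 0"
    by (simp add: kernel_part_def CH vec_eq_iff algebra_simps matrix_vector_right_distrib vector_scalar_commute
       matrix_vector_mult_diff_distrib)
  show "shifted B \<beta>3 (B *v p) = \<beta>2 *s (shifted B \<beta>3 p + kernel_part B \<beta>2 \<beta>3 p)"
    using \<beta>2 by (simp add: kernel_part_def shifted_def vec_eq_iff algebra_simps)
qed

text \<open>A solution that converges to a kernel vector of \<open>B\<close> is bounded by its limit, with a constant that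
  does not depend on how close \<open>\<beta>2\<close> is to zero. In the coordinates above one solves backwards from
  infinity: \<open>\<omega>\<close> moves only because of the perturbation \<open>e\<close>, then \<open>u\<close> starts from \<open>0\<close> at infinity, then
  \<open>y\<close> is damped by \<open>\<beta>3\<close>. Each step loses a multiple of \<open>k\<close> times the supremum \<open>S\<close> of \<open>y\<close>, and the
  smallness of \<open>k\<close> turns the result into \<open>S \<le> const + S / 2\<close>.\<close>

lemma tail_bound:
  fixes B :: "complex^'n^'n" and y e :: "real \<Rightarrow> complex^'n"
  assumes split: "splitting B \<beta>2 \<beta>3 R"
    and \<beta>2: "\<beta>2 \<noteq> 0" "0 \<le> Re \<beta>2" and c: "0 < c" and \<beta>3: "c \<le> Re \<beta>3" "cmod \<beta>3 \<le> R"
    and y: "\<And>x. X \<le> x \<Longrightarrow> (y has_vector_derivative (B *v y x + e x)) (at x)"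
    and e: "\<And>x. X \<le> x \<Longrightarrow> norm (e x) \<le> k * exp (- \<theta> * (x - X)) * norm (y x)"
    and \<theta>: "0 < \<theta>" and k: "0 \<le> k" "k * (3 * R / \<theta> + 1) \<le> c / 2"
    and V: "(y \<longlongrightarrow> V) at_top" "B *v V = 0"
    and x: "X \<le> x"
  shows "norm (y x) \<le> 2 * R / c * norm V"
proof -
  define P where "P = shifted B \<beta>3"
  define W where "W = kernel_part B \<beta>2 \<beta>3"
  note defs = P_def shifted_def W_def kernel_part_def
  note P_bound = splitting_coordinates(1)[OF split \<beta>2(1), folded P_def]
    and W_bound = splitting_coordinates(2)[OF split \<beta>2(1), folded W_def]
    and WB = splitting_coordinates(3)[OF split \<beta>2(1), folded W_def]
    and PB = splitting_coordinates(5)[OF split \<beta>2(1), folded P_def W_def]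
  note P_deriv = coordinates_has_vector_derivative(1)[where B = B and \<beta> = \<beta>3, folded P_def]
    and W_deriv = coordinates_has_vector_derivative(2)[where B = B and ?\<beta>2.0 = \<beta>2 and ?\<beta>3.0 = \<beta>3, folded W_def]
  note PW_add = shifted_linear(1)[where B = B and \<beta> = \<beta>3, folded P_def] kernel_part_linear(1)[where B = B and ?\<beta>2.0 = \<beta>2 and ?\<beta>3.0 = \<beta>3, folded W_def]
    and PW_diff = shifted_linear(2)[where B = B and \<beta> = \<beta>3, folded P_def] kernel_part_linear(2)[where B = B and ?\<beta>2.0 = \<beta>2 and ?\<beta>3.0 = \<beta>3, folded W_def]
  have R0: "0 \<le> R" using \<beta>3 norm_ge_zero[of \<beta>3] by linarith
  have cont: "continuous (at x) y" if "X \<le> x" for x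
    using y[OF that] by (rule has_vector_derivative_continuous)
  have "bdd_above ((\<lambda>x. norm (y x)) ` {X..})"
    using bounded_on_ray[OF cont V(1)] by (metis atLeast_iff bdd_aboveI2)
  define S where "S = (SUP x\<in>{X..}. norm (y x))"
  have S: "norm (y x) \<le> S" if "X \<le> x" for x
    unfolding S_def using that \<open>bdd_above _\<close> by (auto intro!: cSUP_upper)
  have S0: "0 \<le> S" using S[of X] norm_ge_zero[of "y X"] by linarith
  have eS: "norm (e x) \<le> k * S * exp (- \<theta> * (x - X))" if "X \<le> x" for x
  proof -
    have "k * exp (- \<theta> * (x - X)) * norm (y x) \<le> k * exp (- \<theta> * (x - X)) * S"
      using S[OF that] k by (intro mult_left_mono) auto
    with e[OF that] show ?thesis by (simp add: mult_ac)
  qed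
  have eS': "norm (e x) \<le> k * S" if "X \<le> x" for x
  proof -
    have "k * S * exp (- \<theta> * (x - X)) \<le> k * S * 1"
      using that k S0 \<theta> by (intro mult_left_mono) auto
    with eS[OF that] show ?thesis by linarith
  qed
  have WV: "W V = \<beta>3 *s V" and PV: "P V = - (\<beta>3 *s V)"
    using \<beta>2 by (simp_all add: defs V)
  have lim0: "((\<lambda>x. R * norm (y x - V)) \<longlongrightarrow> R * 0) at_top"
    using V(1) by (intro tendsto_mult tendsto_const) (simp add: tendsto_norm_zero_iff Lim_null[symmetric])
  have yW: "((\<lambda>x. W (y x)) \<longlongrightarrow> \<beta>3 *s V) at_top"
    unfolding Lim_null[of _ "\<beta>3 *s V"]
    by (rule Lim_null_comparison[OF always_eventually lim0[unfolded mult_zero_right]])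
      (simp add: WV[symmetric] PW_diff[symmetric] W_bound)
  have "((\<lambda>x. P (y x)) \<longlongrightarrow> P V) at_top"
    unfolding Lim_null[of _ "P V"]
    by (rule Lim_null_comparison[OF always_eventually lim0[unfolded mult_zero_right]])
      (simp add: PW_diff[symmetric] P_bound)
  from tendsto_add[OF this yW] have yP: "((\<lambda>x. P (y x) + W (y x)) \<longlongrightarrow> 0) at_top"
    by (simp add: PV)
  have W_est: "norm (W (y x)) \<le> R * norm V + R * k * S / \<theta>" if "X \<le> x" for x
  proof -
    have "norm (W (y x)) \<le> norm (\<beta>3 *s V) + (R * k * S) / \<theta>"
    proof (rule backward_from_infinity[where \<beta> = 0 and g = "\<lambda>x. W (e x)"])
      fix s assume s: "X \<le> s"
      show "((\<lambda>x. W (y x)) has_vector_derivative 0 *s W (y s) + W (e s)) (at s)"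
        using W_deriv[OF y[OF s]] by (simp add: PW_add WB)
      show "norm (W (e s)) \<le> R * k * S * exp (- \<theta> * (s - X))"
        using W_bound[of "e s"] mult_left_mono[OF eS[OF s] R0] by (simp add: mult_ac)
    qed (use \<theta> yW that in auto)
    moreover have "norm (\<beta>3 *s V) \<le> R * norm V"
      using \<beta>3 by (simp add: norm_smult_vec mult_right_mono)
    ultimately show ?thesis by linarith
  qed
  have u_est: "norm (P (y x) + W (y x)) \<le> 2 * R * k * S / \<theta>" if "X \<le> x" for x
  proof -
    have "norm (P (y x) + W (y x)) \<le> norm (0 :: complex^'n) + (2 * R * k * S) / \<theta>"
    proof (rule backward_from_infinity[where \<beta> = \<beta>2 and g = "\<lambda>x. P (e x) + W (e x)"])
      fix s assume s: "X \<le> s"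
      show "((\<lambda>x. P (y x) + W (y x)) has_vector_derivative \<beta>2 *s (P (y s) + W (y s)) + (P (e s) + W (e s))) (at s)"
        by (rule has_vector_derivative_eq_rhs[OF has_vector_derivative_add[OF P_deriv[OF y[OF s]] W_deriv[OF y[OF s]]]])
          (simp add: PW_add WB PB)
      show "norm (P (e s) + W (e s)) \<le> 2 * R * k * S * exp (- \<theta> * (s - X))"
        using norm_triangle_ineq[of "P (e s)" "W (e s)"] P_bound[of "e s"] W_bound[of "e s"]
          mult_left_mono[OF eS[OF s] R0] by (simp add: mult_ac)
    qed (use \<theta> yP that \<beta>2 in auto)
    then show ?thesis by simp
  qed
  have "norm (y x) \<le> R / c * norm V + S / 2" if "X \<le> x" for x
  proof -
    have "norm (y x) \<le> (R * norm V + 3 * R * k * S / \<theta> + k * S) / c"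
    proof (rule backward_from_infinity_damped[where \<beta> = \<beta>3 and g = "\<lambda>x. (P (y x) + W (y x)) - W (y x) + e x"])
      fix s assume s: "X \<le> s"
      show "(y has_vector_derivative \<beta>3 *s y s + (P (y s) + W (y s) - W (y s) + e s)) (at s)"
        by (rule has_vector_derivative_eq_rhs[OF y[OF s]]) (simp add: defs)
      have "norm (P (y s) + W (y s) - W (y s) + e s)
          \<le> (2 * R * k * S / \<theta> + (R * norm V + R * k * S / \<theta>)) + k * S"
        by (rule order_trans[OF norm_triangle_ineq add_mono[OF order_trans[OF norm_triangle_ineq4
            add_mono[OF u_est[OF s] W_est[OF s]]] eS'[OF s]]])
      also have "\<dots> = R * norm V + 3 * R * k * S / \<theta> + k * S"
        using add_divide_distrib[of "2 * R * k * S" "R * k * S" \<theta>] by simp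
      finally show "norm (P (y s) + W (y s) - W (y s) + e s) \<le> R * norm V + 3 * R * k * S / \<theta> + k * S" .
    qed (use V that \<beta>3 c in auto)
    also have "\<dots> = R / c * norm V + (k * (3 * R / \<theta> + 1)) * S / c"
      using c \<theta> by (simp add: field_simps)
    also have "\<dots> \<le> R / c * norm V + (c / 2) * S / c"
      using k c S0 by (intro add_left_mono divide_right_mono mult_right_mono) auto
    finally show ?thesis using c by simp
  qed
  then have "S \<le> R / c * norm V + S / 2"
    unfolding S_def[symmetric] by (subst S_def, intro cSUP_least) (auto simp: S_def)
  with S[OF x] show ?thesis by (simp add: field_simps)
qed

lemma gronwall_forward:
  fixes N :: "real \<Rightarrow> real"
  assumes "a \<le> b"
    and N: "\<And>x. a \<le> x \<Longrightarrow> x \<le> b \<Longrightarrow> (N has_real_derivative N' x) (at x)"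
    and \<Phi>: "\<And>x. a \<le> x \<Longrightarrow> x \<le> b \<Longrightarrow> (\<Phi> has_real_derivative \<phi> x) (at x)"
    and le: "\<And>x. a \<le> x \<Longrightarrow> x \<le> b \<Longrightarrow> N' x \<le> \<phi> x * N x"
  shows "N b \<le> N a * exp (\<Phi> b - \<Phi> a)"
proof -
  have "N b * exp (- \<Phi> b) \<le> N a * exp (- \<Phi> a)"
  proof (rule DERIV_nonpos_imp_nonincreasing[OF \<open>a \<le> b\<close>])
    fix x assume x: "a \<le> x" "x \<le> b"
    have "((\<lambda>x. N x * exp (- \<Phi> x)) has_real_derivative (N' x - \<phi> x * N x) * exp (- \<Phi> x)) (at x)"
      by (auto intro!: derivative_eq_intros N[OF x] \<Phi>[OF x] simp: algebra_simps)
    moreover have "(N' x - \<phi> x * N x) * exp (- \<Phi> x) \<le> 0"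
      using le[OF x] by (intro mult_nonpos_nonneg) auto
    ultimately show "\<exists>y. ((\<lambda>x. N x * exp (- \<Phi> x)) has_real_derivative y) (at x) \<and> y \<le> 0"
      by blast
  qed
  then have "N b * exp (- \<Phi> b) * exp (\<Phi> b) \<le> N a * exp (- \<Phi> a) * exp (\<Phi> b)"
    by (rule mult_right_mono) simp
  then show ?thesis by (simp add: mult.assoc flip: exp_add)
qed

lemma gronwall_backward:
  fixes N :: "real \<Rightarrow> real"
  assumes "a \<le> b"
    and N: "\<And>x. a \<le> x \<Longrightarrow> x \<le> b \<Longrightarrow> (N has_real_derivative N' x) (at x)"
    and \<Phi>: "\<And>x. a \<le> x \<Longrightarrow> x \<le> b \<Longrightarrow> (\<Phi> has_real_derivative \<phi> x) (at x)"
    and ge: "\<And>x. a \<le> x \<Longrightarrow> x \<le> b \<Longrightarrow> - (\<phi> x * N x) \<le> N' x"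
  shows "N a \<le> N b * exp (\<Phi> b - \<Phi> a)"
proof -
  have "- N b \<le> - N a * exp (- \<Phi> b - - \<Phi> a)"
    by (rule gronwall_forward[OF \<open>a \<le> b\<close>, where N' = "\<lambda>x. - N' x" and \<phi> = "\<lambda>x. - \<phi> x"])
      (use ge in \<open>auto intro!: derivative_intros N \<Phi> simp: minus_le_iff\<close>)
  then have "N a * exp (\<Phi> a - \<Phi> b) * exp (\<Phi> b - \<Phi> a) \<le> N b * exp (\<Phi> b - \<Phi> a)"
    by (intro mult_right_mono) auto
  then show ?thesis by (simp add: mult.assoc flip: exp_add)
qed

lemma linear_ode_zero:
  fixes y :: "real \<Rightarrow> 'a::real_inner"
  assumes y: "\<And>x. (y has_vector_derivative y' x) (at x)"
    and le: "\<And>x. norm (y' x) \<le> C * norm (y x)" and a: "y a = 0"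
  shows "y x = 0"
proof -
  have d: "((\<lambda>x. (norm (y x))\<^sup>2) has_real_derivative 2 * inner (y x) (y' x)) (at x)" for x
    by (rule norm_sq_has_real_derivative[OF y])
  have "\<bar>inner (y x) (y' x)\<bar> \<le> C * (norm (y x))\<^sup>2" for x
    using Cauchy_Schwarz_ineq2[of "y x" "y' x"] mult_left_mono[OF le[of x] norm_ge_zero[of "y x"]]
    by (simp add: power2_eq_square mult_ac)
  then have b: "2 * inner (y x) (y' x) \<le> (2 * C) * (norm (y x))\<^sup>2"
     "- ((2 * C) * (norm (y x))\<^sup>2) \<le> 2 * inner (y x) (y' x)" for x
    by (simp_all add: abs_le_iff mult.assoc) (metis minus_le_iff)
  have \<Phi>: "((\<lambda>x. 2 * C * x) has_real_derivative 2 * C) (at x)" for x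
    by (auto intro!: derivative_eq_intros)
  have "(norm (y x))\<^sup>2 \<le> 0"
  proof (cases "a \<le> x")
    case True
    from gronwall_forward[OF this d \<Phi> b(1)] show ?thesis by (simp add: a)
  next
    case False
    then have "x \<le> a" by simp
    from gronwall_backward[OF this d \<Phi> b(2)] show ?thesis by (simp add: a)
  qed
  then show ?thesis by simp
qed

lemma exp_small_derivative_converges:
  fixes f :: "real \<Rightarrow> 'a::banach"
  assumes f: "\<And>x. 0 \<le> x \<Longrightarrow> (f has_vector_derivative f' x) (at x)"
    and le: "\<And>x. 0 \<le> x \<Longrightarrow> norm (f' x) \<le> G * exp (- \<theta> * x)" and \<theta>: "0 < \<theta>"
  obtains L where "(f \<longlongrightarrow> L) at_top" "\<And>x. 0 \<le> x \<Longrightarrow> norm (f x - L) \<le> G / \<theta> * exp (- \<theta> * x)"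
proof -
  have G: "0 \<le> G" using order_trans[OF norm_ge_zero le[of 0]] by simp
  have diff: "norm (f b - f a) \<le> G / \<theta> * exp (- \<theta> * a)" if "0 \<le> a" "a \<le> b" for a b
  proof (cases "a = b")
    case False
    have "norm (f b - f a) \<le> - (G / \<theta>) * exp (- \<theta> * b) - - (G / \<theta>) * exp (- \<theta> * a)"
    proof (rule differentiable_bound_general[where f' = f' and \<phi>' = "\<lambda>s. G * exp (- \<theta> * s)"])
      show "continuous_on {a..b} f"
        using that by (intro continuous_at_imp_continuous_on) (auto intro!: has_vector_derivative_continuous[OF f])
      show "((\<lambda>s. - (G / \<theta>) * exp (- \<theta> * s)) has_vector_derivative G * exp (- \<theta> * x)) (at x)" for x
        using \<theta> by (auto intro!: derivative_eq_intros simp flip: has_real_derivative_iff_has_vector_derivative)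
    qed (use that False f le in \<open>auto intro!: continuous_intros simp: \<theta>[THEN less_imp_neq, symmetric]\<close>)
    moreover have "0 \<le> G / \<theta> * exp (- \<theta> * b)" using G \<theta> by simp
    ultimately show ?thesis by simp
  qed (use G \<theta> in auto)
  note e0 = exp_decay_at_top[OF \<theta>, of "G / \<theta>"]
  have "Cauchy (\<lambda>n. f (real n))"
  proof (rule CauchyI)
    fix e :: real assume "0 < e"
    then have "\<forall>\<^sub>F x in at_top. G / \<theta> * exp (- \<theta> * x) < e / 2"
      using e0 by (intro order_tendstoD) auto
    then obtain b where b: "\<And>x. b \<le> x \<Longrightarrow> G / \<theta> * exp (- \<theta> * x) < e / 2"
      by (auto simp: eventually_at_top_linorder)
    obtain M where M: "b \<le> real M" using real_arch_simple by blast
    have "norm (f (real m) - f (real n)) < e" if "M \<le> m" "M \<le> n" for m n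
    proof -
      have "norm (f (real m) - f (real M)) < e / 2" "norm (f (real n) - f (real M)) < e / 2"
        using that by (intro le_less_trans[OF diff b[OF M]]; simp)+
      then show ?thesis
        using norm_diff_triangle_less[of "f (real m)" "f (real M)" "e / 2" "f (real n)" "e / 2"]
        by (simp add: norm_minus_commute)
    qed
    then show "\<exists>M. \<forall>m\<ge>M. \<forall>n\<ge>M. norm (f (real m) - f (real n)) < e" by blast
  qed
  then obtain L where L: "(\<lambda>n. f (real n)) \<longlonglongrightarrow> L"
    by (auto simp: Cauchy_convergent_iff convergent_def)
  have est: "norm (f x - L) \<le> G / \<theta> * exp (- \<theta> * x)" if "0 \<le> x" for x
  proof -
    have "(\<lambda>n. norm (f (real n) - f x)) \<longlonglongrightarrow> norm (L - f x)"
      by (intro tendsto_intros L)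
    moreover have "\<forall>\<^sub>F n in sequentially. norm (f (real n) - f x) \<le> G / \<theta> * exp (- \<theta> * x)"
    proof -
      obtain M where M: "x \<le> real M" using real_arch_simple by blast
      show ?thesis
        using M that by (intro eventually_sequentiallyI[of M] diff) auto
    qed
    ultimately have "norm (L - f x) \<le> G / \<theta> * exp (- \<theta> * x)"
      by (intro tendsto_upperbound) auto
    then show ?thesis by (simp add: norm_minus_commute)
  qed
  have "(f \<longlongrightarrow> L) at_top"
    unfolding Lim_null[of _ L]
    by (rule Lim_null_comparison[OF _ e0]) (use est in \<open>auto intro: eventually_at_top_linorderI[of 0]\<close>)
  with est show ?thesis using that by blast
qed

text \<open>Here \<open>\<beta>2\<close> and \<open>\<beta>3\<close> have real part at least \<open>m\<close>, so \<open>q' = - B q\<close> contracts every direction except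
  the kernel and \<open>q\<close> converges to a kernel vector, at a rate that depends only on the constants. The
  coordinates are \<open>w\<close> (\<open>\<omega>\<close> of the splitting), \<open>u\<close> as before, and \<open>s = q - w / \<beta>3\<close>. The Lyapunov
  function \<open>T = |w|\<^sup>2 + |s|\<^sup>2 + |u|\<^sup>2 / m\<^sup>2\<close> stays bounded; its part \<open>Q\<close> without \<open>w\<close> decays, because the
  weight \<open>1 / m\<^sup>2\<close> on \<open>u\<close> absorbs the coupling of \<open>s\<close> to \<open>u\<close>. The perturbation is an integrable
  multiple of \<open>T\<close> in both estimates.\<close>

lemma forward_converge:
  fixes m \<theta> R k :: real
  assumes m: "0 < m" and \<theta>: "0 < \<theta>" and k: "0 \<le> k" and R0: "0 \<le> R"
  obtains C \<kappa> where "0 < \<kappa>" "0 \<le> C"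
    "\<And>(B :: complex^'n^'n) \<beta>2 \<beta>3 q e.
      \<lbrakk>splitting B \<beta>2 \<beta>3 R; m \<le> Re \<beta>2; m \<le> Re \<beta>3;
       \<And>x. 0 \<le> x \<Longrightarrow> (q has_vector_derivative (- (B *v q x) - e x)) (at x);
       \<And>x. 0 \<le> x \<Longrightarrow> norm (e x) \<le> k * exp (- \<theta> * x) * norm (q x)\<rbrakk> \<Longrightarrow>
      \<exists>L. B *v L = 0 \<and> (\<forall>x\<ge>0. norm (q x - L) \<le> C * exp (- \<kappa> * x) * norm (q 0))"
proof -
  define K where "K = k * (1 + 1 / m) * (2 * R + 2 + 6 * R / m)"
  define M where "M = R\<^sup>2 + (1 + R / m)\<^sup>2 + 4 * R\<^sup>2 / m\<^sup>2"
  define Tb where "Tb = M * exp (K / \<theta>)"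
  define \<kappa> where "\<kappa> = min m \<theta> / 2"
  define C where "C = sqrt ((1 + K / \<kappa>) * Tb) + R * k * (1 + 1 / m) * sqrt Tb / \<theta> / m"
  have K0: "0 \<le> K" and M0: "0 \<le> M" using m R0 k by (auto simp: K_def M_def)
  then have Tb0: "0 \<le> Tb" by (simp add: Tb_def)
  have \<kappa>: "0 < \<kappa>" "2 * \<kappa> \<le> m" "2 * \<kappa> \<le> \<theta>" using m \<theta> by (auto simp: \<kappa>_def)
  have C0: "0 \<le> C" using K0 Tb0 \<kappa> R0 k m \<theta> by (simp add: C_def)
  show ?thesis
  proof (rule that[of "\<kappa> / 2" C])
    show "0 < \<kappa> / 2" "0 \<le> C" using \<kappa> C0 by auto
    fix B :: "complex^'n^'n" and \<beta>2 \<beta>3 :: complex and q e :: "real \<Rightarrow> complex^'n"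
    assume split: "splitting B \<beta>2 \<beta>3 R"
      and re: "m \<le> Re \<beta>2" "m \<le> Re \<beta>3"
      and q: "\<And>x. 0 \<le> x \<Longrightarrow> (q has_vector_derivative (- (B *v q x) - e x)) (at x)"
      and e: "\<And>x. 0 \<le> x \<Longrightarrow> norm (e x) \<le> k * exp (- \<theta> * x) * norm (q x)"
    have \<beta>2: "\<beta>2 \<noteq> 0" and \<beta>3: "\<beta>3 \<noteq> 0" using re m by auto
    have m\<beta>3: "m \<le> cmod \<beta>3" using re(2) complex_Re_le_cmod[of \<beta>3] by linarith
    define P where "P = shifted B \<beta>3"
    define W where "W = kernel_part B \<beta>2 \<beta>3"
    note defs = P_def shifted_def W_def kernel_part_def
    note P_bound = splitting_coordinates(1)[OF split \<beta>2, folded P_def]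
      and W_bound = splitting_coordinates(2)[OF split \<beta>2, folded W_def]
      and WB = splitting_coordinates(3)[OF split \<beta>2, folded W_def]
      and PB = splitting_coordinates(5)[OF split \<beta>2, folded P_def W_def]
    note P_deriv = coordinates_has_vector_derivative(1)[where B = B and \<beta> = \<beta>3, folded P_def]
      and W_deriv = coordinates_has_vector_derivative(2)[where B = B and ?\<beta>2.0 = \<beta>2 and ?\<beta>3.0 = \<beta>3, folded W_def]
    note PW_add = shifted_linear(1)[where B = B and \<beta> = \<beta>3, folded P_def] kernel_part_linear(1)[where B = B and ?\<beta>2.0 = \<beta>2 and ?\<beta>3.0 = \<beta>3, folded W_def]
      and PW_diff = shifted_linear(2)[where B = B and \<beta> = \<beta>3, folded P_def] kernel_part_linear(2)[where B = B and ?\<beta>2.0 = \<beta>2 and ?\<beta>3.0 = \<beta>3, folded W_def]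
    note BW = splitting_coordinates(4)[OF split \<beta>2, folded W_def]
    note PW_neg = shifted_linear(3)[where B = B and \<beta> = \<beta>3, folded P_def] kernel_part_linear(3)[where B = B and ?\<beta>2.0 = \<beta>2 and ?\<beta>3.0 = \<beta>3, folded W_def]
    define w where "w x = W (q x)" for x
    define u where "u x = P (q x) + W (q x)" for x
    define s where "s x = q x - (1 / \<beta>3) *s w x" for x
    have dw: "(w has_vector_derivative - W (e x)) (at x)" if "0 \<le> x" for x
      unfolding w_def using W_deriv[OF q[OF that]] by (simp add: PW_diff PW_neg WB)
    have du: "(u has_vector_derivative - (\<beta>2 *s u x) - (P (e x) + W (e x))) (at x)" if "0 \<le> x" for x
      unfolding u_def
      by (rule has_vector_derivative_eq_rhs[OF has_vector_derivative_add[OF P_deriv W_deriv, OF q q, OF that that]])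
        (simp add: PW_diff PW_neg WB PB)
    have ds: "(s has_vector_derivative - (\<beta>3 *s s x) - u x + ((1 / \<beta>3) *s W (e x) - e x)) (at x)" if "0 \<le> x" for x
      unfolding s_def
      by (rule has_vector_derivative_eq_rhs[OF has_vector_derivative_diff[OF q[OF that] has_vector_derivative_smult_const[OF dw[OF that]]]])
        (use \<beta>3 in \<open>simp add: u_def P_def shifted_def vec_eq_iff algebra_simps w_def\<close>)
    define T where "T x = (norm (w x))\<^sup>2 + (norm (s x))\<^sup>2 + (norm (u x))\<^sup>2 / m\<^sup>2" for x
    define T' where "T' x = 2 * inner (w x) (- W (e x))
        + 2 * inner (s x) (- (\<beta>3 *s s x) - u x + ((1 / \<beta>3) *s W (e x) - e x))
        + 2 * inner (u x) (- (\<beta>2 *s u x) - (P (e x) + W (e x))) / m\<^sup>2" for x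
    have dT: "(T has_real_derivative T' x) (at x)" if "0 \<le> x" for x
      unfolding T_def T'_def
      by (intro DERIV_add DERIV_cdivide norm_sq_has_real_derivative dw[OF that] ds[OF that] du[OF that])
    define Q where "Q x = (norm (s x))\<^sup>2 + (norm (u x))\<^sup>2 / m\<^sup>2" for x
    define Q' where "Q' x =
         2 * inner (s x) (- (\<beta>3 *s s x) - u x + ((1 / \<beta>3) *s W (e x) - e x))
        + 2 * inner (u x) (- (\<beta>2 *s u x) - (P (e x) + W (e x))) / m\<^sup>2" for x
    have dQ: "(Q has_real_derivative Q' x) (at x)" if "0 \<le> x" for x
      unfolding Q_def Q'_def
      by (intro DERIV_add DERIV_cdivide norm_sq_has_real_derivative dw[OF that] ds[OF that] du[OF that])
    have T0: "0 \<le> T x" for x by (simp add: T_def)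
    have nw: "norm (w x) \<le> sqrt (T x)" and ns: "norm (s x) \<le> sqrt (T x)" and nu: "norm (u x) \<le> m * sqrt (T x)" for x
    proof -
      show "norm (w x) \<le> sqrt (T x)" "norm (s x) \<le> sqrt (T x)"
        by (auto simp: T_def intro!: real_le_rsqrt)
      have "(norm (u x))\<^sup>2 / m\<^sup>2 \<le> T x" by (simp add: T_def)
      then have "norm (u x) / m \<le> sqrt (T x)"
        by (intro real_le_rsqrt) (simp add: power_divide)
      then show "norm (u x) \<le> m * sqrt (T x)" using m by (simp add: field_simps)
    qed
    have nq: "norm (q x) \<le> (1 + 1 / m) * sqrt (T x)" for x
    proof -
      have "norm (q x) \<le> norm (s x) + norm (1 / \<beta>3 *s w x)"
        unfolding s_def by (metis norm_minus_commute norm_triangle_sub add.commute norm_triangle_ineq diff_add_cancel)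
      also have "norm (1 / \<beta>3 *s w x) \<le> 1 / m * norm (w x)"
        unfolding norm_smult_vec using m\<beta>3 m by (intro mult_right_mono) (auto simp: norm_divide frac_le)
      also have "\<dots> \<le> 1 / m * sqrt (T x)" using m nw[of x] by (intro mult_left_mono) auto
      finally show ?thesis using ns[of x] by (simp add: algebra_simps)
    qed
    have ne: "norm (e x) \<le> k * exp (- \<theta> * x) * ((1 + 1 / m) * sqrt (T x))" if "0 \<le> x" for x
      using e[OF that] mult_left_mono[OF nq[of x], of "k * exp (- \<theta> * x)"] k by simp
    have small: "norm (e x) * (c * sqrt (T x)) \<le> k * (1 + 1 / m) * c * exp (- \<theta> * x) * T x" if "0 \<le> x" "0 \<le> c" for x c
    proof -
      have "norm (e x) * (c * sqrt (T x)) \<le> (k * exp (- \<theta> * x) * ((1 + 1 / m) * sqrt (T x))) * (c * sqrt (T x))"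
        using ne that T0 by (intro mult_right_mono) auto
      also have "\<dots> = k * (1 + 1 / m) * c * exp (- \<theta> * x) * (sqrt (T x) * sqrt (T x))"
        by (simp add: mult_ac)
      finally show ?thesis using T0 by simp
    qed
    have Qle: "Q' x \<le> - m * Q x + norm (e x) * ((2 + 6 * R / m) * sqrt (T x))" for x
    proof -
      have "inner (s x) (\<beta>3 *s s x) \<ge> m * (norm (s x))\<^sup>2"
        unfolding inner_smult_self using re by (intro mult_right_mono) auto
      moreover have "inner (u x) (\<beta>2 *s u x) \<ge> m * (norm (u x))\<^sup>2"
        unfolding inner_smult_self using re by (intro mult_right_mono) auto
      moreover have "- inner (s x) (u x) \<le> norm (s x) * norm (u x)"
        using norm_cauchy_schwarz[of "s x" "- u x"] by simp
      moreover have "2 * (norm (s x) * norm (u x)) \<le> m * (norm (s x))\<^sup>2 + (norm (u x))\<^sup>2 / m"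
      proof -
        have "0 \<le> (m * norm (s x) - norm (u x))\<^sup>2 / m" using m by simp
        also have "\<dots> = m * (norm (s x))\<^sup>2 + (norm (u x))\<^sup>2 / m - 2 * (norm (s x) * norm (u x))"
          using m by (simp add: power2_eq_square field_simps)
        finally show ?thesis by simp
      qed
      moreover have "inner (s x) ((1 / \<beta>3) *s W (e x) - e x) \<le> sqrt (T x) * ((1 + R / m) * norm (e x))"
      proof -
        have "norm (1 / \<beta>3 *s W (e x)) \<le> 1 / m * norm (W (e x))"
          unfolding norm_smult_vec using m\<beta>3 m by (intro mult_right_mono) (auto simp: norm_divide frac_le)
        also have "\<dots> \<le> 1 / m * (R * norm (e x))" using m W_bound by (intro mult_left_mono) auto
        finally have "norm ((1 / \<beta>3) *s W (e x) - e x) \<le> (1 + R / m) * norm (e x)"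
          using norm_triangle_ineq4[of "1 / \<beta>3 *s W (e x)" "e x"] by (simp add: algebra_simps)
        then have "norm (s x) * norm ((1 / \<beta>3) *s W (e x) - e x) \<le> sqrt (T x) * ((1 + R / m) * norm (e x))"
          using ns T0 by (intro mult_mono) auto
        then show ?thesis using norm_cauchy_schwarz order_trans by blast
      qed
      moreover have "- inner (u x) (P (e x) + W (e x)) \<le> m * sqrt (T x) * (2 * R * norm (e x))"
      proof -
        have "norm (P (e x) + W (e x)) \<le> 2 * R * norm (e x)"
          using norm_triangle_ineq[of "P (e x)" "W (e x)"] P_bound[of "e x"] W_bound[of "e x"] by simp
        then have "norm (u x) * norm (P (e x) + W (e x)) \<le> m * sqrt (T x) * (2 * R * norm (e x))"
          using nu T0 m by (intro mult_mono) auto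
        then show ?thesis using Cauchy_Schwarz_ineq2[of "u x" "P (e x) + W (e x)"] by linarith
      qed
      ultimately have "Q' x \<le> - 2 * m * (norm (s x))\<^sup>2 + (m * (norm (s x))\<^sup>2 + (norm (u x))\<^sup>2 / m)
          + 2 * (sqrt (T x) * ((1 + R / m) * norm (e x)))
          + (2 * (m * sqrt (T x) * (2 * R * norm (e x))) - 2 * (m * (norm (u x))\<^sup>2)) / m\<^sup>2"
        unfolding Q'_def using m
        by (intro add_mono order_trans[OF eq_refl[OF mult_2_right]] divide_right_mono) (auto simp: inner_add_right inner_diff_right)
      also have "\<dots> = - m * Q x + norm (e x) * ((2 + 6 * R / m) * sqrt (T x))"
        using m by (simp add: Q_def power2_eq_square field_simps)
      finally show ?thesis .
    qed
    have Tle: "T' x \<le> - m * Q x + norm (e x) * ((2 * R + 2 + 6 * R / m) * sqrt (T x))" for x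
    proof -
      have "inner (w x) (- W (e x)) \<le> norm (w x) * norm (W (e x))"
        using norm_cauchy_schwarz[of "w x" "- W (e x)"] by simp
      also have "\<dots> \<le> sqrt (T x) * (R * norm (e x))"
        using nw W_bound T0 by (intro mult_mono) auto
      finally show ?thesis
        using Qle[of x] by (simp add: T'_def Q'_def algebra_simps)
    qed
    have Q0: "0 \<le> Q x" for x by (simp add: Q_def)
    have Tle': "T' x \<le> K * exp (- \<theta> * x) * T x" if "0 \<le> x" for x
      using Tle[of x] small[OF that, of "2 * R + 2 + 6 * R / m"] mult_nonneg_nonneg[OF less_imp_le[OF m] Q0[of x]] R0 m
      by (simp add: K_def mult.assoc)
    have Tx: "T x \<le> Tb * (norm (q 0))\<^sup>2" if "0 \<le> x" for x
    proof -
      have "T x \<le> T 0 * exp (- (K / \<theta>) * exp (- \<theta> * x) - - (K / \<theta>) * exp (- \<theta> * 0))"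
      proof (rule gronwall_forward[OF that, where N' = T' and \<phi> = "\<lambda>x. K * exp (- \<theta> * x)"])
        show "((\<lambda>b. - (K / \<theta>) * exp (- \<theta> * b)) has_real_derivative K * exp (- \<theta> * x)) (at x)" for x
          using \<theta> by (auto intro!: derivative_eq_intros)
      qed (use dT Tle' in auto)
      also have "\<dots> \<le> T 0 * exp (K / \<theta>)"
        using T0 K0 \<theta> by (intro mult_left_mono) auto
      also have "T 0 \<le> M * (norm (q 0))\<^sup>2"
      proof -
        have 1: "norm (w 0) \<le> R * norm (q 0)" by (simp add: w_def W_bound)
        have 2: "norm (u 0) \<le> 2 * R * norm (q 0)"
          using norm_triangle_ineq[of "P (q 0)" "W (q 0)"] P_bound[of "q 0"] W_bound[of "q 0"] by (simp add: u_def)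
        have "norm (1 / \<beta>3 *s w 0) \<le> 1 / m * norm (w 0)"
          unfolding norm_smult_vec using m\<beta>3 m by (intro mult_right_mono) (auto simp: norm_divide frac_le)
        also have "\<dots> \<le> 1 / m * (R * norm (q 0))" using m 1 by (intro mult_left_mono) auto
        finally have 3: "norm (s 0) \<le> (1 + R / m) * norm (q 0)"
          using norm_triangle_ineq4[of "q 0" "1 / \<beta>3 *s w 0"] by (simp add: s_def algebra_simps)
        have "T 0 \<le> (R * norm (q 0))\<^sup>2 + ((1 + R / m) * norm (q 0))\<^sup>2 + (2 * R * norm (q 0))\<^sup>2 / m\<^sup>2"
          unfolding T_def using 1 2 3 by (intro add_mono divide_right_mono power_mono) auto
        then show ?thesis unfolding M_def power_mult_distrib by (simp add: distrib_right)
      qed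
      finally show ?thesis by (simp add: Tb_def mult_ac)
    qed
    have sT: "sqrt (T x) \<le> sqrt Tb * norm (q 0)" if "0 \<le> x" for x
      using real_sqrt_le_mono[OF Tx[OF that]] by (simp add: real_sqrt_mult)
    have sx: "norm (s x) \<le> sqrt ((1 + K / \<kappa>) * Tb) * exp (- (\<kappa> / 2) * x) * norm (q 0)" if x: "0 \<le> x" for x
    proof -
      (* The second summand is a primitive that absorbs the source term K exp (- theta x) T. *)
      let ?F = "\<lambda>x. Q x * exp (\<kappa> * x) + (K * Tb * (norm (q 0))\<^sup>2 / \<kappa>) * exp (- \<kappa> * x)"
      have "?F x \<le> ?F 0"
      proof (rule DERIV_nonpos_imp_nonincreasing[OF x])
        fix t assume t: "0 \<le> t" "t \<le> x"
        have "(?F has_real_derivative (Q' t + \<kappa> * Q t) * exp (\<kappa> * t) - K * Tb * (norm (q 0))\<^sup>2 * exp (- \<kappa> * t)) (at t)"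
          using \<kappa> by (auto intro!: derivative_eq_intros dQ[OF t(1)] simp: algebra_simps)
        moreover have "(Q' t + \<kappa> * Q t) * exp (\<kappa> * t) \<le> K * Tb * (norm (q 0))\<^sup>2 * exp (- \<kappa> * t)"
        proof -
          have "norm (e t) * ((2 + 6 * R / m) * sqrt (T t)) \<le> K * exp (- \<theta> * t) * T t"
          proof -
            have "norm (e t) * ((2 + 6 * R / m) * sqrt (T t)) \<le> norm (e t) * ((2 * R + 2 + 6 * R / m) * sqrt (T t))"
              using R0 T0 by (intro mult_left_mono mult_right_mono) auto
            with small[OF t(1), of "2 * R + 2 + 6 * R / m"] R0 m show ?thesis by (simp add: K_def mult.assoc)
          qed
          also have "\<dots> \<le> K * exp (- \<theta> * t) * (Tb * (norm (q 0))\<^sup>2)"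
            using K0 Tx[OF t(1)] by (intro mult_left_mono) auto
          finally have "Q' t + \<kappa> * Q t \<le> K * exp (- \<theta> * t) * (Tb * (norm (q 0))\<^sup>2)"
            using Qle[of t] mult_right_mono[of \<kappa> m "Q t"] \<kappa> Q0[of t] by simp
          then have "(Q' t + \<kappa> * Q t) * exp (\<kappa> * t) \<le> K * exp (- \<theta> * t) * (Tb * (norm (q 0))\<^sup>2) * exp (\<kappa> * t)"
            by (rule mult_right_mono) simp
          also have "\<dots> = K * Tb * (norm (q 0))\<^sup>2 * exp ((\<kappa> - \<theta>) * t)"
            by (simp add: left_diff_distrib exp_diff exp_minus field_simps)
          also have "\<dots> \<le> K * Tb * (norm (q 0))\<^sup>2 * exp (- \<kappa> * t)"
            using K0 Tb0 \<kappa> t mult_right_mono[of "\<kappa> - \<theta>" "- \<kappa>" t] by (intro mult_left_mono) auto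
          finally show ?thesis .
        qed
        ultimately show "\<exists>y. (?F has_real_derivative y) (at t) \<and> y \<le> 0" by (intro exI conjI) auto
      qed
      moreover have "Q 0 \<le> Tb * (norm (q 0))\<^sup>2"
        using Tx[of 0] by (simp add: Q_def T_def add.assoc) (smt (verit) zero_le_power2)
      moreover have "0 \<le> (K * Tb * (norm (q 0))\<^sup>2 / \<kappa>) * exp (- \<kappa> * x)"
        using K0 Tb0 \<kappa> by simp
      moreover have "(1 + K / \<kappa>) * Tb * (norm (q 0))\<^sup>2 = Tb * (norm (q 0))\<^sup>2 + K * Tb * (norm (q 0))\<^sup>2 / \<kappa>"
        by (simp add: algebra_simps)
      ultimately have "Q x * exp (\<kappa> * x) \<le> (1 + K / \<kappa>) * Tb * (norm (q 0))\<^sup>2"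
        by simp
      then have "Q x * exp (\<kappa> * x) * exp (- \<kappa> * x) \<le> (1 + K / \<kappa>) * Tb * (norm (q 0))\<^sup>2 * exp (- \<kappa> * x)"
        by (rule mult_right_mono) simp
      then have "Q x \<le> (1 + K / \<kappa>) * Tb * exp (- \<kappa> * x) * (norm (q 0))\<^sup>2"
        by (simp add: mult_ac flip: exp_add)
      moreover have "(norm (s x))\<^sup>2 \<le> Q x" by (simp add: Q_def)
      ultimately have "norm (s x) \<le> sqrt ((1 + K / \<kappa>) * Tb * exp (- \<kappa> * x) * (norm (q 0))\<^sup>2)"
        by (intro real_le_rsqrt) auto
      also have "\<dots> = sqrt ((1 + K / \<kappa>) * Tb) * sqrt (exp (- \<kappa> * x)) * norm (q 0)"
        by (simp add: real_sqrt_mult)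
      also have "sqrt (exp (- \<kappa> * x)) = exp (- (\<kappa> / 2) * x)"
        by (rule real_sqrt_unique) (auto simp flip: exp_of_nat_mult)
      finally show ?thesis by simp
    qed
    have "norm (- W (e x)) \<le> (R * k * (1 + 1 / m) * sqrt Tb * norm (q 0)) * exp (- \<theta> * x)" if x: "0 \<le> x" for x
    proof -
      have "norm (- W (e x)) \<le> R * norm (e x)" using W_bound[of "e x"] by simp
      also have "\<dots> \<le> R * (k * exp (- \<theta> * x) * ((1 + 1 / m) * (sqrt Tb * norm (q 0))))"
        using ne[OF x] sT[OF x] R0 k m
        by (intro mult_left_mono order_trans[OF ne[OF x]]) auto
      finally show ?thesis by (simp add: mult_ac)
    qed
    from exp_small_derivative_converges[OF dw this \<theta>] obtain L where L: "(w \<longlongrightarrow> L) at_top"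
      "\<And>x. 0 \<le> x \<Longrightarrow> norm (w x - L) \<le> (R * k * (1 + 1 / m) * sqrt Tb * norm (q 0)) / \<theta> * exp (- \<theta> * x)"
      by blast
    have "((\<lambda>x. B *v w x) \<longlongrightarrow> B *v L) at_top"
      unfolding matrix_vector_mult_def by (intro vec_tendstoI) (auto intro!: tendsto_intros L)
    then have "((\<lambda>x::real. 0 :: complex^'n) \<longlongrightarrow> B *v L) at_top" by (simp add: w_def BW)
    then have BL: "B *v L = 0" by (simp add: tendsto_const_iff)
    show "\<exists>L. B *v L = 0 \<and> (\<forall>x\<ge>0. norm (q x - L) \<le> C * exp (- (\<kappa> / 2) * x) * norm (q 0))"
    proof (intro exI[of _ "(1 / \<beta>3) *s L"] conjI allI impI)
      show "B *v ((1 / \<beta>3) *s L) = 0" by (simp add: vector_scalar_commute BL)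
      fix x :: real assume x: "0 \<le> x"
      have "q x - (1 / \<beta>3) *s L = s x + (1 / \<beta>3) *s (w x - L)"
        by (simp add: s_def vec_eq_iff algebra_simps)
      then have "norm (q x - (1 / \<beta>3) *s L) \<le> norm (s x) + norm ((1 / \<beta>3) *s (w x - L))"
        by (simp only: norm_triangle_ineq)
      also have "norm ((1 / \<beta>3) *s (w x - L)) \<le> 1 / m * norm (w x - L)"
        unfolding norm_smult_vec using m\<beta>3 m by (intro mult_right_mono) (auto simp: norm_divide frac_le)
      also have "\<dots> \<le> 1 / m * ((R * k * (1 + 1 / m) * sqrt Tb * norm (q 0)) / \<theta> * exp (- (\<kappa> / 2) * x))"
      proof (intro mult_left_mono order_trans[OF L(2)[OF x]])
        show "exp (- \<theta> * x) \<le> exp (- (\<kappa> / 2) * x)"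
          using \<kappa> x mult_right_mono[of "\<kappa> / 2" \<theta> x] by simp
      qed (use m \<theta> k R0 Tb0 in auto)
      finally have "norm (q x - (1 / \<beta>3) *s L) \<le> norm (s x)
          + (R * k * (1 + 1 / m) * sqrt Tb / \<theta> / m) * exp (- (\<kappa> / 2) * x) * norm (q 0)"
        by (simp add: mult_ac)
      with sx[OF x] show "norm (q x - (1 / \<beta>3) *s L) \<le> C * exp (- (\<kappa> / 2) * x) * norm (q 0)"
        unfolding C_def distrib_right by linarith
    qed
  qed
qed

section \<open>Spectral algebra of the coefficient matrices\<close>

lemma norm_vec3_le:
  fixes q :: "complex^3"
  assumes "cmod (q $ 1) \<le> c" "cmod (q $ 2) \<le> c" "cmod (q $ 3) \<le> c"
  shows "norm q \<le> 3 * c"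
proof -
  have "norm q \<le> (\<Sum>i\<in>UNIV. norm (q $ i))"
    unfolding norm_vec_def by (rule L2_set_le_sum) simp
  also have "\<dots> \<le> 3 * c" using assms by (simp add: sum_3)
  finally show ?thesis .
qed

lemma cmod_row_le:
  fixes p :: "complex^3"
  assumes "cmod a \<le> c" "cmod b \<le> c" "cmod d \<le> c"
  shows "cmod (a * p $ 1 + b * p $ 2 + d * p $ 3) \<le> 3 * c * norm p"
proof -
  have *: "cmod (a * p $ i) \<le> c * norm p" if "cmod a \<le> c" for a i
    unfolding norm_mult using that Finite_Cartesian_Product.norm_nth_le[of p i] order_trans[OF norm_ge_zero that]
    by (intro mult_mono) auto
  have "cmod (a * p $ 1 + b * p $ 2 + d * p $ 3) \<le> c * norm p + c * norm p + c * norm p"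
    by (intro norm_triangle_le add_mono *[OF assms(1)] *[OF assms(2)] *[OF assms(3)] order_trans[OF norm_triangle_ineq])
  then show ?thesis by simp
qed

text \<open>Minus the transpose of the coefficient matrix at \<open>v = s\<^sup>2\<close>, with \<open>h = z - f\<close>, shifted by the
  eigenvalue \<open>\<nu>\<close>, after the first component has been divided by \<open>s\<close>. It governs the conjugate of
  an adjoint solution times \<open>exp (- \<nu> x)\<close>. The division removes the quotients of small numbers that
  the spectral projections of the unscaled matrix contain.\<close>

definition dual_matrix :: "complex \<Rightarrow> complex \<Rightarrow> complex \<Rightarrow> complex \<Rightarrow> complex^3^3" where
  "dual_matrix s z h \<nu> = vector
     [vector [- \<nu>, 0, - s],
      vector [- (z * s), - \<nu>, - s\<^sup>2],
      vector [- (z * s), - z, h - \<nu>]]"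

lemma dual_matrix_mult:
  "(dual_matrix s z h \<nu> *v p) $ 1 = - \<nu> * p $ 1 - s * p $ 3"
  "(dual_matrix s z h \<nu> *v p) $ 2 = - (z * s) * p $ 1 - \<nu> * p $ 2 - s\<^sup>2 * p $ 3"
  "(dual_matrix s z h \<nu> *v p) $ 3 = - (z * s) * p $ 1 - z * p $ 2 + (h - \<nu>) * p $ 3"
  by (simp_all add: dual_matrix_def matrix_vector_mult_def sum_3)

lemma coef_matrix_mult:
  "(coef_matrix v f z *v p) $ 1 = z * p $ 2 + z * p $ 3"
  "(coef_matrix v f z *v p) $ 2 = z * p $ 3"
  "(coef_matrix v f z *v p) $ 3 = of_real v * p $ 1 + of_real v * p $ 2 + (of_real f - z) * p $ 3"
  by (simp_all add: coef_matrix_def matrix_vector_mult_def sum_3)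

lemma adjoint_matrix_mult:
  "(- cadj (coef_matrix v f z) *v p) $ 1 = - of_real v * p $ 3"
  "(- cadj (coef_matrix v f z) *v p) $ 2 = - cnj z * p $ 1 - of_real v * p $ 3"
  "(- cadj (coef_matrix v f z) *v p) $ 3 = - cnj z * p $ 1 - cnj z * p $ 2 + (cnj z - of_real f) * p $ 3"
  by (simp_all add: coef_matrix_def cadj_def matrix_vector_mult_def sum_3 algebra_simps)

text \<open>The hypotheses are Vieta's formulas for the characteristic polynomial at \<open>v = s\<^sup>2\<close>; the claim is
  Cayley-Hamilton, with the eigenvalue \<open>0\<close> that the shift produces.\<close>

lemma dual_matrix_cubic:
  fixes p :: "complex^3"
  assumes "h = \<nu>1 + \<nu>2 + \<nu>3" and e2: "\<nu>1 * \<nu>2 + \<nu>1 * \<nu>3 + \<nu>2 * \<nu>3 = - 2 * s\<^sup>2 * z" and e3: "\<nu>1 * \<nu>2 * \<nu>3 = - s\<^sup>2 * z\<^sup>2"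
  defines "B \<equiv> dual_matrix s z h \<nu>1"
  shows "B *v (B *v (B *v p)) = ((\<nu>2 - \<nu>1) + (\<nu>3 - \<nu>1)) *s (B *v (B *v p)) - ((\<nu>2 - \<nu>1) * (\<nu>3 - \<nu>1)) *s (B *v p)"
  unfolding vec_eq_iff forall_3 B_def assms(1)
  apply (simp add: dual_matrix_mult)
  apply (intro conjI)
  subgoal using e2 e3 by algebra
  subgoal using e2 e3 by algebra
  subgoal using e2 e3 by algebra
  done

lemma coef_matrix_cubic:
  fixes p :: "complex^3"
  assumes "of_real f - z = \<mu>1 + \<mu>2 + \<mu>3" and e2: "\<mu>1 * \<mu>2 + \<mu>1 * \<mu>3 + \<mu>2 * \<mu>3 = - 2 * of_real v * z"
    and e3: "\<mu>1 * \<mu>2 * \<mu>3 = of_real v * z\<^sup>2"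
  defines "B \<equiv> mat \<mu>1 - coef_matrix v f z"
  shows "B *v (B *v (B *v p)) = ((\<mu>1 - \<mu>2) + (\<mu>1 - \<mu>3)) *s (B *v (B *v p)) - ((\<mu>1 - \<mu>2) * (\<mu>1 - \<mu>3)) *s (B *v p)"
proof -
  have "mat \<mu>1 *v q = \<mu>1 *s q" for q :: "complex^3"
    by (simp add: vec_eq_iff forall_3 matrix_vector_mult_def mat_def sum_3)
  then have B: "(B *v q) $ i = \<mu>1 * q $ i - (coef_matrix v f z *v q) $ i" for q i
    by (simp add: B_def matrix_vector_mult_diff_rdistrib)
  show ?thesis
    unfolding vec_eq_iff forall_3
    apply (simp add: B coef_matrix_mult assms(1))
    apply (intro conjI)
    subgoal using e2 e3 by algebra
    subgoal using e2 e3 by algebra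
    subgoal using e2 e3 by algebra
    done
qed

lemma cubic_companion_roots:
  fixes \<nu>1 :: complex
  assumes "\<nu>1^3 - a * \<nu>1\<^sup>2 + b * \<nu>1 - c = 0"
  obtains \<nu>2 \<nu>3 where "a = \<nu>1 + \<nu>2 + \<nu>3" "\<nu>1 * \<nu>2 + \<nu>1 * \<nu>3 + \<nu>2 * \<nu>3 = b" "\<nu>1 * \<nu>2 * \<nu>3 = c"
proof -
  define P where "P = a - \<nu>1"
  define Q where "Q = b - \<nu>1 * P"
  define d where "d = csqrt (P\<^sup>2 - 4 * Q)"
  have d: "d\<^sup>2 = P\<^sup>2 - 4 * Q" by (simp add: d_def)
  show ?thesis
  proof (rule that[of "(P + d) / 2" "(P - d) / 2"])
    have prod: "(P + d) / 2 * ((P - d) / 2) = Q"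
      using d by (simp add: field_simps power2_eq_square)
    show "a = \<nu>1 + (P + d) / 2 + (P - d) / 2"
      by (simp add: P_def field_simps)
    show "\<nu>1 * ((P + d) / 2) + \<nu>1 * ((P - d) / 2) + (P + d) / 2 * ((P - d) / 2) = b"
      unfolding prod by (simp add: Q_def field_simps)
    show "\<nu>1 * ((P + d) / 2) * ((P - d) / 2) = c"
      unfolding mult.assoc prod using assms by (simp add: Q_def P_def algebra_simps power2_eq_square power3_eq_cube)
  qed
qed

text \<open>The hypotheses say that \<open>\<mu>\<close> is a double root of the characteristic polynomial of
  \<open>coef_matrix v f z\<close>. In terms of \<open>q = 1 + z / \<mu>\<close> they become \<open>v q\<^sup>2 (2 q - 1) = v - f\<close> and
  \<open>\<mu> = - 2 v q (q - 1)\<close>, hence \<open>z = - 2 v q (q - 1)\<^sup>2\<close>. The first of these has a nonnegative real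
  right-hand side, and for every such \<open>q\<close> other than \<open>0\<close> and \<open>1\<close> the real part of \<open>z\<close> turns out to be
  negative.\<close>

lemma no_double_root:
  fixes \<mu> z :: complex and v f :: real
  assumes v: "0 < v" "f \<le> v"
    and p: "\<mu>^3 + (z - of_real f) * \<mu>\<^sup>2 - 2 * of_real v * z * \<mu> - of_real v * z\<^sup>2 = 0"
    and p': "3 * \<mu>\<^sup>2 + 2 * (z - of_real f) * \<mu> - 2 * of_real v * z = 0"
    and z: "0 \<le> Re z" and \<mu>: "\<mu> \<noteq> 0"
  shows False
proof -
  define q where "q = 1 + z / \<mu>"
  define x y where "x = Re q" and "y = Im q"
  have zq: "z = \<mu> * (q - 1)" using \<mu> by (simp add: q_def)
  have "\<mu> * \<mu> * (\<mu> * q - of_real f + of_real v - of_real v * q\<^sup>2) = 0"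
    using p unfolding zq by algebra
  then have 1: "\<mu> * q - of_real f + of_real v - of_real v * q\<^sup>2 = 0" using \<mu> by simp
  have "\<mu> * (3 * \<mu> + 2 * (\<mu> * (q - 1) - of_real f) - 2 * of_real v * (q - 1)) = 0"
    using p' unfolding zq by algebra
  then have 2: "3 * \<mu> + 2 * (\<mu> * (q - 1) - of_real f) - 2 * of_real v * (q - 1) = 0"
    using \<mu> by simp
  have \<mu>q: "\<mu> = - 2 * of_real v * q * (q - 1)" using 1 2 by algebra
  have q3: "of_real v * q\<^sup>2 * (2 * q - 1) = complex_of_real (v - f)"
    using 1 unfolding \<mu>q by (simp add: algebra_simps power2_eq_square)
  have zq': "z = - 2 * of_real v * q * (q - 1)\<^sup>2" unfolding zq \<mu>q by algebra
  have q: "q = Complex x y" by (simp add: x_def y_def)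
  have "Im (of_real v * q\<^sup>2 * (2 * q - 1)) = 0" unfolding q3 by simp
  then have "v * (y * (6 * x\<^sup>2 - 2 * y\<^sup>2 - 2 * x)) = 0"
    unfolding q by (simp add: power2_eq_square algebra_simps)
  (* The admissible q lie on the real axis or on a hyperbola; the two cases are treated below. *)
  then have im: "y = 0 \<or> y\<^sup>2 = 3 * x\<^sup>2 - x" using v by auto
  have "Re (of_real v * q\<^sup>2 * (2 * q - 1)) = v - f" unfolding q3 by simp
  then have re: "v * (2 * (x^3 - 3 * x * y\<^sup>2) - (x\<^sup>2 - y\<^sup>2)) = v - f"
    unfolding q by (simp add: power2_eq_square power3_eq_cube algebra_simps)
  then have "0 \<le> v * (2 * (x^3 - 3 * x * y\<^sup>2) - (x\<^sup>2 - y\<^sup>2))" using v by simp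
  then have re': "0 \<le> 2 * (x^3 - 3 * x * y\<^sup>2) - (x\<^sup>2 - y\<^sup>2)" using v by (simp add: zero_le_mult_iff)
  have "Re z = v * (- 2 * (x^3 - 3 * x * y\<^sup>2 - 2 * x\<^sup>2 + 2 * y\<^sup>2 + x))"
    unfolding zq' q by (simp add: power2_eq_square power3_eq_cube algebra_simps)
  then have z': "0 \<le> - 2 * (x^3 - 3 * x * y\<^sup>2 - 2 * x\<^sup>2 + 2 * y\<^sup>2 + x)" using v z by (simp add: zero_le_mult_iff)
  show False
  proof (cases "y = 0")
    case True
    have q_ne: "q \<noteq> 0" "q \<noteq> 1" using \<mu> by (auto simp: \<mu>q)
    then have "x \<noteq> 0" "x \<noteq> 1" using True by (auto simp: q complex_eq_iff)
    have "0 \<le> x\<^sup>2 * (2 * x - 1)" using re' True by (simp add: power2_eq_square power3_eq_cube algebra_simps)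
    then have "1 / 2 \<le> x" using \<open>x \<noteq> 0\<close> by (simp add: zero_le_mult_iff)
    then have "0 < x * (x - 1)\<^sup>2" using \<open>x \<noteq> 1\<close> by simp
    then show False using z' True by (simp add: power2_eq_square power3_eq_cube algebra_simps)
  next
    case False
    then have y2: "y\<^sup>2 = 3 * x\<^sup>2 - x" using im by simp
    have "0 \<le> - x * (4 * x - 1)\<^sup>2"
      using re' unfolding y2 by (simp add: power2_eq_square power3_eq_cube algebra_simps)
    moreover have y_pos: "0 < x * (3 * x - 1)" using False y2 zero_less_power2[of y] by (simp add: power2_eq_square algebra_simps)
    ultimately have "x < 0"
      by (smt (verit, best) mult_neg_pos mult_pos_pos zero_less_mult_iff zero_less_power2)
    have "0 \<le> 8 * x^3 - 7 * x\<^sup>2 + x"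
      using z' unfolding y2 by (simp add: power2_eq_square power3_eq_cube algebra_simps)
    also have "\<dots> = x * (8 * x\<^sup>2 - 7 * x + 1)" by (simp add: power2_eq_square power3_eq_cube algebra_simps)
    also have "\<dots> < 0" using \<open>x < 0\<close> zero_le_power2[of x] by (intro mult_neg_pos) linarith+
    finally show False by simp
  qed
qed

lemma coef_matrix_eigenvalue:
  assumes "\<mu> \<noteq> 0" "\<mu>^3 + (z - of_real f) * \<mu>\<^sup>2 - 2 * of_real v * z * \<mu> - of_real v * z\<^sup>2 = 0"
  shows "\<mu> \<in> eigenvalues (coef_matrix v f z)"
proof -
  define V :: "complex^3" where "V = vector [z\<^sup>2 + z * \<mu>, z * \<mu>, \<mu>\<^sup>2]"
  have "coef_matrix v f z *v V = \<mu> *s V"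
    unfolding vec_eq_iff forall_3 coef_matrix_mult V_def
    using assms(2) by (auto simp: power2_eq_square) algebra+
  moreover have "V $ 3 \<noteq> 0" using assms(1) by (simp add: V_def)
  then have "V \<noteq> 0" by auto
  ultimately show ?thesis by (auto simp: eigenvalues_def eigenpair_def)
qed

text \<open>The third component of an eigenvector never vanishes, so it determines the other two, and the third
  row recovers the eigenvalue from the eigenvector. The latter makes the eigenvalue inherit the
  regularity of the eigenvector.\<close>

lemma coef_matrix_eigenpair:
  assumes V: "eigenpair (coef_matrix v f z) \<mu> V" and \<mu>: "\<mu> \<noteq> 0"
  shows "V $ 3 \<noteq> 0" "V $ 2 = z / \<mu> * V $ 3" "V $ 1 = z / \<mu> * (1 + z / \<mu>) * V $ 3"
    "\<mu> = of_real v * (V $ 1 + V $ 2) / V $ 3 + of_real f - z"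
    "\<mu>^3 + (z - of_real f) * \<mu>\<^sup>2 - 2 * of_real v * z * \<mu> - of_real v * z\<^sup>2 = 0"
proof -
  have e: "z * V $ 2 + z * V $ 3 = \<mu> * V $ 1" "z * V $ 3 = \<mu> * V $ 2"
    "of_real v * V $ 1 + of_real v * V $ 2 + (of_real f - z) * V $ 3 = \<mu> * V $ 3"
    using V unfolding eigenpair_def vec_eq_iff forall_3 coef_matrix_mult by auto
  show 2: "V $ 2 = z / \<mu> * V $ 3" using e(2) \<mu> by (simp add: field_simps)
  have "\<mu> * V $ 1 = \<mu> * (z / \<mu> * (1 + z / \<mu>) * V $ 3)"
    unfolding e(1)[symmetric] 2 using \<mu> by (simp add: field_simps)
  then show 1: "V $ 1 = z / \<mu> * (1 + z / \<mu>) * V $ 3" using \<mu> mult_left_cancel by blast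
  show 3: "V $ 3 \<noteq> 0"
  proof
    assume "V $ 3 = 0"
    then have "V = 0" by (simp add: vec_eq_iff forall_3 1 2)
    then show False using V by (simp add: eigenpair_def)
  qed
  show "\<mu> = of_real v * (V $ 1 + V $ 2) / V $ 3 + of_real f - z"
    using e(3) 3 by (simp add: field_simps)
  have "(\<mu>^3 + (z - of_real f) * \<mu>\<^sup>2 - 2 * of_real v * z * \<mu> - of_real v * z\<^sup>2) * V $ 3 = 0"
    using e by algebra
  then show "\<mu>^3 + (z - of_real f) * \<mu>\<^sup>2 - 2 * of_real v * z * \<mu> - of_real v * z\<^sup>2 = 0"
    using 3 by simp
qed

lemma adjoint_eigenvalue:
  assumes "\<nu> \<noteq> 0" "v \<noteq> 0" "\<nu>^3 - (z - of_real f) * \<nu>\<^sup>2 + (- 2 * of_real v * z) * \<nu> - (- of_real v * z\<^sup>2) = 0"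
  shows "cnj \<nu> \<in> eigenvalues (- cadj (coef_matrix v f z))"
proof -
  define V :: "complex^3" where "V = vector [- of_real v * cnj \<nu>, of_real v * cnj z - of_real v * cnj \<nu>, (cnj \<nu>)\<^sup>2]"
  have c: "(cnj \<nu>)^3 - (cnj z - of_real f) * (cnj \<nu>)\<^sup>2 + (- 2 * of_real v * cnj z) * cnj \<nu> - (- of_real v * (cnj z)\<^sup>2) = 0"
    using arg_cong[OF assms(3), of cnj] by simp
  have "- cadj (coef_matrix v f z) *v V = cnj \<nu> *s V"
    unfolding vec_eq_iff forall_3 adjoint_matrix_mult V_def
    using c by (auto simp: power2_eq_square) algebra+
  moreover have "V $ 1 \<noteq> 0" using assms(1,2) by (simp add: V_def)
  then have "V \<noteq> 0" by auto
  ultimately show ?thesis by (auto simp: eigenvalues_def eigenpair_def)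
qed

lemma adjoint_eigenvector_eqs:
  assumes V: "- cadj (coef_matrix v f z) *v V = cnj \<nu> *s V"
  shows "\<nu> * cnj (V $ 1) = - of_real v * cnj (V $ 3)"
     "\<nu> * cnj (V $ 2) = - z * cnj (V $ 1) - of_real v * cnj (V $ 3)"
     "\<nu> * cnj (V $ 3) = - z * cnj (V $ 1) - z * cnj (V $ 2) + (z - of_real f) * cnj (V $ 3)"
proof -
  have e: "- of_real v * V $ 3 = cnj \<nu> * V $ 1" "- cnj z * V $ 1 - of_real v * V $ 3 = cnj \<nu> * V $ 2"
    "- cnj z * V $ 1 - cnj z * V $ 2 + (cnj z - of_real f) * V $ 3 = cnj \<nu> * V $ 3"
    using V unfolding vec_eq_iff forall_3 adjoint_matrix_mult by auto
  show "\<nu> * cnj (V $ 1) = - of_real v * cnj (V $ 3)"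
     "\<nu> * cnj (V $ 2) = - z * cnj (V $ 1) - of_real v * cnj (V $ 3)"
     "\<nu> * cnj (V $ 3) = - z * cnj (V $ 1) - z * cnj (V $ 2) + (z - of_real f) * cnj (V $ 3)"
    using e(1,2,3)[THEN arg_cong, of cnj] by simp_all
qed

lemma adjoint_eigenpair_root:
  assumes V: "eigenpair (- cadj (coef_matrix v f z)) (cnj \<nu>) V" and v: "v \<noteq> 0" "\<nu> \<noteq> 0"
  shows "\<nu>^3 - (z - of_real f) * \<nu>\<^sup>2 + (- 2 * of_real v * z) * \<nu> - (- of_real v * z\<^sup>2) = 0"
proof -
  note E = adjoint_eigenvector_eqs[of v f z V \<nu>]
  have eq: "- cadj (coef_matrix v f z) *v V = cnj \<nu> *s V" and V0: "V \<noteq> 0" using V by (auto simp: eigenpair_def)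
  have "cnj (V $ 3) \<noteq> 0"
  proof
    assume 3: "cnj (V $ 3) = 0"
    then have 1: "cnj (V $ 1) = 0" using E(1)[OF eq] v by simp
    then have "cnj (V $ 2) = 0" using E(2)[OF eq] v 3 by simp
    then have "V = 0" using 1 3 by (simp add: vec_eq_iff forall_3)
    then show False using V0 by simp
  qed
  moreover have "(\<nu>^3 - (z - of_real f) * \<nu>\<^sup>2 + (- 2 * of_real v * z) * \<nu> - (- of_real v * z\<^sup>2)) * cnj (V $ 3) = 0"
    using E[OF eq] by algebra
  ultimately show ?thesis by simp
qed

text \<open>The two small roots of the cubic at \<open>v = s\<^sup>2\<close> are written \<open>z s a\<close> and \<open>z s b\<close>, and \<open>n\<close> is the large
  one; the equations are Vieta's formulas after division by powers of \<open>z s\<close>. In this form they are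
  closed conditions that make sense for \<open>z s = 0\<close> too, so they define a compact set, and it suffices
  to exclude \<open>a = b\<close> on it: for \<open>z s = 0\<close> this would give \<open>n = - s\<^sup>2\<close>, contrary to \<open>Re n > 0\<close>, and
  otherwise a double root.\<close>

lemma scaled_roots_separated:
  fixes K :: "complex set" and \<epsilon> \<Gamma> R :: real
  assumes K: "compact K" "K \<subseteq> RHP" and \<epsilon>: "0 < \<epsilon>"
  obtains c where "0 < c"
    "\<And>s z f n a b. \<lbrakk>0 \<le> s; s \<le> 1; z \<in> K; - \<Gamma> \<le> f; f \<le> 0; cmod n \<le> R; cmod a \<le> R; cmod b \<le> R; \<epsilon> \<le> Re n;
      n * (a * b) = - 1; n * (a + b) = - 2 * of_real s - z * of_real s * (a * b);
      z * of_real s * a + z * of_real s * b + n = z - of_real f\<rbrakk>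
      \<Longrightarrow> c \<le> cmod (a - b)"
proof -
  define Q where "Q = ({0..1} \<times> K \<times> {- \<Gamma>..0} \<times> cball 0 R \<times> cball 0 R \<times> cball 0 R) \<inter>
    {x :: real \<times> complex \<times> real \<times> complex \<times> complex \<times> complex. case x of (s, z, f, n, a, b) \<Rightarrow>
      \<epsilon> \<le> Re n \<and> n * (a * b) = - 1 \<and> n * (a + b) = - 2 * of_real s - z * of_real s * (a * b) \<and>
      z * of_real s * a + z * of_real s * b + n = z - of_real f}"
  have "compact Q"
    unfolding Q_def case_prod_beta
    by (intro compact_Int_closed compact_Times K closed_Collect_conj closed_Collect_eq closed_Collect_le continuous_intros) auto
  have pos: "a \<noteq> b" if Q: "(s, z, f, n, a, b) \<in> Q" for s z f n a b
  proof
    assume ab: "a = b"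
    define zs where "zs = z * complex_of_real s"
    have H: "0 \<le> s" "z \<in> K" "f \<le> 0" "\<epsilon> \<le> Re n" "n * (a * a) = - 1" "n * (a + a) = - 2 * of_real s - zs * (a * a)"
      "zs * a + zs * a + n = z - of_real f"
      using Q by (auto simp: Q_def ab zs_def)
    have "zs \<noteq> 0"
    proof
      assume 0: "zs = 0"
      have "n = - (of_real s * of_real s)"
      proof -
        have "2 * (n * a + of_real s) = 0" using H(6) 0 by (simp add: algebra_simps)
        then have "n * a + of_real s = 0" by (metis mult_eq_0_iff zero_neq_numeral)
        then have na: "n * a = - of_real s" by (simp only: eq_neg_iff_add_eq_0)
        have "n * (n * (a * a)) = (n * a) * (n * a)" by (simp add: algebra_simps)
        then show ?thesis unfolding H(5) na by simp (metis minus_equation_iff)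
      qed
      then have "Re n = - (s * s)" by simp
      then show False using H(4) \<epsilon> zero_le_square[of s] by linarith
    qed
    moreover have "a \<noteq> 0" using H(5) by auto
    ultimately have \<mu>: "- (zs * a) \<noteq> 0" by simp
    have s: "0 < s" using H(1) \<open>zs \<noteq> 0\<close> by (cases "s = 0") (auto simp: zs_def)
    show False
    proof (rule no_double_root[where v = "s\<^sup>2" and f = f and z = z and \<mu> = "- (zs * a)"])
      show "0 < s\<^sup>2" using s by simp
      show "f \<le> s\<^sup>2" using H(3) by (rule order_trans) simp
      show "0 \<le> Re z" using H(2) K by (auto simp: RHP_def)
      define w where "w = zs * a"
      have F1: "n * w\<^sup>2 = - zs\<^sup>2"
      proof -
        have "n * w\<^sup>2 = zs\<^sup>2 * (n * (a * a))" by (simp add: w_def power2_eq_square mult_ac)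
        then show ?thesis unfolding H(5) by simp
      qed
      have F2: "w\<^sup>2 + 2 * n * w + 2 * of_real s * zs = 0"
      proof -
        have "w\<^sup>2 + 2 * n * w + 2 * of_real s * zs = zs * (n * (a + a) + 2 * of_real s + zs * (a * a))"
          by (simp add: w_def power2_eq_square algebra_simps)
        then show ?thesis unfolding H(6) by simp
      qed
      have vz: "of_real (s\<^sup>2) * z = of_real s * zs" "of_real (s\<^sup>2) * z\<^sup>2 = zs\<^sup>2"
        by (simp_all add: zs_def power2_eq_square mult_ac)
      have h: "z - of_real f = 2 * w + n" unfolding w_def H(7)[symmetric] by simp
      show "(- (zs * a))^3 + (z - of_real f) * (- (zs * a))\<^sup>2 - 2 * of_real (s\<^sup>2) * z * (- (zs * a)) - of_real (s\<^sup>2) * z\<^sup>2 = 0"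
        using F1 F2 vz h unfolding w_def[symmetric] by algebra
      show "3 * (- (zs * a))\<^sup>2 + 2 * (z - of_real f) * (- (zs * a)) - 2 * of_real (s\<^sup>2) * z = 0"
        using F2 vz(1) h unfolding w_def[symmetric] by algebra
    qed (use \<mu> in auto)
  qed
  show ?thesis
  proof (cases "Q = {}")
    case True
    then have "\<And>x. x \<notin> Q" by simp
    then show ?thesis
      by (intro that[of 1]) (auto simp: Q_def)
  next
    case False
    have "continuous_on Q (\<lambda>(s, z, f, n, a, b). cmod (a - b))"
      unfolding case_prod_beta by (intro continuous_intros)
    from continuous_attains_inf[OF \<open>compact Q\<close> False this] obtain q where
      q: "q \<in> Q" "\<And>x. x \<in> Q \<Longrightarrow> (case q of (s, z, f, n, a, b) \<Rightarrow> cmod (a - b)) \<le> (case x of (s, z, f, n, a, b) \<Rightarrow> cmod (a - b))"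
      by blast
    show ?thesis
    proof (rule that)
      show "0 < (case q of (s, z, f, n, a, b) \<Rightarrow> cmod (a - b))"
      proof -
        obtain s z f n a b where "q = (s, z, f, n, a, b)" by (cases q rule: prod_cases6)
        then show ?thesis using pos[of s z f n a b] q(1) by simp
      qed
      show "(case q of (s, z, f, n, a, b) \<Rightarrow> cmod (a - b)) \<le> cmod (a - b)"
        if "0 \<le> s" "s \<le> 1" "z \<in> K" "- \<Gamma> \<le> f" "f \<le> 0" "cmod n \<le> R" "cmod a \<le> R" "cmod b \<le> R" "\<epsilon> \<le> Re n"
          "n * (a * b) = - 1" "n * (a + b) = - 2 * of_real s - z * of_real s * (a * b)"
          "z * of_real s * a + z * of_real s * b + n = z - of_real f"
        for s z f n a b
        using q(2)[of "(s, z, f, n, a, b)"] that by (simp add: Q_def)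
    qed
  qed
qed

lemma dual_matrix_norm_bounds:
  fixes p :: "complex^3"
  assumes "cmod s \<le> 1" "cmod z \<le> Z" "cmod h \<le> Z" "cmod \<nu> \<le> Z" "cmod \<beta> \<le> 3 * Z" "1 \<le> Z"
  shows "norm (dual_matrix s z h \<nu> *v p - \<beta> *s p) \<le> 45 * Z * norm p"
proof -
  have s2: "cmod (s\<^sup>2) \<le> 1" using assms(1) by (simp add: norm_power power_le_one)
  have zs: "cmod (z * s) \<le> Z" using mult_mono[OF assms(2,1)] order_trans[OF norm_ge_zero assms(2)] by (simp add: norm_mult)
  have b: "cmod (- \<nu> - \<beta>) \<le> 5 * Z" "cmod (h - \<nu> - \<beta>) \<le> 5 * Z"
    using norm_triangle_ineq4[of "- \<nu>" \<beta>] norm_triangle_ineq4[of "h - \<nu>" \<beta>] norm_triangle_ineq4[of h \<nu>] assms by auto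
  have e: "dual_matrix s z h \<nu> *v p - \<beta> *s p = vector
    [(- \<nu> - \<beta>) * p $ 1 + 0 * p $ 2 + (- s) * p $ 3,
     (- (z * s)) * p $ 1 + (- \<nu> - \<beta>) * p $ 2 + (- s\<^sup>2) * p $ 3,
     (- (z * s)) * p $ 1 + (- z) * p $ 2 + (h - \<nu> - \<beta>) * p $ 3]"
    unfolding vec_eq_iff forall_3 by (simp add: dual_matrix_mult algebra_simps)
  have "norm (dual_matrix s z h \<nu> *v p - \<beta> *s p) \<le> 3 * (3 * (5 * Z) * norm p)"
    unfolding e using assms s2 zs b
    by (intro norm_vec3_le) (simp_all only: vector_3, (intro cmod_row_le; simp)+)
  then show ?thesis by simp
qed

text \<open>If \<open>a\<close> were larger than \<open>2 M\<close>, then \<open>b\<close> would be larger than \<open>M\<close>, and the product too large.\<close>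

lemma cmod_le_by_sum_and_product:
  fixes a b :: complex
  assumes "cmod (a + b) \<le> M" "cmod (a * b) \<le> M" "1 \<le> M"
  shows "cmod a \<le> 2 * M"
proof (rule ccontr)
  assume "\<not> ?thesis"
  then have a: "2 * M < cmod a" by simp
  have "cmod a \<le> cmod (a + b) + cmod b" by (metis add_diff_cancel norm_triangle_ineq4)
  then have b: "M < cmod b" using a assms by linarith
  have "M * 1 < cmod a * cmod b" using a b assms by (intro mult_strict_mono) auto
  then show False using assms by (simp add: norm_mult)
qed

text \<open>The roots of this cubic with negative real part are the conjugates of the eigenvalues of
  \<open>- cadj (coef_matrix v f z)\<close> with negative real part.\<close>

definition sole_decaying_root :: "real \<Rightarrow> real \<Rightarrow> complex \<Rightarrow> complex \<Rightarrow> bool" where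
  "sole_decaying_root v f z \<nu>1 \<longleftrightarrow> Re \<nu>1 < 0 \<and> (\<forall>\<nu>. Re \<nu> < 0 \<longrightarrow>
     (\<nu>^3 - (z - of_real f) * \<nu>\<^sup>2 + (- 2 * of_real v * z) * \<nu> - (- of_real v * z\<^sup>2) = 0 \<longleftrightarrow> \<nu> = \<nu>1))"

text \<open>Uniform spectral data at \<open>+\<infinity>\<close> for \<open>v\<^sub>+ = s\<^sup>2\<close>. The real parts of the roots sum to at least
  \<open>\<epsilon>\<close>, which forces one of the companions of \<open>\<nu>1\<close> to have real part at least \<open>\<epsilon> / 2\<close>; the
  other one may be as small as \<open>\<nu>1\<close>. Dividing both small roots by \<open>zs = z s\<close> gives bounded quotients
  \<open>a\<close> and \<open>b\<close> that are uniformly separated. So \<open>\<beta>2 = zs (b - a)\<close> is comparable to \<open>zs\<close>, and the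
  explicit form of \<open>(B - \<beta>2)(B - \<beta>3)\<close> shows that it is \<open>zs\<close> times a bounded matrix.\<close>

lemma decaying_root_spectral_data:
  fixes K :: "complex set" and \<epsilon> \<Gamma> :: real
  assumes K: "compact K" "K \<subseteq> RHP" and \<epsilon>: "0 < \<epsilon>" and \<Gamma>: "0 \<le> \<Gamma>"
  obtains R where "1 \<le> R"
    "\<And>z s f \<nu>1. \<lbrakk>z \<in> K; z \<noteq> 0; 0 < s; s \<le> 1; - \<Gamma> \<le> f; f \<le> - \<epsilon>; sole_decaying_root (s\<^sup>2) f z \<nu>1\<rbrakk> \<Longrightarrow>
       cmod \<nu>1 \<le> R * cmod z * s \<and>
       (\<exists>\<beta>2 \<beta>3. splitting (dual_matrix (of_real s) z (z - of_real f) \<nu>1) \<beta>2 \<beta>3 R \<and>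
         \<beta>2 \<noteq> 0 \<and> 0 \<le> Re \<beta>2 \<and> \<epsilon> / 2 \<le> Re \<beta>3 \<and> cmod \<beta>3 \<le> R)"
proof -
  obtain Z0 where Z0: "\<And>z. z \<in> K \<Longrightarrow> cmod z \<le> Z0"
    using compact_imp_bounded[OF K(1)] by (auto simp: bounded_iff)
  define C where "C = 1 + 3 / \<epsilon>"
  define Z where "Z = 1 + \<bar>Z0\<bar> + \<Gamma>"
  define M where "M = 1 + Z + C * Z + 2 * Z + C * Z * (Z + C * Z)"
  have C1: "1 \<le> C" using \<epsilon> by (simp add: C_def)
  have Z1: "1 \<le> Z" using \<Gamma> by (simp add: Z_def)
  define Ra where "Ra = C + (2 + Z / (\<epsilon> / 2)) / (\<epsilon> / 2) + 2 * M"
  define E where "E = 2 + C * (Z + C * Z) + Z + C * Z"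
  obtain c where c: "0 < c"
    "\<And>s z f n a b. \<lbrakk>0 \<le> s; s \<le> 1; z \<in> K; - \<Gamma> \<le> f; f \<le> 0; cmod n \<le> Ra; cmod a \<le> Ra; cmod b \<le> Ra; \<epsilon> / 2 \<le> Re n;
      n * (a * b) = - 1; n * (a + b) = - 2 * of_real s - z * of_real s * (a * b);
      z * of_real s * a + z * of_real s * b + n = z - of_real f\<rbrakk>
      \<Longrightarrow> c \<le> cmod (a - b)"
    using scaled_roots_separated[OF K, of "\<epsilon> / 2" \<Gamma> Ra] \<epsilon> by (metis half_gt_zero)
  have CZ0: "0 \<le> C * Z" "0 \<le> C * Z * (Z + C * Z)" "C \<le> C * Z" "C * 1 \<le> C * (Z + C * Z)" "C * (C * Z) \<le> C * (Z + C * Z)"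
    using C1 Z1 mult_mono[OF order_refl Z1, of C] by (auto intro!: mult_left_mono add_increasing2)
  have M1: "1 \<le> M" "Z \<le> M" "C * Z \<le> M" "Z + C * Z \<le> M" using C1 Z1 CZ0 by (simp_all add: M_def)
  have E1: "1 \<le> E" using CZ0 Z1 mult_nonneg_nonneg[of C "Z + C * Z"] C1 by (simp add: E_def)
  define R where "R = 45 * M + 9 * E / c + C"
  have R: "1 \<le> R" "C \<le> R" "45 * M \<le> R" "9 * E / c \<le> R"
    using M1 E1 c(1) C1 by (auto simp: R_def divide_nonneg_pos add_nonneg_nonneg intro!: add_increasing2)
  show ?thesis
  proof (rule that[OF R(1)])
    fix z :: complex and s f :: real and \<nu>1 :: complex
    assume z: "z \<in> K" "z \<noteq> 0" and s: "0 < s" "s \<le> 1" and f: "- \<Gamma> \<le> f" "f \<le> - \<epsilon>"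
      and sole: "sole_decaying_root (s\<^sup>2) f z \<nu>1"
    have \<nu>1: "Re \<nu>1 < 0"
      and uniq: "\<And>\<nu>. \<nu>^3 - (z - of_real f) * \<nu>\<^sup>2 + (- 2 * of_real (s\<^sup>2) * z) * \<nu> - (- of_real (s\<^sup>2) * z\<^sup>2) = 0 \<Longrightarrow> Re \<nu> < 0 \<Longrightarrow> \<nu> = \<nu>1"
      and root: "\<nu>1^3 - (z - of_real f) * \<nu>1\<^sup>2 + (- 2 * of_real (s\<^sup>2) * z) * \<nu>1 - (- of_real (s\<^sup>2) * z\<^sup>2) = 0"
      using sole unfolding sole_decaying_root_def by blast+
    define h where "h = z - complex_of_real f"
    define S where "S = complex_of_real s"
    define zs where "zs = z * S"
    have S2: "of_real (s\<^sup>2) = S\<^sup>2" by (simp add: S_def)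
    have zRHP: "0 \<le> Re z" using z K by (auto simp: RHP_def)
    have zZ: "cmod z \<le> Z" "cmod h \<le> Z"
      using Z0[OF z(1)] norm_triangle_ineq4[of z "of_real f"] f \<Gamma> \<epsilon> by (auto simp: Z_def h_def)
    have Sn: "cmod S \<le> 1" "cmod S = s" using s by (auto simp: S_def)
    have zs0: "zs \<noteq> 0" using z s by (simp add: zs_def S_def)
    have zsZ: "cmod zs \<le> Z" "cmod zs = cmod z * s"
      using mult_mono[OF zZ(1) Sn(1)] Z1 s by (simp_all add: zs_def norm_mult Sn(2))
    have nonneg: "0 \<le> Re n" if "h = \<nu>1 + n + m" "\<nu>1 * n + \<nu>1 * m + n * m = - 2 * S\<^sup>2 * z" "\<nu>1 * n * m = - S\<^sup>2 * z\<^sup>2" for n m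
    proof (rule ccontr)
      assume "\<not> 0 \<le> Re n"
      moreover have "n^3 - h * n\<^sup>2 + (- 2 * S\<^sup>2 * z) * n - (- S\<^sup>2 * z\<^sup>2) = 0"
        unfolding that(2)[symmetric] that(3)[symmetric] that(1) by algebra
      ultimately have n: "n = \<nu>1" using uniq unfolding S2 h_def by simp
      show False
      proof (rule no_double_root[where v = "s\<^sup>2" and f = f and z = z and \<mu> = "- \<nu>1"])
        show "0 < s\<^sup>2" using s by simp
        show "f \<le> s\<^sup>2" using f \<epsilon> zero_le_power2[of s] by linarith
        show "(- \<nu>1)^3 + (z - of_real f) * (- \<nu>1)\<^sup>2 - 2 * of_real (s\<^sup>2) * z * (- \<nu>1) - of_real (s\<^sup>2) * z\<^sup>2 = 0"
          using root by algebra
        show "3 * (- \<nu>1)\<^sup>2 + 2 * (z - of_real f) * (- \<nu>1) - 2 * of_real (s\<^sup>2) * z = 0"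
          using that unfolding n S2 h_def by algebra
      qed (use zRHP \<nu>1 in auto)
    qed
    obtain n2 n3 where n: "h = \<nu>1 + n2 + n3" "\<nu>1 * n2 + \<nu>1 * n3 + n2 * n3 = - 2 * S\<^sup>2 * z" "\<nu>1 * n2 * n3 = - S\<^sup>2 * z\<^sup>2"
      and n2: "0 \<le> Re n2" and n3: "\<epsilon> / 2 \<le> Re n3"
    proof -
      obtain a b where ab: "h = \<nu>1 + a + b" "\<nu>1 * a + \<nu>1 * b + a * b = - 2 * S\<^sup>2 * z" "\<nu>1 * a * b = - S\<^sup>2 * z\<^sup>2"
        using cubic_companion_roots[OF root] unfolding S2 h_def by metis
      have ba: "h = \<nu>1 + b + a" "\<nu>1 * b + \<nu>1 * a + b * a = - 2 * S\<^sup>2 * z" "\<nu>1 * b * a = - S\<^sup>2 * z\<^sup>2"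
        using ab by (simp_all add: algebra_simps)
      have "\<epsilon> \<le> Re h" using zRHP f by (simp add: h_def)
      then have "\<epsilon> < Re a + Re b" using \<nu>1 unfolding ab(1) by simp
      then consider "\<epsilon> / 2 \<le> Re a" | "\<epsilon> / 2 \<le> Re b" by linarith
      then show ?thesis
        by cases (use that[OF ab] that[OF ba] nonneg[OF ab] nonneg[OF ba] in blast)+
    qed
    define a where "a = \<nu>1 / zs"
    define b where "b = n2 / zs"
    have \<nu>a: "\<nu>1 = zs * a" and nb: "n2 = zs * b" using zs0 by (simp_all add: a_def b_def)
    have ab1: "n3 * (a * b) = - 1"
    proof -
      have "zs\<^sup>2 * (n3 * (a * b)) = zs\<^sup>2 * (- 1)"
        using n(3) unfolding \<nu>a nb by (simp add: power2_eq_square zs_def algebra_simps)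
      then show ?thesis using zs0 mult_left_cancel[of "zs\<^sup>2"] by fastforce
    qed
    have ab2: "n3 * (a + b) = - 2 * S - zs * (a * b)"
    proof -
      have "zs * (n3 * (a + b)) = zs * (- 2 * S - zs * (a * b))"
        using n(2) unfolding \<nu>a nb zs_def by algebra
      then show ?thesis using zs0 by simp
    qed
    have h_ge: "\<epsilon> \<le> cmod (h - \<nu>1)"
    proof -
      have "\<epsilon> \<le> Re (h - \<nu>1)" using zRHP f \<nu>1 by (simp add: h_def)
      then show ?thesis using complex_Re_le_cmod[of "h - \<nu>1"] by linarith
    qed
    (* Divided by zs^2, the cubic says a^2 (h - nu1) = 1 - 2 S a, and h - nu1 is bounded away
       from zero. *)
    have aC: "cmod a \<le> C"
    proof (rule ccontr)
      assume "\<not> cmod a \<le> C"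
      then have a: "C < cmod a" by simp
      have "zs\<^sup>2 * (a\<^sup>2 * (h - \<nu>1)) = zs\<^sup>2 * (1 - 2 * S * a)"
        using root unfolding S2 h_def[symmetric] \<nu>a zs_def by algebra
      then have "a\<^sup>2 * (h - \<nu>1) = 1 - 2 * S * a" using zs0 by simp
      then have "(cmod a)\<^sup>2 * cmod (h - \<nu>1) = cmod (1 - 2 * S * a)" by (simp flip: norm_power norm_mult)
      also have "\<dots> \<le> 1 + 2 * cmod a"
        using norm_triangle_ineq4[of 1 "2 * S * a"] Sn(1) mult_right_mono[OF Sn(1) norm_ge_zero[of a]] by (simp add: norm_mult)
      finally have "(cmod a)\<^sup>2 * cmod (h - \<nu>1) \<le> 1 + 2 * cmod a" .
      then have "(cmod a)\<^sup>2 * \<epsilon> \<le> 3 * cmod a" using mult_left_mono[OF h_ge, of "(cmod a)\<^sup>2"] a C1 by simp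
      then have "cmod a * (cmod a * \<epsilon>) \<le> cmod a * 3" by (simp add: power2_eq_square mult_ac)
      then have "cmod a * \<epsilon> \<le> 3" using a C1 by (simp only: mult_le_cancel_left_pos)
      then have "cmod a \<le> 3 / \<epsilon>" using \<epsilon> by (simp add: pos_le_divide_eq)
      then show False using a by (simp add: C_def)
    qed
    have \<nu>C: "cmod \<nu>1 \<le> C * cmod z * s" "cmod \<nu>1 \<le> C * Z"
    proof -
      have *: "cmod \<nu>1 \<le> cmod zs * C" unfolding \<nu>a norm_mult using aC by (intro mult_left_mono) auto
      then show "cmod \<nu>1 \<le> C * cmod z * s" unfolding zsZ(2) by (simp add: mult_ac)
      have "cmod zs * C \<le> Z * C" using zsZ(1) C1 by (intro mult_right_mono) auto
      with * show "cmod \<nu>1 \<le> C * Z" by (simp add: mult_ac)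
    qed
    have h\<nu>: "cmod (h - \<nu>1) \<le> Z + C * Z" using norm_triangle_ineq4[of h \<nu>1] zZ \<nu>C by linarith
    have sum23: "cmod (n2 + n3) \<le> M"
    proof -
      have "n2 + n3 = h - \<nu>1" using n(1) by simp
      then show ?thesis using h\<nu> M1 by simp
    qed
    have p23: "n2 * n3 = - (2 * S * zs) - \<nu>1 * (h - \<nu>1)" using n unfolding zs_def by algebra
    have prod23: "cmod (n2 * n3) \<le> M"
    proof -
      have "cmod (n2 * n3) \<le> cmod (2 * S * zs) + cmod \<nu>1 * cmod (h - \<nu>1)"
        unfolding p23 using norm_triangle_ineq4[of "- (2 * S * zs)" "\<nu>1 * (h - \<nu>1)"] by (simp add: norm_mult)
      moreover have "cmod \<nu>1 * cmod (h - \<nu>1) \<le> (C * Z) * (Z + C * Z)"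
        using \<nu>C h\<nu> CZ0 by (intro mult_mono) auto
      moreover have "cmod S * cmod zs \<le> 1 * Z" using Sn(1) zsZ(1) by (intro mult_mono) auto
      then have "cmod (2 * S * zs) \<le> 2 * Z" by (simp add: norm_mult)
      ultimately show ?thesis using CZ0 Z1 by (simp add: M_def)
    qed
    have n3M: "cmod n3 \<le> 2 * M"
      using cmod_le_by_sum_and_product[of n3 n2 M] sum23 prod23 M1 by (simp add: add.commute mult.commute)
    have n3pos: "\<epsilon> / 2 \<le> cmod n3" using n3 complex_Re_le_cmod[of n3] by linarith
    have bRa: "cmod b \<le> C + (2 + Z / (\<epsilon> / 2)) / (\<epsilon> / 2)"
    proof -
      have n30: "n3 \<noteq> 0" using n3pos \<epsilon> by auto
      have "a * b = - 1 / n3" using ab1 n30 by (simp add: field_simps)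
      then have "n3 * (a + b) = - 2 * S + zs / n3" using ab2 by simp
      then have "a + b = (- 2 * S + zs / n3) / n3" using n30 by (simp add: field_simps)
      then have "b = (- 2 * S + zs / n3) / n3 - a" by (metis add_diff_cancel_left')
      then have "cmod b \<le> cmod (- 2 * S + zs / n3) / cmod n3 + cmod a"
        by (metis norm_divide norm_triangle_ineq4)
      moreover have "cmod (zs / n3) \<le> Z / (\<epsilon> / 2)"
        unfolding norm_divide using zsZ(1) n3pos \<epsilon> Z1 by (intro frac_le) auto
      then have "cmod (- 2 * S + zs / n3) \<le> 2 + Z / (\<epsilon> / 2)"
        using norm_triangle_ineq[of "- 2 * S" "zs / n3"] Sn(1) by (simp add: norm_mult)
      then have "cmod (- 2 * S + zs / n3) / cmod n3 \<le> (2 + Z / (\<epsilon> / 2)) / (\<epsilon> / 2)"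
        using n3pos \<epsilon> Z1 by (intro frac_le) auto
      ultimately show ?thesis using aC by linarith
    qed
    have pos: "0 \<le> (2 + Z / (\<epsilon> / 2)) / (\<epsilon> / 2)" using Z1 \<epsilon> by simp
    have sep: "c \<le> cmod (a - b)"
    proof (rule c(2)[of s z f n3 a b])
      show "z * of_real s * a + z * of_real s * b + n3 = z - of_real f"
        using n(1) unfolding \<nu>a nb zs_def S_def h_def by simp
      show "n3 * (a + b) = - 2 * of_real s - z * of_real s * (a * b)" using ab2 unfolding zs_def S_def .
    qed (use s z f \<epsilon> n3M aC bRa pos M1 C1 n3 ab1 in \<open>auto simp: Ra_def\<close>)
    have CZ1: "0 \<le> C * (Z + C * Z)" "C \<le> C * Z" "0 \<le> C * Z" "C * (C * Z) \<le> C * (Z + C * Z)"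
      using CZ0 C1 by linarith+
    define \<beta>2 where "\<beta>2 = n2 - \<nu>1"
    define \<beta>3 where "\<beta>3 = n3 - \<nu>1"
    define B where "B = dual_matrix S z h \<nu>1"
    have \<beta>2: "\<beta>2 = zs * (b - a)" unfolding \<beta>2_def \<nu>a nb by (simp add: algebra_simps)
    have \<beta>2n: "cmod zs * c \<le> cmod \<beta>2"
      unfolding \<beta>2 norm_mult using sep by (intro mult_left_mono) (auto simp: norm_minus_commute)
    have \<beta>3n: "cmod \<beta>3 \<le> 3 * M"
      using norm_triangle_ineq4[of n3 \<nu>1] n3M \<nu>C M1 by (simp add: \<beta>3_def)
    have G: "norm (B *v (B *v p) - (\<beta>2 + \<beta>3) *s (B *v p) + (\<beta>2 * \<beta>3) *s p) \<le> R * cmod \<beta>2 * norm p" for p :: "complex^3"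
    proof -
      let ?k = "h - \<nu>1"
      have e: "B *v (B *v p) - (\<beta>2 + \<beta>3) *s (B *v p) + (\<beta>2 * \<beta>3) *s p = zs *s vector
        [(- S - a * ?k) * p $ 1 + 1 * p $ 2 + (- (a * S)) * p $ 3,
         (S\<^sup>2 + ?k) * p $ 1 + (- S - a * ?k) * p $ 2 + (S - a * S\<^sup>2) * p $ 3,
         (z - \<nu>1) * p $ 1 + (- (a * z)) * p $ 2 + (a * \<nu>1) * p $ 3]"
        unfolding vec_eq_iff forall_3 \<beta>2_def \<beta>3_def B_def
        apply (simp add: dual_matrix_mult)
        apply (intro conjI)
        subgoal using n \<nu>a zs_def by algebra
        subgoal using n \<nu>a zs_def by algebra
        subgoal using n \<nu>a zs_def by algebra
        done
      have ak: "cmod (a * ?k) \<le> C * (Z + C * Z)" unfolding norm_mult using aC h\<nu> C1 by (intro mult_mono) auto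
      have S2n: "cmod (S\<^sup>2) \<le> 1" using Sn(1) by (simp add: norm_power power_le_one)
      have aS: "cmod (a * S) \<le> C" "cmod (a * S\<^sup>2) \<le> C" "cmod (a * z) \<le> C * Z" "cmod (a * \<nu>1) \<le> C * (C * Z)"
        using mult_mono[OF aC Sn(1)] mult_mono[OF aC S2n] mult_mono[OF aC zZ(1)] mult_mono[OF aC \<nu>C(2)] C1
        by (simp_all add: norm_mult)
      have F: "cmod (- S - a * ?k) \<le> E"
        "cmod 1 \<le> E"
        "cmod (- (a * S)) \<le> E"
        "cmod (S\<^sup>2 + ?k) \<le> E"
        "cmod (S - a * S\<^sup>2) \<le> E"
        "cmod (z - \<nu>1) \<le> E"
        "cmod (- (a * z)) \<le> E"
        "cmod (a * \<nu>1) \<le> E"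
      proof -
        show "cmod (- S - a * ?k) \<le> E"
          using norm_triangle_ineq4[of "- S" "a * ?k"] ak Sn(1) CZ1 Z1 unfolding E_def norm_minus_cancel by linarith
        show "cmod 1 \<le> E" using E1 by simp
        show "cmod (- (a * S)) \<le> E" using aS CZ1 Z1 unfolding E_def norm_minus_cancel by linarith
        show "cmod (S\<^sup>2 + ?k) \<le> E" using norm_triangle_ineq[of "S\<^sup>2" ?k] S2n h\<nu> CZ1 unfolding E_def by linarith
        show "cmod (S - a * S\<^sup>2) \<le> E"
          using norm_triangle_ineq4[of S "a * S\<^sup>2"] aS Sn(1) CZ1 Z1 unfolding E_def by linarith
        show "cmod (z - \<nu>1) \<le> E" using norm_triangle_ineq4[of z \<nu>1] zZ \<nu>C CZ1 unfolding E_def by linarith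
        show "cmod (- (a * z)) \<le> E" using aS CZ1 Z1 unfolding E_def norm_minus_cancel by linarith
        show "cmod (a * \<nu>1) \<le> E" using aS CZ1 Z1 unfolding E_def by linarith
      qed
      have "norm (zs *s (vector
        [(- S - a * ?k) * p $ 1 + 1 * p $ 2 + (- (a * S)) * p $ 3,
         (S\<^sup>2 + ?k) * p $ 1 + (- S - a * ?k) * p $ 2 + (S - a * S\<^sup>2) * p $ 3,
         (z - \<nu>1) * p $ 1 + (- (a * z)) * p $ 2 + (a * \<nu>1) * p $ 3] :: complex^3))
         \<le> cmod zs * (3 * (3 * E * norm p))"
        unfolding norm_smult_vec
        by (intro mult_left_mono norm_vec3_le norm_ge_zero) (simp_all only: vector_3, (intro cmod_row_le F)+)
      also have "\<dots> = (9 * E / c) * (cmod zs * c) * norm p" using c by simp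
      also have "\<dots> \<le> R * cmod \<beta>2 * norm p"
        using R \<beta>2n E1 c by (intro mult_right_mono mult_mono) auto
      finally show ?thesis unfolding e .
    qed
    have "splitting B \<beta>2 \<beta>3 R"
      unfolding splitting_def
    proof (intro conjI allI G)
      show "B *v (B *v (B *v p)) = (\<beta>2 + \<beta>3) *s (B *v (B *v p)) - (\<beta>2 * \<beta>3) *s (B *v p)" for p
        unfolding B_def \<beta>2_def \<beta>3_def by (rule dual_matrix_cubic[OF n])
      show "norm (B *v p - \<beta>3 *s p) \<le> R * norm p" for p
      proof -
        have "norm (B *v p - \<beta>3 *s p) \<le> 45 * M * norm p"
          unfolding B_def using Sn zZ M1 \<nu>C \<beta>3n by (intro dual_matrix_norm_bounds) auto
        also have "\<dots> \<le> R * norm p" using R by (intro mult_right_mono) auto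
        finally show ?thesis .
      qed
    qed
    moreover have "cmod \<nu>1 \<le> R * cmod z * s"
    proof -
      have "C * cmod z * s \<le> R * cmod z * s" using R s by (intro mult_right_mono) auto
      then show ?thesis using \<nu>C by linarith
    qed
    moreover have "\<beta>2 \<noteq> 0"
    proof -
      have "0 < cmod zs * c" using zs0 c by simp
      then show ?thesis using \<beta>2n by auto
    qed
    moreover have "0 \<le> Re \<beta>2" "\<epsilon> / 2 \<le> Re \<beta>3" using n2 n3 \<nu>1 by (simp_all add: \<beta>2_def \<beta>3_def)
    moreover have "cmod \<beta>3 \<le> R" using \<beta>3n R M1 by linarith
    ultimately show "cmod \<nu>1 \<le> R * cmod z * s \<and>
       (\<exists>\<beta>2 \<beta>3. splitting (dual_matrix (of_real s) z (z - of_real f) \<nu>1) \<beta>2 \<beta>3 R \<and>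
         \<beta>2 \<noteq> 0 \<and> 0 \<le> Re \<beta>2 \<and> \<epsilon> / 2 \<le> Re \<beta>3 \<and> cmod \<beta>3 \<le> R)"
      unfolding S_def[symmetric] h_def[symmetric] B_def[symmetric] by blast
  qed
qed

section \<open>The shock profile\<close>

lemma one_minus_powr_le:
  fixes x \<gamma> :: real
  assumes "1 \<le> \<gamma>" "0 < x"
  shows "1 - x powr \<gamma> \<le> \<gamma> * (1 - x)"
proof -
  have "x powr \<gamma> - 1 powr \<gamma> \<ge> \<gamma> * 1 powr (\<gamma> - 1) * (x - 1)"
  proof (rule convex_on_imp_above_tangent[OF powr_convex[OF assms(1)]])
    show "((\<lambda>x. x powr \<gamma>) has_real_derivative \<gamma> * 1 powr (\<gamma> - 1)) (at 1 within {0<..})"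
      by (rule has_field_derivative_at_within[OF has_real_derivative_powr]) simp
  qed (use assms in \<open>auto simp: interior_open\<close>)
  then show ?thesis by (simp add: algebra_simps)
qed

lemma powr_chord_le:
  fixes p r \<gamma> :: real
  assumes "1 \<le> \<gamma>" "0 < p" "p < 1" "p \<le> r" "r \<le> 1"
  shows "(r powr \<gamma> - p powr \<gamma>) * (1 - p) \<le> (r - p) * (1 - p powr \<gamma>)"
proof -
  define t where "t = (r - p) / (1 - p)"
  have tp: "t * (1 - p) = r - p" using assms by (simp add: t_def)
  have t: "0 \<le> t" "t \<le> 1" using assms by (auto simp: t_def)
  have t3: "r = (1 - t) * p + t * 1" using tp by (simp add: algebra_simps)
  have "((1 - t) * p + t * 1) powr \<gamma> \<le> (1 - t) * p powr \<gamma> + t * 1 powr \<gamma>"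
    using convex_onD[OF powr_convex[OF assms(1)], of t p 1] t assms by simp
  then have "r powr \<gamma> - p powr \<gamma> \<le> t * (1 - p powr \<gamma>)" unfolding t3[symmetric] by (simp add: algebra_simps)
  then have "(r powr \<gamma> - p powr \<gamma>) * (1 - p) \<le> t * (1 - p powr \<gamma>) * (1 - p)"
    using assms by (intro mult_right_mono) auto
  also have "\<dots> = (r - p) * (1 - p powr \<gamma>)" using assms by (simp add: t_def field_simps)
  finally show ?thesis .
qed

lemma powr_lt_one:
  fixes p \<gamma> :: real
  assumes "1 \<le> \<gamma>" "0 < p" "p < 1"
  shows "p powr \<gamma> < 1"
  using powr_less_mono2[of \<gamma> p 1] assms by simp

text \<open>The value of \<open>a v\<^sup>-\<^sup>\<gamma>\<close> at \<open>v = v\<^sub>+\<close>. It lies between \<open>1 / \<gamma>\<close> and \<open>1\<close>, whereas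
  \<open>a\<close> and the negative power degenerate as \<open>v\<^sub>+ \<rightarrow> 0\<close>.\<close>

definition pressure :: "real \<Rightarrow> real \<Rightarrow> real" where
  "pressure \<gamma> vp = (1 - vp) / (1 - vp powr \<gamma>)"

lemma pressure_bounds:
  assumes "1 \<le> \<gamma>" "0 < vp" "vp < 1"
  shows "0 < pressure \<gamma> vp" "pressure \<gamma> vp \<le> 1" "1 \<le> \<gamma> * pressure \<gamma> vp"
proof -
  have "vp powr \<gamma> < 1" by (rule powr_lt_one[OF assms])
  moreover have "vp powr \<gamma> \<le> vp" using assms by (intro powr_le_one_le) auto
  ultimately show "0 < pressure \<gamma> vp" "pressure \<gamma> vp \<le> 1" "1 \<le> \<gamma> * pressure \<gamma> vp"
    using assms one_minus_powr_le[OF assms(1,2)] by (auto simp: pressure_def field_simps)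
qed

lemma acoef_powr:
  assumes "1 \<le> \<gamma>" "0 < vp" "vp < 1" "0 < v"
  shows "acoef \<gamma> vp * v powr (- \<gamma>) = pressure \<gamma> vp * (vp / v) powr \<gamma>"
  using assms by (simp add: acoef_def pressure_def powr_divide powr_minus field_simps)

lemma acoef_pressure: "acoef \<gamma> vp = pressure \<gamma> vp * vp powr \<gamma>"
  by (simp add: acoef_def pressure_def)

lemma acoef_bounds:
  assumes "1 \<le> \<gamma>" "0 < vp" "vp < 1"
  shows "0 \<le> acoef \<gamma> vp" "acoef \<gamma> vp \<le> 1"
proof -
  have "pressure \<gamma> vp * vp powr \<gamma> \<le> 1 * 1"
    using pressure_bounds[OF assms] powr_lt_one[OF assms] by (intro mult_mono) auto
  then show "0 \<le> acoef \<gamma> vp" "acoef \<gamma> vp \<le> 1"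
    using pressure_bounds[OF assms] by (auto simp: acoef_pressure)
qed

definition slope :: "real \<Rightarrow> real \<Rightarrow> real \<Rightarrow> real" where
  "slope \<gamma> vp v = v * (v - 1 + acoef \<gamma> vp * (v powr (- \<gamma>) - 1))"

text \<open>The profile equation is compared with two logistic equations. With \<open>r = v\<^sub>+ / v\<close>, the lower bound
  says that the graph of \<open>r\<close> to the power \<open>\<gamma>\<close> lies below its chord over \<open>[v\<^sub>+, 1]\<close>. Neither bound
  involves \<open>\<gamma>\<close>.\<close>

lemma slope_bounds:
  assumes g: "1 \<le> \<gamma>" "0 < vp" "vp < 1" and v: "vp \<le> v" "v \<le> 1"
  shows "(v - vp) * (1 - v) \<le> - slope \<gamma> vp v" "- slope \<gamma> vp v \<le> v * (1 - v)"
proof -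
  have v0: "0 < v" using g v by simp
  have r: "vp \<le> vp / v" "vp / v \<le> 1" using g v v0 by (auto simp: field_simps)
  have "acoef \<gamma> vp * (v powr (- \<gamma>) - 1) = pressure \<gamma> vp * ((vp / v) powr \<gamma> - vp powr \<gamma>)"
    unfolding right_diff_distrib acoef_powr[OF g v0] by (simp add: acoef_pressure)
  also have "\<dots> = ((vp / v) powr \<gamma> - vp powr \<gamma>) * (1 - vp) / (1 - vp powr \<gamma>)"
    by (simp add: pressure_def)
  also have "\<dots> \<le> vp / v - vp"
    using powr_chord_le[OF g r] powr_lt_one[OF g] by (simp add: divide_le_eq)
  finally have "v * (1 - v - acoef \<gamma> vp * (v powr (- \<gamma>) - 1)) \<ge> v * (1 - v - (vp / v - vp))"
    using v0 by (intro mult_left_mono) auto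
  moreover have "v * (1 - v - (vp / v - vp)) = (v - vp) * (1 - v)" using v0 by (simp add: field_simps)
  ultimately show "(v - vp) * (1 - v) \<le> - slope \<gamma> vp v" by (simp add: slope_def algebra_simps)
  have "1 \<le> v powr (- \<gamma>)" using v v0 g by (simp add: powr_minus one_le_inverse_iff powr_le1)
  then have "v * (acoef \<gamma> vp * (v powr (- \<gamma>) - 1)) \<ge> 0" using acoef_bounds[OF g] v0 by simp
  then show "- slope \<gamma> vp v \<le> v * (1 - v)" by (simp add: slope_def algebra_simps)
qed

text \<open>At the end state \<open>f = v\<^sub>+ - \<gamma> pressure\<close>. The upper bound keeps \<open>f\<close> away from zero as long as
  \<open>v\<^sub>+ \<le> 1 - \<epsilon>\<close>, and this is the spectral gap at \<open>+\<infinity>\<close>.\<close>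

lemma fcoef_end_bounds:
  assumes g: "1 \<le> \<gamma>" "0 < vp" "vp < 1"
  shows "- \<gamma> \<le> fcoef \<gamma> vp vp" "fcoef \<gamma> vp vp \<le> vp - 1"
proof -
  note P = pressure_bounds[OF g]
  have 1: "pressure \<gamma> vp * (1 - vp powr \<gamma>) = 1 - vp" using powr_lt_one[OF g] by (simp add: pressure_def)
  have 2: "acoef \<gamma> vp * vp powr (- \<gamma>) = pressure \<gamma> vp"
    using acoef_powr[OF g g(2)] g by simp
  have "fcoef \<gamma> vp vp = 2 * vp - (\<gamma> - 1) * (acoef \<gamma> vp * vp powr (- \<gamma>)) - (acoef \<gamma> vp + 1)"
    by (simp add: fcoef_def algebra_simps)
  also have "\<dots> = vp - \<gamma> * pressure \<gamma> vp"
    unfolding 2 unfolding acoef_pressure using 1 by (simp add: algebra_simps)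
  finally have eq: "fcoef \<gamma> vp vp = vp - \<gamma> * pressure \<gamma> vp" .
  have "\<gamma> * pressure \<gamma> vp \<le> \<gamma> * 1" using P g by (intro mult_left_mono) auto
  then show "- \<gamma> \<le> fcoef \<gamma> vp vp" "fcoef \<gamma> vp vp \<le> vp - 1" using P(3) g unfolding eq by linarith+
qed

lemma fcoef_upper:
  assumes g: "1 \<le> \<gamma>" "0 < vp" "vp < 1" and v: "0 < v"
  shows "fcoef \<gamma> vp v \<le> 2 * v - 1"
proof -
  have "0 \<le> acoef \<gamma> vp * (\<gamma> - 1) * v powr (- \<gamma>)" using acoef_bounds[OF g] g by simp
  then show ?thesis unfolding fcoef_def using acoef_bounds[OF g] by linarith
qed

text \<open>The bound has to be in terms of the relative distance to \<open>v\<^sub>+\<close>, because \<open>f\<close> depends on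
  \<open>v\<^sub>+ / v\<close>. This is why the region near \<open>+\<infinity>\<close> is where \<open>v \<le> (1 + \<kappa>) v\<^sub>+\<close>.\<close>

lemma fcoef_near_end:
  assumes g: "1 \<le> \<gamma>" "0 < vp" "vp < 1" and v: "vp \<le> v" "v \<le> 1"
  shows "\<bar>fcoef \<gamma> vp v - fcoef \<gamma> vp vp\<bar> \<le> (2 + \<gamma>\<^sup>2) * ((v - vp) / vp)"
proof -
  have v0: "0 < v" using g v by simp
  note P = pressure_bounds[OF g]
  let ?r = "vp / v"
  have r: "0 < ?r" "?r \<le> 1" using g v v0 by auto
  have "fcoef \<gamma> vp v - fcoef \<gamma> vp vp
    = 2 * (v - vp) + (\<gamma> - 1) * (acoef \<gamma> vp * vp powr (- \<gamma>) - acoef \<gamma> vp * v powr (- \<gamma>))"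
    by (simp add: fcoef_def algebra_simps)
  also have "\<dots> = 2 * (v - vp) + (\<gamma> - 1) * (pressure \<gamma> vp * (1 - ?r powr \<gamma>))"
    unfolding acoef_powr[OF g v0] acoef_powr[OF g g(2)] using g by (simp add: algebra_simps)
  finally have eq: "fcoef \<gamma> vp v - fcoef \<gamma> vp vp = 2 * (v - vp) + (\<gamma> - 1) * (pressure \<gamma> vp * (1 - ?r powr \<gamma>))" .
  have nn: "0 \<le> 1 - ?r powr \<gamma>" using r g by (simp add: powr_le1)
  have rv: "1 - ?r \<le> (v - vp) / vp"
  proof -
    have "1 - ?r = (v - vp) / v" using v0 by (simp add: field_simps)
    also have "\<dots> \<le> (v - vp) / vp" using v g v0 by (intro divide_left_mono) auto
    finally show ?thesis .
  qed
  have "(\<gamma> - 1) * (pressure \<gamma> vp * (1 - ?r powr \<gamma>)) \<le> \<gamma> * (1 * (\<gamma> * ((v - vp) / vp)))"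
  proof (intro mult_mono)
    show "1 - ?r powr \<gamma> \<le> \<gamma> * ((v - vp) / vp)"
      using one_minus_powr_le[OF g(1) r(1)] mult_left_mono[OF rv, of \<gamma>] g by linarith
  qed (use P nn g v in auto)
  moreover have "2 * (v - vp) \<le> 2 * ((v - vp) / vp)"
  proof -
    have "(v - vp) * vp \<le> (v - vp) * 1" using g v by (intro mult_left_mono) auto
    then have "v - vp \<le> (v - vp) / vp" using g by (simp add: pos_le_divide_eq)
    then show ?thesis by (rule mult_left_mono) simp
  qed
  moreover have "0 \<le> (\<gamma> - 1) * (pressure \<gamma> vp * (1 - ?r powr \<gamma>))" using P nn g by simp
  ultimately show ?thesis unfolding eq using v by (simp add: power2_eq_square algebra_simps)
qed

lemma fcoef_near_one:
  assumes g: "1 \<le> \<gamma>" "0 < vp" "vp < 1" and v: "1 / 2 \<le> v" "v \<le> 1"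
  shows "\<bar>fcoef \<gamma> vp 1 - fcoef \<gamma> vp v\<bar> \<le> (2 + \<gamma>\<^sup>2 * 2 powr \<gamma>) * (1 - v)"
proof -
  have v0: "0 < v" using v by simp
  have eq: "fcoef \<gamma> vp 1 - fcoef \<gamma> vp v = 2 * (1 - v) + (\<gamma> - 1) * (acoef \<gamma> vp * (v powr (- \<gamma>) - 1))"
    by (simp add: fcoef_def algebra_simps)
  have 1: "1 \<le> v powr (- \<gamma>)" using v v0 g by (simp add: powr_minus one_le_inverse_iff powr_le1)
  have "v powr (- \<gamma>) - 1 = v powr (- \<gamma>) * (1 - v powr \<gamma>)"
    using v0 by (simp add: right_diff_distrib flip: powr_add)
  also have "\<dots> \<le> 2 powr \<gamma> * (\<gamma> * (1 - v))"
  proof (intro mult_mono)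
    have "v powr (- \<gamma>) \<le> (1 / 2) powr (- \<gamma>)" using v g by (intro powr_mono2') auto
    also have "(1 / 2 :: real) powr (- \<gamma>) = 2 powr \<gamma>" by (simp add: powr_minus powr_divide)
    finally show "v powr (- \<gamma>) \<le> 2 powr \<gamma>" .
  qed (use one_minus_powr_le[OF g(1) v0] v g v0 in \<open>auto simp: powr_le1\<close>)
  finally have "(\<gamma> - 1) * (acoef \<gamma> vp * (v powr (- \<gamma>) - 1)) \<le> \<gamma> * (1 * (2 powr \<gamma> * (\<gamma> * (1 - v))))"
    using acoef_bounds[OF g] g 1 by (intro mult_mono) auto
  moreover have "0 \<le> (\<gamma> - 1) * (acoef \<gamma> vp * (v powr (- \<gamma>) - 1))" using acoef_bounds[OF g] g 1 by simp
  ultimately show ?thesis unfolding eq using v by (simp add: power2_eq_square algebra_simps)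
qed

lemma fcoef_one: "fcoef \<gamma> vp 1 = 1 - \<gamma> * acoef \<gamma> vp"
  by (simp add: fcoef_def algebra_simps)

lemma profile_translate:
  assumes "profile \<gamma> vp v0 v"
  shows "profile \<gamma> vp (v s) (\<lambda>x. v (x + s))"
  unfolding profile_def
proof (intro conjI allI)
  fix x
  have "(v has_real_derivative v (x + s) * (v (x + s) - 1 + acoef \<gamma> vp * (v (x + s) powr (-\<gamma>) - 1))) (at (x + s))"
    using assms by (simp add: profile_def)
  then show "((\<lambda>x. v (x + s)) has_real_derivative
      v (x + s) * (v (x + s) - 1 + acoef \<gamma> vp * (v (x + s) powr (-\<gamma>) - 1))) (at x)"
    by (simp add: DERIV_shift)
next
  show "antimono (\<lambda>x. v (x + s))" using assms by (auto simp: profile_def antimono_def)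
  have lims: "(v \<longlongrightarrow> 1) at_bot" "(v \<longlongrightarrow> vp) at_top" using assms by (simp_all add: profile_def)
  show "((\<lambda>x. v (x + s)) \<longlongrightarrow> 1) at_bot" by (rule filterlim_compose[OF lims(1) filterlim_shift_at_bot])
  show "((\<lambda>x. v (x + s)) \<longlongrightarrow> vp) at_top" by (rule filterlim_compose[OF lims(2) filterlim_shift_at_top])
qed auto

lemma profile_facts:
  assumes v: "profile \<gamma> vp v0 v"
  shows "(v has_real_derivative slope \<gamma> vp (v x)) (at x)" "vp \<le> v x" "v x \<le> 1" "x \<le> y \<Longrightarrow> v y \<le> v x"
proof -
  have am: "antimono v" and lims: "(v \<longlongrightarrow> 1) at_bot" "(v \<longlongrightarrow> vp) at_top" using v by (auto simp: profile_def)
  show "(v has_real_derivative slope \<gamma> vp (v x)) (at x)" using v by (simp add: profile_def slope_def)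
  show "x \<le> y \<Longrightarrow> v y \<le> v x" for x y using am by (auto simp: antimono_def)
  then show "vp \<le> v x"
    by (intro tendsto_upperbound[OF lims(2)] eventually_at_top_linorderI[of x]) auto
  show "v x \<le> 1"
    using am by (intro tendsto_lowerbound[OF lims(1)] eventually_at_bot_linorderI[of x]) (auto simp: antimono_def)
qed

lemma profile_decay_right:
  assumes g: "1 \<le> \<gamma>" "0 < vp" "vp < 1" and v: "profile \<gamma> vp v0 v"
    and c: "c \<le> 1 - v X" and x: "X \<le> x"
  shows "v x - vp \<le> (v X - vp) * exp (- c * (x - X))"
proof -
  note F = profile_facts[OF v]
  have "v x - vp \<le> (v X - vp) * exp (- c * x - - c * X)"
  proof (rule gronwall_forward[OF x, where N' = "\<lambda>x. slope \<gamma> vp (v x)" and \<phi> = "\<lambda>x. - c"])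
    show "((\<lambda>x. v x - vp) has_real_derivative slope \<gamma> vp (v t)) (at t)" for t
      using DERIV_diff[OF F(1)[of t] DERIV_const[of vp]] by simp
    show "((*) (- c) has_real_derivative - c) (at t)" for t
      by (auto intro!: derivative_eq_intros)
    fix t assume "X \<le> t"
    then have "c \<le> 1 - v t" using c F(4)[of X t] by simp
    then have "(v t - vp) * c \<le> (v t - vp) * (1 - v t)" using F(2)[of t] by (intro mult_left_mono) auto
    then show "slope \<gamma> vp (v t) \<le> - c * (v t - vp)"
      using slope_bounds(1)[OF g F(2,3), of t] by (simp add: mult.commute)
  qed
  then show ?thesis by (simp add: algebra_simps)
qed

lemma profile_decay_left:
  assumes g: "1 \<le> \<gamma>" "0 < vp" "vp < 1" and v: "profile \<gamma> vp v0 v"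
    and c: "c \<le> v X - vp" and x: "x \<le> X"
  shows "1 - v x \<le> (1 - v X) * exp (- c * (X - x))"
proof -
  note F = profile_facts[OF v]
  have "1 - v x \<le> (1 - v X) * exp (- c * X - - c * x)"
  proof (rule gronwall_backward[OF x, where N' = "\<lambda>x. - slope \<gamma> vp (v x)" and \<phi> = "\<lambda>x. - c"])
    show "((\<lambda>x. 1 - v x) has_real_derivative - slope \<gamma> vp (v t)) (at t)" for t
      using DERIV_diff[OF DERIV_const[of 1] F(1)[of t]] by simp
    show "((*) (- c) has_real_derivative - c) (at t)" for t
      by (auto intro!: derivative_eq_intros)
    fix t assume "t \<le> X"
    then have "c \<le> v t - vp" using c F(4)[of t X] by simp
    then have "c * (1 - v t) \<le> (v t - vp) * (1 - v t)" using F(3)[of t] by (intro mult_right_mono) auto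
    then show "- (- c * (1 - v t)) \<le> - slope \<gamma> vp (v t)"
      using slope_bounds(1)[OF g F(2,3), of t] by simp
  qed
  then show ?thesis by (simp add: algebra_simps)
qed

text \<open>The profile does not approach \<open>1\<close> faster than \<open>exp x\<close>, by \<open>- v' \<le> 1 - v\<close>. Hence a value
  \<open>v\<^sub>0\<close> near \<open>1\<close> is attained only far to the left.\<close>

lemma profile_lower_left:
  assumes g: "1 \<le> \<gamma>" "0 < vp" "vp < 1" and v: "profile \<gamma> vp v0 v" and x: "x \<le> X"
  shows "1 - v X \<le> (1 - v x) * exp (X - x)"
proof (rule gronwall_forward[OF x, where N' = "\<lambda>x. - slope \<gamma> vp (v x)" and \<phi> = "\<lambda>x. 1" and \<Phi> = "\<lambda>x. x"])
  note F = profile_facts[OF v]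
  show "((\<lambda>x. 1 - v x) has_real_derivative - slope \<gamma> vp (v t)) (at t)" for t
    using DERIV_diff[OF DERIV_const[of 1] F(1)[of t]] by simp
  show "- slope \<gamma> vp (v t) \<le> 1 * (1 - v t)" for t
    using slope_bounds(2)[OF g F(2,3), of t] mult_right_mono[OF F(3), of "1 - v t" t] F(3)[of t] by simp
qed auto

section \<open>The adjoint system near plus infinity\<close>

lemma adjoint_components:
  assumes "solves (\<lambda>x. - cadj (coef_matrix (v x) (f x) z)) W"
  shows "((\<lambda>x. cnj (W x $ 1)) has_vector_derivative (- of_real (v x) * cnj (W x $ 3))) (at x)"
    "((\<lambda>x. cnj (W x $ 2)) has_vector_derivative (- z * cnj (W x $ 1) - of_real (v x) * cnj (W x $ 3))) (at x)"
    "((\<lambda>x. cnj (W x $ 3)) has_vector_derivative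
        (- z * cnj (W x $ 1) - z * cnj (W x $ 2) + (z - of_real (f x)) * cnj (W x $ 3))) (at x)"
proof -
  have "(W has_vector_derivative (- cadj (coef_matrix (v x) (f x) z)) *v W x) (at x)"
    using assms by (simp add: solves_def)
  from has_vector_derivative_vec_nth[OF this]
  have *: "((\<lambda>x. cnj (W x $ i)) has_vector_derivative cnj (((- cadj (coef_matrix (v x) (f x) z)) *v W x) $ i)) (at x)" for i
    by (rule bounded_linear.has_vector_derivative[OF bounded_linear_cnj])
  show "((\<lambda>x. cnj (W x $ 1)) has_vector_derivative (- of_real (v x) * cnj (W x $ 3))) (at x)"
    "((\<lambda>x. cnj (W x $ 2)) has_vector_derivative (- z * cnj (W x $ 1) - of_real (v x) * cnj (W x $ 3))) (at x)"
    "((\<lambda>x. cnj (W x $ 3)) has_vector_derivative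
        (- z * cnj (W x $ 1) - z * cnj (W x $ 2) + (z - of_real (f x)) * cnj (W x $ 3))) (at x)"
    using *[of 1] *[of 2] *[of 3] by (simp_all only: adjoint_matrix_mult) simp_all
qed

lemma has_vector_derivative_exp_scaled:
  assumes "(g has_vector_derivative g') (at x)"
  shows "((\<lambda>x. exp (- \<nu> * complex_of_real x) * g x) has_vector_derivative
    (exp (- \<nu> * complex_of_real x) * g' - \<nu> * (exp (- \<nu> * complex_of_real x) * g x))) (at x)"
proof -
  have "((\<lambda>x. exp (- \<nu> * complex_of_real x)) has_vector_derivative - \<nu> * exp (- \<nu> * complex_of_real x)) (at x)"
    using has_vector_derivative_cexp[of "- \<nu>" 0] by simp
  from has_vector_derivative_mult[OF this assms] show ?thesis
    by (rule has_vector_derivative_eq_rhs) (simp add: algebra_simps)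
qed

text \<open>Dividing by \<open>s\<close> matches the scaling of \<open>dual_matrix\<close>; for \<open>s = 1\<close> this is the conjugate of \<open>W\<close>
  times \<open>exp (- \<nu> x)\<close>.\<close>

definition scaled_dual :: "complex \<Rightarrow> complex \<Rightarrow> (real \<Rightarrow> complex^3) \<Rightarrow> real \<Rightarrow> complex^3" where
  "scaled_dual s \<nu> W x = vector
    [exp (- \<nu> * of_real x) * cnj (W x $ 1) / s, exp (- \<nu> * of_real x) * cnj (W x $ 2), exp (- \<nu> * of_real x) * cnj (W x $ 3)]"

lemma scaled_dual_equation:
  assumes W: "solves (\<lambda>x. - cadj (coef_matrix (v x) (f x) z)) W" and s: "s \<noteq> 0"
  shows "(scaled_dual s \<nu> W has_vector_derivative
    (dual_matrix s z (z - of_real fe) \<nu> *v scaled_dual s \<nu> W x +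
      vector [- ((of_real (v x) - s\<^sup>2) / s) * scaled_dual s \<nu> W x $ 3, - (of_real (v x) - s\<^sup>2) * scaled_dual s \<nu> W x $ 3,
        of_real (fe - f x) * scaled_dual s \<nu> W x $ 3])) (at x)"
proof (rule has_vector_derivative_vec)
  fix i :: 3
  note d = adjoint_components[OF W, of x, THEN has_vector_derivative_exp_scaled[where \<nu> = \<nu>]]
  have "((\<lambda>x. exp (- \<nu> * complex_of_real x) * cnj (W x $ 1) / s) has_vector_derivative
    (- \<nu> * (exp (- \<nu> * complex_of_real x) * cnj (W x $ 1) / s) - of_real (v x) / s * (exp (- \<nu> * complex_of_real x) * cnj (W x $ 3)))) (at x)"
    using has_vector_derivative_mult_left[OF d(1), of "1 / s"] by (simp add: diff_divide_distrib algebra_simps minus_diff_commute)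
  then show "((\<lambda>x. scaled_dual s \<nu> W x $ i) has_vector_derivative
    (dual_matrix s z (z - of_real fe) \<nu> *v scaled_dual s \<nu> W x +
      vector [- ((of_real (v x) - s\<^sup>2) / s) * scaled_dual s \<nu> W x $ 3, - (of_real (v x) - s\<^sup>2) * scaled_dual s \<nu> W x $ 3,
        of_real (fe - f x) * scaled_dual s \<nu> W x $ 3]) $ i) (at x)"
    using s exhaust_3[of i]
  proof (elim disjE)
    assume i: "i = 1"
    have "s\<^sup>2 / s = s" by (simp add: power2_eq_square)
    assume "((\<lambda>x. exp (- \<nu> * complex_of_real x) * cnj (W x $ 1) / s) has_vector_derivative
    (- \<nu> * (exp (- \<nu> * complex_of_real x) * cnj (W x $ 1) / s) - of_real (v x) / s * (exp (- \<nu> * complex_of_real x) * cnj (W x $ 3)))) (at x)"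
    then show ?thesis unfolding i
      by (simp add: dual_matrix_mult scaled_dual_def[abs_def] diff_divide_distrib \<open>s\<^sup>2 / s = s\<close> algebra_simps)
  next
    assume i: "i = 2"
    show ?thesis unfolding i
      using d(2) s by (simp add: dual_matrix_mult scaled_dual_def[abs_def] algebra_simps)
  next
    assume i: "i = 3"
    show ?thesis unfolding i
      using d(3) s by (simp add: dual_matrix_mult scaled_dual_def[abs_def] algebra_simps)
  qed
qed

lemma scaled_dual_tendsto:
  assumes "asymp_exp (cnj \<nu>) L F W"
  shows "(scaled_dual s \<nu> W \<longlongrightarrow> vector [cnj (L $ 1) / s, cnj (L $ 2), cnj (L $ 3)]) F"
proof (rule vec_tendstoI)
  fix i :: 3
  have *: "((\<lambda>x. exp (- \<nu> * of_real x) * cnj (W x $ j)) \<longlongrightarrow> cnj (L $ j)) F" for j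
  proof -
    have "((\<lambda>x. cnj ((exp (- cnj \<nu> * complex_of_real x) *s W x) $ j)) \<longlongrightarrow> cnj (L $ j)) F"
      using assms unfolding asymp_exp_def by (intro tendsto_cnj tendsto_vec_nth)
    then show ?thesis by (simp add: exp_cnj)
  qed
  show "((\<lambda>x. scaled_dual s \<nu> W x $ i) \<longlongrightarrow> vector [cnj (L $ 1) / s, cnj (L $ 2), cnj (L $ 3)] $ i) F"
    using exhaust_3[of i] *[of 1] *[of 2] *[of 3]
    by (auto simp: scaled_dual_def divide_inverse intro!: tendsto_mult tendsto_const)
qed

text \<open>Applies \<open>tail_bound\<close> to the rescaled solution on the ray where \<open>v \<le> (1 + \<kappa>) v\<^sub>+\<close>. There the
  relative deviation of \<open>v\<close> from \<open>v\<^sub>+\<close> is at most \<open>\<kappa>\<close> and decays exponentially, so \<open>\<kappa>\<close> can be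
  chosen to make the perturbation as small as needed. The first component of the eigenvector is
  \<open>O(s)\<close> and survives the division by \<open>s\<close>.\<close>

lemma adjoint_tail_bound:
  fixes \<gamma> \<epsilon> :: real and K :: "complex set"
  assumes \<gamma>: "1 \<le> \<gamma>" and K: "compact K" "K \<subseteq> RHP" and \<epsilon>: "0 < \<epsilon>"
  obtains \<kappa> C where "0 < \<kappa>" "\<kappa> \<le> \<epsilon> / 2" "0 \<le> C"
    "\<And>vp z \<nu> L v0 v W X x. \<lbrakk>0 < vp; vp \<le> 1 - \<epsilon>; z \<in> K; z \<noteq> 0;
      {\<mu> \<in> eigenvalues (- cadj (Amat \<gamma> vp vp z)). Re \<mu> < 0} = {cnj \<nu>};
      - cadj (Amat \<gamma> vp vp z) *v L = cnj \<nu> *s L; profile \<gamma> vp v0 v;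
      solves (\<lambda>x. - cadj (Amat \<gamma> vp (v x) z)) W; asymp_exp (cnj \<nu>) L at_top W;
      v X \<le> (1 + \<kappa>) * vp; X \<le> x\<rbrakk> \<Longrightarrow> norm (scaled_dual (of_real (sqrt vp)) \<nu> W x) \<le> C * norm L"
proof -
  obtain R where R1: "1 \<le> R" and R:
    "\<And>z s f \<nu>1. \<lbrakk>z \<in> K; z \<noteq> 0; 0 < s; s \<le> 1; - \<gamma> \<le> f; f \<le> - \<epsilon>; sole_decaying_root (s\<^sup>2) f z \<nu>1\<rbrakk> \<Longrightarrow>
       cmod \<nu>1 \<le> R * cmod z * s \<and>
       (\<exists>\<beta>2 \<beta>3. splitting (dual_matrix (of_real s) z (z - of_real f) \<nu>1) \<beta>2 \<beta>3 R \<and>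
         \<beta>2 \<noteq> 0 \<and> 0 \<le> Re \<beta>2 \<and> \<epsilon> / 2 \<le> Re \<beta>3 \<and> cmod \<beta>3 \<le> R)"
  proof (rule decaying_root_spectral_data[OF K \<epsilon>, of \<gamma>], goal_cases)
    case 1
    show ?case using \<gamma> by simp
  next
    case (2 R)
    show ?case by (rule that[OF 2(2)]) (rule 2(3); assumption)
  qed
  (* k0 * kappa is the size of the perturbation; kappa is chosen to meet the smallness condition of tail_bound. *)
  define k0 where "k0 = 3 * (2 + \<gamma>\<^sup>2)"
  define D where "D = 3 * R / (\<epsilon> / 2) + 1"
  define \<kappa> where "\<kappa> = min (\<epsilon> / 2) (\<epsilon> / 4 / (k0 * D))"
  have k0: "0 < k0" "3 \<le> k0" by (auto simp: k0_def add_pos_nonneg)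
  have D: "0 < D" using R1 \<epsilon> by (simp add: D_def add_pos_pos)
  have \<kappa>: "0 < \<kappa>" "\<kappa> \<le> \<epsilon> / 2" using \<epsilon> k0 D by (auto simp: \<kappa>_def)
  have kD: "k0 * \<kappa> * D \<le> (\<epsilon> / 2) / 2"
  proof -
    have "\<kappa> \<le> \<epsilon> / 4 / (k0 * D)" by (simp add: \<kappa>_def)
    then have "\<kappa> * (k0 * D) \<le> \<epsilon> / 4" using k0 D by (simp add: pos_le_divide_eq)
    then show ?thesis by (simp add: mult_ac)
  qed
  show ?thesis
  proof (rule that[OF \<kappa>, of "2 * R / (\<epsilon> / 2) * (6 * R)"])
    show "0 \<le> 2 * R / (\<epsilon> / 2) * (6 * R)" using R1 \<epsilon> by simp
    fix vp :: real and z \<nu> :: complex and L :: "complex^3" and v0 v and W :: "real \<Rightarrow> complex^3" and X x :: real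
    assume vp: "0 < vp" "vp \<le> 1 - \<epsilon>" and z: "z \<in> K" "z \<noteq> 0"
      and ev: "{\<mu> \<in> eigenvalues (- cadj (Amat \<gamma> vp vp z)). Re \<mu> < 0} = {cnj \<nu>}"
      and L: "- cadj (Amat \<gamma> vp vp z) *v L = cnj \<nu> *s L" and v: "profile \<gamma> vp v0 v"
      and W: "solves (\<lambda>x. - cadj (Amat \<gamma> vp (v x) z)) W" and as: "asymp_exp (cnj \<nu>) L at_top W"
      and X: "v X \<le> (1 + \<kappa>) * vp" and x: "X \<le> x"
    have vp1: "vp < 1" using vp \<epsilon> by simp
    note g = \<gamma> vp(1) vp1
    note F = profile_facts[OF v]
    define s where "s = sqrt vp"
    have s: "0 < s" "s \<le> 1" "s\<^sup>2 = vp" using vp vp1 by (auto simp: s_def)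
    define f where "f = fcoef \<gamma> vp vp"
    have f: "- \<gamma> \<le> f" "f \<le> - \<epsilon>" using fcoef_end_bounds[OF g] vp by (auto simp: f_def)
    have Am: "Amat \<gamma> vp vp z = coef_matrix vp f z" by (simp add: Amat_def f_def)
    have mem: "cnj \<nu> \<in> {\<mu> \<in> eigenvalues (- cadj (Amat \<gamma> vp vp z)). Re \<mu> < 0}" unfolding ev by simp
    then have \<nu>: "Re \<nu> < 0" by simp
    obtain V where "eigenpair (- cadj (coef_matrix vp f z)) (cnj \<nu>) V"
      using mem unfolding Am eigenvalues_def by auto
    from adjoint_eigenpair_root[OF this] have *: "vp \<noteq> 0 \<Longrightarrow> \<nu> \<noteq> 0 \<Longrightarrow> \<nu>^3 - (z - of_real f) * \<nu>\<^sup>2 + (- 2 * of_real vp * z) * \<nu> - (- of_real vp * z\<^sup>2) = 0" .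
    have root: "\<nu>^3 - (z - of_real f) * \<nu>\<^sup>2 + (- 2 * of_real vp * z) * \<nu> - (- of_real vp * z\<^sup>2) = 0"
    proof -
      have "\<nu> \<noteq> 0" using \<nu> by auto
      then show ?thesis using vp by (intro *) auto
    qed
    have uniq: "\<xi> = \<nu>" if "\<xi>^3 - (z - of_real f) * \<xi>\<^sup>2 + (- 2 * of_real vp * z) * \<xi> - (- of_real vp * z\<^sup>2) = 0" "Re \<xi> < 0" for \<xi>
    proof -
      have "cnj \<xi> \<in> eigenvalues (- cadj (coef_matrix vp f z))"
        using that vp by (intro adjoint_eigenvalue) auto
      then have "cnj \<xi> \<in> {\<mu> \<in> eigenvalues (- cadj (Amat \<gamma> vp vp z)). Re \<mu> < 0}" using that by (simp add: Am)
      then show ?thesis unfolding ev by simp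
    qed
    define B where "B = dual_matrix (of_real s) z (z - of_real f) \<nu>"
    have "sole_decaying_root (s\<^sup>2) f z \<nu>"
      unfolding sole_decaying_root_def s(3) using \<nu> root uniq by blast
    from R[OF z s(1,2) f this] obtain \<beta>2 \<beta>3 where \<nu>R: "cmod \<nu> \<le> R * cmod z * s"
      and split: "splitting B \<beta>2 \<beta>3 R"
      and \<beta>: "\<beta>2 \<noteq> 0" "0 \<le> Re \<beta>2" "\<epsilon> / 2 \<le> Re \<beta>3" "cmod \<beta>3 \<le> R"
      unfolding B_def by blast
    define y where "y = scaled_dual (of_real s) \<nu> W"
    define e where "e x = (vector [- ((of_real (v x) - (of_real s)\<^sup>2) / of_real s) * y x $ 3,
        - (of_real (v x) - (of_real s)\<^sup>2) * y x $ 3, of_real (f - fcoef \<gamma> vp (v x)) * y x $ 3] :: complex^3)" for x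
    have dy: "(y has_vector_derivative (B *v y t + e t)) (at t)" for t
      unfolding y_def B_def e_def
      by (rule scaled_dual_equation) (use W s in \<open>auto simp: Amat_def\<close>)
    define L' where "L' = (vector [cnj (L $ 1) / of_real s, cnj (L $ 2), cnj (L $ 3)] :: complex^3)"
    have yL: "(y \<longlongrightarrow> L') at_top" unfolding y_def L'_def by (rule scaled_dual_tendsto[OF as])
    note Leq = adjoint_eigenvector_eqs[OF L[unfolded Am]]
    have BL: "B *v L' = 0"
    proof -
      have vs: "of_real vp = (of_real s :: complex)\<^sup>2" by (simp flip: s(3))
      show ?thesis
        unfolding vec_eq_iff forall_3 B_def dual_matrix_mult L'_def
        using Leq s unfolding vs by (simp add: field_simps power2_eq_square)
    qed
    have L'n: "norm L' \<le> 6 * R * norm L"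
    proof -
      have Li: "cmod (L $ i) \<le> norm L" for i by (rule Finite_Cartesian_Product.norm_nth_le)
      have Li': "cmod (L $ i) \<le> 2 * R * norm L" for i
        using mult_right_mono[OF R1 norm_ge_zero[of L]] Li[of i] norm_ge_zero[of L] by linarith
      (* This combination of the eigenvector equations, with |nu| = O(|z| s), shows that L $ 1 = O(s). *)
      have "z * cnj (L $ 1) = \<nu> * (cnj (L $ 1) - cnj (L $ 2))" using Leq(1,2) by algebra
      then have "cmod z * cmod (L $ 1) = cmod \<nu> * cmod (cnj (L $ 1) - cnj (L $ 2))"
        by (metis complex_mod_cnj norm_mult)
      also have "\<dots> \<le> (R * cmod z * s) * (2 * norm L)"
        using \<nu>R norm_triangle_ineq4[of "cnj (L $ 1)" "cnj (L $ 2)"] Li[of 1] Li[of 2] R1 s by (intro mult_mono) auto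
      finally have "cmod z * cmod (L $ 1) \<le> cmod z * (2 * R * norm L * s)" by (simp add: mult_ac)
      then have "cmod (L $ 1) \<le> 2 * R * norm L * s" using z by (simp add: mult_le_cancel_left_pos)
      then have 1: "cmod (L' $ 1) \<le> 2 * R * norm L" using s by (simp add: L'_def norm_divide pos_divide_le_eq)
      have "norm L' \<le> 3 * (2 * R * norm L)"
        using 1 Li' by (intro norm_vec3_le) (auto simp: L'_def)
      then show ?thesis by simp
    qed
    have ne: "norm (e t) \<le> k0 * \<kappa> * exp (- (\<epsilon> / 2) * (t - X)) * norm (y t)" if t: "X \<le> t" for t
    proof -
      define E where "E = \<kappa> * exp (- (\<epsilon> / 2) * (t - X))"
      have E0: "0 \<le> E" using \<kappa> by (simp add: E_def)
      have "(1 + \<kappa>) * vp \<le> vp + \<kappa>" using vp1 \<kappa> vp mult_left_mono[of vp 1 \<kappa>] by (simp add: algebra_simps)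
      then have "\<epsilon> / 2 \<le> 1 - v X" using X vp \<kappa> by linarith
      from profile_decay_right[OF g v this t] have "v t - vp \<le> (v X - vp) * exp (- (\<epsilon> / 2) * (t - X))" .
      also have "\<dots> \<le> (\<kappa> * vp) * exp (- (\<epsilon> / 2) * (t - X))"
        using X by (intro mult_right_mono) (auto simp: algebra_simps)
      finally have d: "v t - vp \<le> vp * E" by (simp add: E_def mult_ac)
      have d0: "0 \<le> v t - vp" using F(2)[of t] by simp
      have y3: "cmod (y t $ 3) \<le> norm (y t)" by (rule Finite_Cartesian_Product.norm_nth_le)
      have v_s: "of_real (v t) - (of_real s)\<^sup>2 = complex_of_real (v t - vp)" by (simp flip: s(3))
      have a1: "cmod ((of_real (v t) - (of_real s)\<^sup>2) / of_real s) \<le> E"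
      proof -
        have "(v t - vp) / s \<le> (s * s * E) / s" using d s by (intro divide_right_mono) (auto simp: power2_eq_square)
        also have "\<dots> = s * E" using s by simp
        also have "\<dots> \<le> E" using s E0 by (simp add: mult_left_le_one_le)
        finally show ?thesis unfolding v_s norm_divide norm_of_real using d0 s by simp
      qed
      have a2: "cmod (of_real (v t) - (of_real s)\<^sup>2) \<le> E"
      proof -
        have "vp * E \<le> 1 * E" using vp1 E0 by (intro mult_right_mono) auto
        then show ?thesis unfolding v_s norm_of_real using d d0 by simp
      qed
      have a3: "cmod (of_real (f - fcoef \<gamma> vp (v t))) \<le> (2 + \<gamma>\<^sup>2) * E"
      proof -
        have "(v t - vp) / vp \<le> E" using d vp by (simp add: pos_divide_le_eq mult.commute)
        then have "(2 + \<gamma>\<^sup>2) * ((v t - vp) / vp) \<le> (2 + \<gamma>\<^sup>2) * E" by (intro mult_left_mono) auto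
        then show ?thesis using fcoef_near_end[OF g F(2,3), of t] unfolding norm_of_real f_def by linarith
      qed
      have "1 * E \<le> (2 + \<gamma>\<^sup>2) * E" using E0 by (intro mult_right_mono) auto
      then have a12: "cmod (- ((of_real (v t) - (of_real s)\<^sup>2) / of_real s)) \<le> (2 + \<gamma>\<^sup>2) * E"
         "cmod (- (of_real (v t) - (of_real s)\<^sup>2)) \<le> (2 + \<gamma>\<^sup>2) * E"
        using a1 a2 unfolding norm_minus_cancel by linarith+
      have "norm (e t) \<le> 3 * ((2 + \<gamma>\<^sup>2) * E * norm (y t))"
        unfolding e_def
        by (rule norm_vec3_le; simp only: vector_3 norm_mult)
          (intro mult_mono a12 a3 y3 norm_ge_zero mult_nonneg_nonneg E0; simp)+
      then show ?thesis unfolding k0_def E_def by (simp only: mult_ac)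
    qed
    have "norm (y x) \<le> 2 * R / (\<epsilon> / 2) * norm L'"
      by (rule tail_bound[OF split \<beta>(1,2) _ \<beta>(3,4) dy ne _ _ kD[unfolded D_def] yL BL x])
        (use \<epsilon> k0 \<kappa> in auto)
    also have "\<dots> \<le> 2 * R / (\<epsilon> / 2) * (6 * R * norm L)"
      using L'n R1 \<epsilon> by (intro mult_left_mono) auto
    finally show "norm (scaled_dual (of_real (sqrt vp)) \<nu> W x) \<le> 2 * R / (\<epsilon> / 2) * (6 * R) * norm L"
      by (simp add: y_def s_def mult_ac)
  qed
qed

lemma matrix_norm_bound:
  fixes M :: "complex^3^3"
  assumes "\<And>i j. cmod (M $ i $ j) \<le> c"
  shows "norm (M *v p) \<le> 9 * c * norm p"
proof -
  have "norm (M *v p) \<le> 3 * (3 * c * norm p)"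
    by (rule norm_vec3_le) (auto simp: matrix_vector_mult_def sum_3 intro!: cmod_row_le assms)
  then show ?thesis by simp
qed

lemma bounded_solves_zero:
  assumes W: "solves B W" and B: "\<And>x i j. cmod (B x $ i $ j) \<le> c" and a: "W a = 0"
  shows "W x = 0"
  by (rule linear_ode_zero[of W "\<lambda>x. B x *v W x" "9 * c", OF _ _ a])
    (use W in \<open>auto simp: solves_def intro: matrix_norm_bound B\<close>)

lemma solves_diff_smult:
  assumes "solves B W1" "solves B W2"
  shows "solves B (\<lambda>x. W1 x - c *s W2 x)"
  unfolding solves_def
proof
  fix x
  have "((\<lambda>x. W1 x - c *s W2 x) has_vector_derivative B x *v W1 x - c *s (B x *v W2 x)) (at x)"
    using assms by (intro has_vector_derivative_diff has_vector_derivative_smult_const) (auto simp: solves_def)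
  then show "((\<lambda>x. W1 x - c *s W2 x) has_vector_derivative B x *v (W1 x - c *s W2 x)) (at x)"
    by (simp add: matrix_vector_mult_diff_distrib vector_scalar_commute)
qed

lemma solves_shift:
  assumes "solves B W"
  shows "solves (\<lambda>x. B (x + t)) (\<lambda>x. W (x + t))"
  unfolding solves_def
proof
  fix x
  have "((W \<circ> (\<lambda>x. x + t)) has_vector_derivative (1 *\<^sub>R (B (x + t) *v W (x + t)))) (at x)"
  proof (rule vector_diff_chain_at)
    show "((\<lambda>x. x + t) has_vector_derivative 1) (at x)"
      by (auto intro!: derivative_eq_intros)
    show "(W has_vector_derivative B (x + t) *v W (x + t)) (at (x + t))"
      using assms by (simp add: solves_def)
  qed
  then show "((\<lambda>x. W (x + t)) has_vector_derivative B (x + t) *v W (x + t)) (at x)"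
    by (simp add: o_def)
qed

lemma asymp_exp_shift:
  assumes W: "asymp_exp \<mu> V F W" and F: "filterlim (\<lambda>x. x + t) F F"
  shows "asymp_exp \<mu> V F (\<lambda>x. exp (- \<mu> * of_real t) *s W (x + t))"
proof -
  have "((\<lambda>x. exp (- \<mu> * of_real (x + t)) *s W (x + t)) \<longlongrightarrow> V) F"
    using filterlim_compose[OF W[unfolded asymp_exp_def] F] .
  moreover have "exp (- \<mu> * of_real (x + t)) *s W (x + t) = exp (- \<mu> * of_real x) *s (exp (- \<mu> * of_real t) *s W (x + t))" for x
    by (simp add: vec_eq_iff algebra_simps flip: exp_add)
  ultimately show ?thesis unfolding asymp_exp_def by (simp only:)
qed

lemma asymp_exp_diff:
  assumes "asymp_exp \<mu> V1 F W1" "asymp_exp \<mu> V2 F W2"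
  shows "asymp_exp \<mu> (V1 - V2) F (\<lambda>x. W1 x - W2 x)"
proof -
  have "exp (- \<mu> * of_real x) *s (W1 x - W2 x) = exp (- \<mu> * of_real x) *s W1 x - exp (- \<mu> * of_real x) *s W2 x" for x
    by (simp add: vec_eq_iff algebra_simps)
  then show ?thesis using tendsto_diff[OF assms[unfolded asymp_exp_def]] by (simp add: asymp_exp_def)
qed

text \<open>Serves uniqueness for the initial value problem, for which a bound depending on \<open>v\<^sub>+\<close> does.\<close>

lemma Amat_profile_bounded:
  assumes g: "1 \<le> \<gamma>" "0 < vp" "vp < 1" and v: "profile \<gamma> vp v0 v"
  shows "\<exists>c. \<forall>x i j. cmod (Amat \<gamma> vp (v x) z $ i $ j) \<le> c"
proof -
  define c where "c = cmod z + 1 + 3 + (2 + \<gamma>\<^sup>2) / vp + \<gamma>"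
  have c: "0 \<le> (2 + \<gamma>\<^sup>2) / vp" "0 \<le> \<gamma>" using g by (auto intro: add_nonneg_nonneg)
  have fb: "\<bar>fcoef \<gamma> vp (v x)\<bar> \<le> (2 + \<gamma>\<^sup>2) / vp + \<gamma>" for x
  proof -
    note F = profile_facts[OF v, of x]
    have "(2 + \<gamma>\<^sup>2) * ((v x - vp) / vp) \<le> (2 + \<gamma>\<^sup>2) * (1 / vp)"
      using F g by (intro mult_left_mono divide_right_mono) (auto intro: add_nonneg_nonneg)
    then show ?thesis using fcoef_near_end[OF g F(2,3)] fcoef_end_bounds[OF g] g by auto
  qed
  show ?thesis
  proof (intro exI[of _ c] allI)
    fix x and i j :: 3
    note F = profile_facts[OF v, of x]
    have "cmod (of_real (fcoef \<gamma> vp (v x)) - z) \<le> c"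
      using norm_triangle_ineq4[of "of_real (fcoef \<gamma> vp (v x))" z] fb[of x] by (simp add: c_def)
    moreover have "cmod (of_real (v x)) \<le> c"
      unfolding norm_of_real c_def using F(2,3) g(2) c norm_ge_zero[of z] by linarith
    moreover have "cmod z \<le> c" "0 \<le> c" using c by (auto simp: c_def)
    ultimately show "cmod (Amat \<gamma> vp (v x) z $ i $ j) \<le> c"
      using exhaust_3[of i] exhaust_3[of j] by (auto simp: Amat_def coef_matrix_def)
  qed
qed

lemma cadj_bound: "(\<And>i j. cmod (M $ i $ j) \<le> c) \<Longrightarrow> cmod ((- cadj M) $ i $ j) \<le> c"
  by (simp add: cadj_def)

lemma scaled_dual_eq_0: "scaled_dual s \<nu> W x = 0 \<Longrightarrow> s \<noteq> 0 \<Longrightarrow> W x = 0"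
  by (simp add: vec_eq_iff forall_3 scaled_dual_def)

text \<open>The difference of two such solutions has the asymptotic vector \<open>0\<close>, so \<open>adjoint_tail_bound\<close> makes it
  vanish at a point far to the right, hence everywhere.\<close>

lemma adjoint_solution_unique:
  assumes g: "1 \<le> \<gamma>" "0 < vp" "vp < 1" and z: "z \<in> RHP" "z \<noteq> 0"
    and ev: "{\<mu> \<in> eigenvalues (- cadj (Amat \<gamma> vp vp z)). Re \<mu> < 0} = {\<mu>}"
    and v: "profile \<gamma> vp v0 v"
    and W1: "solves (\<lambda>x. - cadj (Amat \<gamma> vp (v x) z)) W1" "asymp_exp \<mu> V at_top W1"
    and W2: "solves (\<lambda>x. - cadj (Amat \<gamma> vp (v x) z)) W2" "asymp_exp \<mu> V at_top W2"
  shows "W1 x = W2 x"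
proof -
  define U where "U x = W1 x - W2 x" for x
  have U: "solves (\<lambda>x. - cadj (Amat \<gamma> vp (v x) z)) U"
    using solves_diff_smult[OF W1(1) W2(1), of 1] by (simp add: U_def[abs_def])
  have U0: "asymp_exp \<mu> 0 at_top U"
    using asymp_exp_diff[OF W1(2) W2(2)] by (simp add: U_def[abs_def])
  have "0 < 1 - vp" using g by simp
  obtain \<kappa> C where \<kappa>: "0 < \<kappa>" and C:
    "\<And>\<nu> L W X x. \<lbrakk>{\<mu> \<in> eigenvalues (- cadj (Amat \<gamma> vp vp z)). Re \<mu> < 0} = {cnj \<nu>};
      - cadj (Amat \<gamma> vp vp z) *v L = cnj \<nu> *s L;
      solves (\<lambda>x. - cadj (Amat \<gamma> vp (v x) z)) W; asymp_exp (cnj \<nu>) L at_top W;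
      v X \<le> (1 + \<kappa>) * vp; X \<le> x\<rbrakk> \<Longrightarrow> norm (scaled_dual (of_real (sqrt vp)) \<nu> W x) \<le> C * norm L"
  proof (rule adjoint_tail_bound[OF g(1), of "{z}" "1 - vp"], goal_cases)
    case (4 \<kappa> C)
    show ?case
      by (rule that[OF 4(2)]) (rule 4(5)[of vp z _ _ v0 v]; (assumption | simp add: g z v))
  qed (use z g in auto)
  have L: "- cadj (Amat \<gamma> vp vp z) *v 0 = cnj (cnj \<mu>) *s 0" by simp
  have "(v \<longlongrightarrow> vp) at_top" using v by (simp add: profile_def)
  then have "\<forall>\<^sub>F x in at_top. v x < (1 + \<kappa>) * vp" by (rule order_tendstoD) (use \<kappa> g in simp)
  then obtain X where X: "v X < (1 + \<kappa>) * vp" by (auto simp: eventually_at_top_linorder)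
  have "norm (scaled_dual (of_real (sqrt vp)) (cnj \<mu>) U X) \<le> C * norm (0 :: complex^3)"
    by (rule C[OF _ L U]) (use ev U0 X in auto)
  then have "U X = 0" using scaled_dual_eq_0[of "of_real (sqrt vp)" "cnj \<mu>" U X] g by simp
  obtain c where c: "\<And>x i j. cmod (Amat \<gamma> vp (v x) z $ i $ j) \<le> c"
    using Amat_profile_bounded[OF g v] by blast
  have "U x = 0"
    by (rule bounded_solves_zero[OF U cadj_bound[OF c] \<open>U X = 0\<close>])
  then show ?thesis by (simp add: U_def)
qed

section \<open>Uniform bounds for the decaying adjoint solution\<close>

text \<open>Young's inequality for the cross terms that appear in \<open>adjoint_transition_bound\<close>, where
  \<open>w\<^sup>4 = v\<close> and \<open>a, b, c\<close> are the moduli of the three components. The weights are balanced so that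
  every term gains at least one factor \<open>w\<close>.\<close>

lemma weighted_energy_estimate:
  fixes w a b c z :: real
  assumes w: "0 < w" "w \<le> 1" and nn: "0 \<le> a" "0 \<le> b" "0 \<le> c" "0 \<le> z" "z \<le> Z"
  shows "2 * a * c + 2 * z * a * b + 2 * w^4 * b * c + w\<^sup>2 * (4 * w^4) * c\<^sup>2 + 2 * w\<^sup>2 * z * c * (a + b)
    \<le> (6 + 3 * Z) * w * (a\<^sup>2 / w^4 + b\<^sup>2 + w\<^sup>2 * c\<^sup>2)"
proof -
  define \<alpha> where "\<alpha> = a / w\<^sup>2"
  define \<zeta> where "\<zeta> = w * c"
  define N where "N = \<alpha>\<^sup>2 + b\<^sup>2 + \<zeta>\<^sup>2"
  have a: "a = w\<^sup>2 * \<alpha>" and c: "c = \<zeta> / w" using w by (simp_all add: \<alpha>_def \<zeta>_def)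
  have pos: "0 \<le> \<alpha>" "0 \<le> \<zeta>" using nn w by (simp_all add: \<alpha>_def \<zeta>_def)
  have N: "2 * (\<alpha> * \<zeta>) \<le> N" "2 * (\<alpha> * b) \<le> N" "2 * (b * \<zeta>) \<le> N" "\<zeta>\<^sup>2 \<le> N" "0 \<le> N"
    using sum_squares_bound[of \<alpha> \<zeta>] sum_squares_bound[of \<alpha> b] sum_squares_bound[of b \<zeta>]
      zero_le_power2[of \<alpha>] zero_le_power2[of b] zero_le_power2[of \<zeta>] unfolding N_def by linarith+
  have wp: "w^2 \<le> w" "w^3 \<le> w" "w^4 \<le> w"
    using w power_decreasing[of 1 2 w] power_decreasing[of 1 3 w] power_decreasing[of 1 4 w] by auto
  have t1: "2 * a * c \<le> w * N"
  proof -
    have "2 * a * c = w * (2 * (\<alpha> * \<zeta>))" using w by (simp add: a c power2_eq_square)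
    also have "\<dots> \<le> w * N" using N w by (intro mult_left_mono) auto
    finally show ?thesis .
  qed
  have t2: "2 * z * a * b \<le> Z * (w * N)"
  proof -
    have "2 * z * a * b = z * (w\<^sup>2 * (2 * (\<alpha> * b)))" by (simp add: a)
    also have "\<dots> \<le> Z * (w * N)" using N w wp nn pos by (intro mult_mono) auto
    finally show ?thesis .
  qed
  have t3: "2 * w^4 * b * c \<le> w * N"
  proof -
    have "2 * w^4 * b * c = w^3 * (2 * (b * \<zeta>))" using w by (simp add: c power4_eq_xxxx power3_eq_cube)
    also have "\<dots> \<le> w * N" using N w wp nn pos by (intro mult_mono) auto
    finally show ?thesis .
  qed
  have t4: "w\<^sup>2 * (4 * w^4) * c\<^sup>2 \<le> 4 * (w * N)"
  proof -
    have "w\<^sup>2 * (4 * w^4) * c\<^sup>2 = 4 * (w^4 * \<zeta>\<^sup>2)" using w by (simp add: c power_divide)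
    also have "\<dots> \<le> 4 * (w * N)" using N w wp by (intro mult_left_mono mult_mono) auto
    finally show ?thesis .
  qed
  have t5: "2 * w\<^sup>2 * z * c * (a + b) \<le> 2 * (Z * (w * N))"
  proof -
    have "2 * w\<^sup>2 * z * c * (a + b) = z * (w^3 * (2 * (\<alpha> * \<zeta>))) + z * (w * (2 * (b * \<zeta>)))"
      using w by (simp add: a c power2_eq_square power3_eq_cube algebra_simps)
    also have "\<dots> \<le> Z * (w * N) + Z * (w * N)"
      using N w wp nn pos by (intro add_mono mult_mono) auto
    finally show ?thesis by (simp only: mult_2)
  qed
  have "N = a\<^sup>2 / w^4 + b\<^sup>2 + w\<^sup>2 * c\<^sup>2" using w by (simp add: N_def \<alpha>_def \<zeta>_def power_divide power_mult_distrib)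
  moreover have "2 * a * c + 2 * z * a * b + 2 * w^4 * b * c + w\<^sup>2 * (4 * w^4) * c\<^sup>2 + 2 * w\<^sup>2 * z * c * (a + b)
    \<le> (6 + 3 * Z) * (w * N)"
    using t1 t2 t3 t4 t5 by (simp add: algebra_simps)
  ultimately show ?thesis by (simp add: mult.assoc)
qed

text \<open>From \<open>X\<close> back to \<open>0\<close>. Since \<open>Re \<nu> \<le> 0\<close>, the factor \<open>- \<nu>\<close> only helps backwards, and the
  diagonal coefficient of the third component is at least \<open>1 - 2 v\<close>. The energy \<open>N\<close> therefore
  satisfies \<open>N' \<ge> - (6 + 3 Z) w N\<close> with \<open>w\<^sup>4 = v\<close>. The length of the interval is not bounded, but
  \<open>c v \<le> - v'\<close> gives \<open>w' \<le> - c w / 4\<close>, so \<open>w\<close> has integral at most \<open>4 / c\<close>.\<close>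

lemma adjoint_transition_bound:
  fixes W :: "real \<Rightarrow> complex^3" and z \<nu> :: complex
  assumes g: "1 \<le> \<gamma>" "0 < vp" "vp < 1" and v: "profile \<gamma> vp v0 v"
    and W: "solves (\<lambda>x. - cadj (Amat \<gamma> vp (v x) z)) W"
    and z: "0 \<le> Re z" "cmod z \<le> Z" and \<nu>: "Re \<nu> \<le> 0" and c: "0 < c"
    and X: "0 \<le> X" "\<And>x. 0 \<le> x \<Longrightarrow> x \<le> X \<Longrightarrow> c * v x \<le> (v x - vp) * (1 - v x)"
  defines "y \<equiv> scaled_dual 1 \<nu> W"
  defines "N \<equiv> \<lambda>x. (cmod (y x $ 1))\<^sup>2 / v x + (cmod (y x $ 2))\<^sup>2 + sqrt (v x) * (cmod (y x $ 3))\<^sup>2"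
  shows "N 0 \<le> N X * exp (4 * (6 + 3 * Z) / c)"
proof -
  note F = profile_facts[OF v]
  have v0: "0 < v x" for x using F(2)[of x] g by simp
  define w where "w x = sqrt (sqrt (v x))" for x
  have w: "0 < w x" "w x \<le> 1" "(w x)\<^sup>2 = sqrt (v x)" "(w x)^4 = v x" for x
  proof -
    show "0 < w x" "w x \<le> 1" "(w x)\<^sup>2 = sqrt (v x)" using v0[of x] F(3)[of x] by (auto simp: w_def)
    then show "(w x)^4 = v x" using v0[of x] power_mult[of "w x" 2 2] by simp
  qed
  define sl where "sl x = slope \<gamma> vp (v x)" for x
  have dsv: "((\<lambda>x. sqrt (v x)) has_real_derivative sl x / (2 * sqrt (v x))) (at x)" for x
    using v0[of x] unfolding sl_def by (auto intro!: derivative_eq_intros F(1) simp: field_simps)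
  have dw: "(w has_real_derivative sl x / (4 * (w x)^3)) (at x)" for x
  proof -
    have "(w has_real_derivative (sl x / (2 * sqrt (v x))) / (2 * sqrt (sqrt (v x)))) (at x)"
      unfolding w_def using DERIV_chain2[OF DERIV_real_sqrt dsv, of x] v0[of x] by (simp add: field_simps)
    moreover have "(sl x / (2 * sqrt (v x))) / (2 * sqrt (sqrt (v x))) = sl x / (4 * (w x)^3)"
      by (simp add: w_def[symmetric] flip: w(3)) (use w(1)[of x] in \<open>simp add: power2_eq_square power3_eq_cube\<close>)
    ultimately show ?thesis by (simp only:)
  qed
  note d = adjoint_components[OF W[unfolded Amat_def], THEN has_vector_derivative_exp_scaled[where \<nu> = \<nu>]]
  define y1 where "y1 x = y x $ 1" for x
  define y2 where "y2 x = y x $ 2" for x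
  define y3 where "y3 x = y x $ 3" for x
  define f where "f x = fcoef \<gamma> vp (v x)" for x
  have Y: "y1 = (\<lambda>x. exp (- \<nu> * of_real x) * cnj (W x $ 1))" "y2 = (\<lambda>x. exp (- \<nu> * of_real x) * cnj (W x $ 2))"
    "y3 = (\<lambda>x. exp (- \<nu> * of_real x) * cnj (W x $ 3))"
    by (simp_all add: fun_eq_iff y1_def y2_def y3_def y_def scaled_dual_def)
  have d1: "(y1 has_vector_derivative (- \<nu> * y1 x - of_real (v x) * y3 x)) (at x)" for x
    unfolding Y by (rule has_vector_derivative_eq_rhs[OF d(1)]) (simp add: f_def algebra_simps)
  have d2: "(y2 has_vector_derivative (- \<nu> * y2 x - z * y1 x - of_real (v x) * y3 x)) (at x)" for x
    unfolding Y by (rule has_vector_derivative_eq_rhs[OF d(2)]) (simp add: f_def algebra_simps)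
  have d3: "(y3 has_vector_derivative ((z - of_real (f x) - \<nu>) * y3 x - z * (y1 x + y2 x))) (at x)" for x
    unfolding Y by (rule has_vector_derivative_eq_rhs[OF d(3)]) (simp add: f_def algebra_simps)
  define N' where "N' x = (2 * inner (y1 x) (- \<nu> * y1 x - of_real (v x) * y3 x) * v x - (cmod (y1 x))\<^sup>2 * sl x) / (v x * v x)
    + 2 * inner (y2 x) (- \<nu> * y2 x - z * y1 x - of_real (v x) * y3 x)
    + (sl x / (2 * sqrt (v x)) * (cmod (y3 x))\<^sup>2
       + 2 * inner (y3 x) ((z - of_real (f x) - \<nu>) * y3 x - z * (y1 x + y2 x)) * sqrt (v x))" for x
  have dN: "(N has_real_derivative N' x) (at x)" for x
    unfolding N_def N'_def y1_def[symmetric] y2_def[symmetric] y3_def[symmetric]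
    by (intro DERIV_add DERIV_divide DERIV_mult norm_sq_has_real_derivative d1 d2 d3 dsv)
      (use v0[of x] F(1) in \<open>auto simp: sl_def\<close>)
  have inner_c: "inner p (\<beta> * p) = Re \<beta> * (cmod p)\<^sup>2" for p \<beta> :: complex
    unfolding cmod_power2 by (simp add: inner_complex_def algebra_simps power2_eq_square)
  have inner_ge: "- (cmod p * cmod q) \<le> inner p q" "inner p q \<le> cmod p * cmod q" for p q :: complex
    using Cauchy_Schwarz_ineq2[of p q] by linarith+
  have key: "- ((6 + 3 * Z) * w x * N x) \<le> N' x" for x
  proof -
    define a b q where "a = cmod (y1 x)" and "b = cmod (y2 x)" and "q = cmod (y3 x)"
    have nn: "0 \<le> a" "0 \<le> b" "0 \<le> q" by (simp_all add: a_def b_def q_def)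
    have i1: "- (v x * (a * q)) \<le> inner (y1 x) (- \<nu> * y1 x - of_real (v x) * y3 x)"
    proof -
      have "inner (y1 x) (- \<nu> * y1 x) \<ge> 0" unfolding inner_c using \<nu> by (simp add: mult_nonpos_nonneg)
      moreover have "inner (y1 x) (of_real (v x) * y3 x) \<le> a * (v x * q)"
        using inner_ge(2)[of "y1 x" "of_real (v x) * y3 x"] v0[of x] by (simp add: a_def q_def norm_mult)
      ultimately show ?thesis by (simp add: inner_diff_right mult_ac)
    qed
    have i2: "- (cmod z * a * b + v x * (b * q)) \<le> inner (y2 x) (- \<nu> * y2 x - z * y1 x - of_real (v x) * y3 x)"
    proof -
      have "inner (y2 x) (- \<nu> * y2 x) \<ge> 0" unfolding inner_c using \<nu> by (simp add: mult_nonpos_nonneg)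
      moreover have "inner (y2 x) (of_real (v x) * y3 x) \<le> b * (v x * q)"
        using inner_ge(2)[of "y2 x" "of_real (v x) * y3 x"] v0[of x] by (simp add: b_def q_def norm_mult)
      moreover have "inner (y2 x) (z * y1 x) \<le> b * (cmod z * a)"
        using inner_ge(2)[of "y2 x" "z * y1 x"] by (simp add: a_def b_def norm_mult)
      ultimately show ?thesis by (simp add: inner_diff_right mult_ac)
    qed
    have i3: "(1 - 2 * v x) * q\<^sup>2 - cmod z * q * (a + b) \<le> inner (y3 x) ((z - of_real (f x) - \<nu>) * y3 x - z * (y1 x + y2 x))"
    proof -
      have "(1 - 2 * v x) * q\<^sup>2 \<le> inner (y3 x) ((z - of_real (f x) - \<nu>) * y3 x)"
        unfolding inner_c q_def using z \<nu> fcoef_upper[OF g v0[of x]]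
        by (intro mult_right_mono) (auto simp: f_def)
      moreover have "inner (y3 x) (z * (y1 x + y2 x)) \<le> q * (cmod z * (a + b))"
      proof -
        have "cmod z * cmod (y1 x + y2 x) \<le> cmod z * (a + b)"
          unfolding a_def b_def by (intro mult_left_mono norm_triangle_ineq norm_ge_zero)
        then have "q * (cmod z * cmod (y1 x + y2 x)) \<le> q * (cmod z * (a + b))"
          using nn(3) by (rule mult_left_mono)
        then show ?thesis using inner_ge(2)[of "y3 x" "z * (y1 x + y2 x)"] by (simp add: q_def norm_mult)
      qed
      ultimately show ?thesis by (simp add: inner_diff_right mult_ac)
    qed
    have sl: "sl x \<le> 0" "- v x \<le> sl x"
    proof -
      have "0 \<le> (v x - vp) * (1 - v x)" using F(2,3)[of x] by simp
      then show "sl x \<le> 0" using slope_bounds(1)[OF g F(2,3), of x] by (simp add: sl_def)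
      have "v x * (1 - v x) \<le> v x" using v0[of x] by (simp add: algebra_simps)
      then show "- v x \<le> sl x" using slope_bounds(2)[OF g F(2,3), of x] by (simp add: sl_def)
    qed
    have s1: "- (2 * a * q) \<le> (2 * inner (y1 x) (- \<nu> * y1 x - of_real (v x) * y3 x) * v x - (cmod (y1 x))\<^sup>2 * sl x) / (v x * v x)"
    proof -
      have "- (v x * (a * q)) * v x * 2 \<le> inner (y1 x) (- \<nu> * y1 x - of_real (v x) * y3 x) * v x * 2"
        using i1 v0[of x] by (intro mult_right_mono) auto
      moreover have "(cmod (y1 x))\<^sup>2 * sl x \<le> 0" using sl by (simp add: mult_nonneg_nonpos)
      ultimately have "- (2 * a * q) * (v x * v x) \<le> 2 * inner (y1 x) (- \<nu> * y1 x - of_real (v x) * y3 x) * v x - (cmod (y1 x))\<^sup>2 * sl x"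
        by (simp add: mult_ac)
      then show ?thesis using v0[of x] by (subst pos_le_divide_eq) auto
    qed
    have s3: "- ((w x)\<^sup>2 * (4 * (w x)^4) * q\<^sup>2 + 2 * (w x)\<^sup>2 * cmod z * q * (a + b))
      \<le> sl x / (2 * sqrt (v x)) * (cmod (y3 x))\<^sup>2
       + 2 * inner (y3 x) ((z - of_real (f x) - \<nu>) * y3 x - z * (y1 x + y2 x)) * sqrt (v x)"
    proof -
      have "- (v x) / (2 * sqrt (v x)) \<le> sl x / (2 * sqrt (v x))" using sl v0[of x] by (intro divide_right_mono) auto
      moreover have "- (v x) / (2 * sqrt (v x)) = - (sqrt (v x) / 2)"
        using v0[of x] by (simp add: real_div_sqrt)
      ultimately have "- (sqrt (v x) / 2) * q\<^sup>2 \<le> sl x / (2 * sqrt (v x)) * q\<^sup>2"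
        by (intro mult_right_mono) auto
      moreover have "((1 - 2 * v x) * q\<^sup>2 - cmod z * q * (a + b)) * (2 * sqrt (v x))
        \<le> inner (y3 x) ((z - of_real (f x) - \<nu>) * y3 x - z * (y1 x + y2 x)) * (2 * sqrt (v x))"
        using i3 v0[of x] by (intro mult_right_mono) auto
      moreover have "0 \<le> sqrt (v x) * q\<^sup>2" using v0[of x] by simp
      ultimately show ?thesis
        unfolding w(3,4) q_def[symmetric] by (simp add: algebra_simps)
    qed
    define E1 where "E1 = 2 * a * q"
    define E2 where "E2 = cmod z * a * b + v x * (b * q)"
    define E3 where "E3 = (w x)\<^sup>2 * (4 * (w x)^4) * q\<^sup>2 + 2 * (w x)\<^sup>2 * cmod z * q * (a + b)"
    have Nx: "N x = a\<^sup>2 / (w x)^4 + b\<^sup>2 + (w x)\<^sup>2 * q\<^sup>2"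
      unfolding N_def w(3,4) by (simp add: a_def b_def q_def y1_def y2_def y3_def)
    have "E1 + 2 * E2 + E3 = 2 * a * q + 2 * cmod z * a * b + 2 * (w x)^4 * b * q
        + (w x)\<^sup>2 * (4 * (w x)^4) * q\<^sup>2 + 2 * (w x)\<^sup>2 * cmod z * q * (a + b)"
      unfolding E1_def E2_def E3_def w(4) by (simp add: algebra_simps)
    also have "\<dots> \<le> (6 + 3 * Z) * w x * N x"
      unfolding Nx by (rule weighted_energy_estimate) (use w z nn in auto)
    finally have "E1 + 2 * E2 + E3 \<le> (6 + 3 * Z) * w x * N x" .
    moreover have "- E1 + 2 * (- E2) + (- E3) \<le> N' x"
      unfolding N'_def E1_def E2_def E3_def by (intro add_mono s1 s3 mult_left_mono[OF i2]) simp
    ultimately show ?thesis by linarith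
  qed
  (* By the differential inequality for w, the function - k w is a primitive of a rate that dominates (6 + 3 Z) w. *)
  define k where "k = 4 * (6 + 3 * Z) / c"
  have Z0: "0 \<le> Z" using z norm_ge_zero order_trans by blast
  have k0: "0 \<le> k" using Z0 c by (simp add: k_def)
  have "N 0 \<le> N X * exp (- k * w X - - k * w 0)"
  proof (rule gronwall_backward[OF X(1), where N' = N' and \<phi> = "\<lambda>x. - k * (sl x / (4 * (w x)^3))"])
    show "((\<lambda>b. - k * w b) has_real_derivative - k * (sl x / (4 * (w x)^3))) (at x)" for x
      by (intro DERIV_cmult dw)
    fix x assume x: "0 \<le> x" "x \<le> X"
    have N0: "0 \<le> N x" using v0[of x] by (simp add: N_def)
    have "c * v x \<le> - sl x"
      using X(2)[OF x] slope_bounds(1)[OF g F(2,3), of x] by (simp add: sl_def)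
    then have "k * (c * (w x)^4) / (4 * (w x)^3) \<le> k * (- sl x) / (4 * (w x)^3)"
      unfolding w(4) using k0 w(1)[of x] by (intro divide_right_mono mult_left_mono) auto
    moreover have "k * (c * (w x)^4) / (4 * (w x)^3) = (6 + 3 * Z) * w x"
      using c w(1)[of x] by (simp add: k_def power4_eq_xxxx power3_eq_cube)
    ultimately have "(6 + 3 * Z) * w x \<le> - k * (sl x / (4 * (w x)^3))" by simp
    then have "(6 + 3 * Z) * w x * N x \<le> - k * (sl x / (4 * (w x)^3)) * N x"
      using N0 by (rule mult_right_mono)
    then show "- (- k * (sl x / (4 * (w x)^3)) * N x) \<le> N' x" using key[of x] by linarith
  qed (rule dN)
  also have "\<dots> \<le> N X * exp k"
  proof (intro mult_left_mono)
    have "0 \<le> k * w X" using k0 w(1)[of X] by (simp add: less_imp_le)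
    moreover have "k * w 0 \<le> k * 1" using k0 w(2)[of 0] by (intro mult_left_mono) auto
    ultimately have "- k * w X - - k * w 0 \<le> k" by simp
    then show "exp (- k * w X - - k * w 0) \<le> exp k" by simp
    show "0 \<le> N X" using v0[of X] by (simp add: N_def)
  qed
  finally show ?thesis by (simp add: k_def)
qed

lemma scaled_dual_rescale:
  "scaled_dual 1 \<nu> W x $ 1 = s * (scaled_dual s \<nu> W x $ 1)" if "s \<noteq> 0"
  using that by (simp add: scaled_dual_def)

text \<open>Joins the two regions at the point \<open>X\<close> where \<open>v = (1 + \<kappa>) v\<^sub>+\<close>. The weight \<open>1 / v\<close> on the first
  component in the energy there is what the division by \<open>s = sqrt v\<^sub>+\<close> in the tail bound provides.\<close>

lemma adjoint_value_bound:
  fixes \<gamma> \<epsilon> :: real and K :: "complex set"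
  assumes \<gamma>: "1 \<le> \<gamma>" and K: "compact K" "K \<subseteq> RHP" and \<epsilon>: "0 < \<epsilon>"
  obtains C where "0 \<le> C"
    "\<And>vp z \<mu> L v0 v W. \<lbrakk>0 < vp; vp \<le> 1 - \<epsilon>; z \<in> K; z \<noteq> 0;
      {\<mu> \<in> eigenvalues (- cadj (Amat \<gamma> vp vp z)). Re \<mu> < 0} = {\<mu>};
      - cadj (Amat \<gamma> vp vp z) *v L = \<mu> *s L; profile \<gamma> vp v0 v; v 0 = (1 + vp) / 2;
      solves (\<lambda>x. - cadj (Amat \<gamma> vp (v x) z)) W; asymp_exp \<mu> L at_top W\<rbrakk>
      \<Longrightarrow> norm (W 0) \<le> C * norm L"
proof (rule adjoint_tail_bound[OF \<gamma> K \<epsilon>])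
  fix \<kappa> C0
  assume \<kappa>: "0 < \<kappa>" "\<kappa> \<le> \<epsilon> / 2" and C0: "0 \<le> C0"
    and tail: "\<And>vp z \<nu> L v0 v W X x. \<lbrakk>0 < vp; vp \<le> 1 - \<epsilon>; z \<in> K; z \<noteq> 0;
      {\<mu> \<in> eigenvalues (- cadj (Amat \<gamma> vp vp z)). Re \<mu> < 0} = {cnj \<nu>};
      - cadj (Amat \<gamma> vp vp z) *v L = cnj \<nu> *s L; profile \<gamma> vp v0 v;
      solves (\<lambda>x. - cadj (Amat \<gamma> vp (v x) z)) W; asymp_exp (cnj \<nu>) L at_top W;
      v X \<le> (1 + \<kappa>) * vp; X \<le> x\<rbrakk> \<Longrightarrow> norm (scaled_dual (of_real (sqrt vp)) \<nu> W x) \<le> C0 * norm L"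
  obtain Z where Z: "\<And>z. z \<in> K \<Longrightarrow> cmod z \<le> Z"
    using compact_imp_bounded[OF K(1)] by (auto simp: bounded_iff)
  (* On [0, X]: v - vp is at least the fraction kappa / (1 + kappa) of v, and 1 - v is at least epsilon / 2. *)
  define c where "c = \<kappa> / (1 + \<kappa>) * (\<epsilon> / 2)"
  have c: "0 < c" using \<kappa> \<epsilon> by (simp add: c_def)
  define Q where "Q = max 1 (exp (4 * (6 + 3 * Z) / c))"
  have Q: "1 \<le> Q" by (simp add: Q_def)
  show thesis
  proof (rule that[of "3 * sqrt (2 * (3 * C0\<^sup>2 * Q))"])
    show "0 \<le> 3 * sqrt (2 * (3 * C0\<^sup>2 * Q))" using Q by simp
    fix vp :: real and z \<mu> :: complex and L :: "complex^3" and v0 v and W :: "real \<Rightarrow> complex^3"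
    assume vp: "0 < vp" "vp \<le> 1 - \<epsilon>" and z: "z \<in> K" "z \<noteq> 0"
      and ev: "{\<mu> \<in> eigenvalues (- cadj (Amat \<gamma> vp vp z)). Re \<mu> < 0} = {\<mu>}"
      and L: "- cadj (Amat \<gamma> vp vp z) *v L = \<mu> *s L" and v: "profile \<gamma> vp v0 v" and v_0: "v 0 = (1 + vp) / 2"
      and W: "solves (\<lambda>x. - cadj (Amat \<gamma> vp (v x) z)) W" and as: "asymp_exp \<mu> L at_top W"
    have g: "1 \<le> \<gamma>" "0 < vp" "vp < 1" using \<gamma> vp \<epsilon> by auto
    note F = profile_facts[OF v]
    define \<nu> where "\<nu> = cnj \<mu>"
    have "\<mu> \<in> {\<mu> \<in> eigenvalues (- cadj (Amat \<gamma> vp vp z)). Re \<mu> < 0}" unfolding ev by simp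
    then have \<nu>: "Re \<nu> \<le> 0" by (simp add: \<nu>_def)
    define y where "y = scaled_dual 1 \<nu> W"
    define N where "N x = (cmod (y x $ 1))\<^sup>2 / v x + (cmod (y x $ 2))\<^sup>2 + sqrt (v x) * (cmod (y x $ 3))\<^sup>2" for x
    have N0: "0 \<le> N x" for x using F(2)[of x] g by (simp add: N_def)
    define M where "M = C0 * norm L"
    have NX: "N X \<le> 3 * M\<^sup>2" if "v X \<le> (1 + \<kappa>) * vp" for X
    proof -
      let ?s = "complex_of_real (sqrt vp)"
      define Y where "Y = scaled_dual ?s \<nu> W X"
      have "norm Y \<le> M"
        unfolding M_def Y_def by (rule tail[where X = X]) (use vp z ev L v W as that in \<open>auto simp: \<nu>_def\<close>)
      then have Y: "(cmod (Y $ i))\<^sup>2 \<le> M\<^sup>2" for i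
        using Finite_Cartesian_Product.norm_nth_le[of Y i] by (intro power_mono) auto
      have y23: "y X $ 2 = Y $ 2" "y X $ 3 = Y $ 3" by (simp_all add: y_def Y_def scaled_dual_def)
      have "y X $ 1 = ?s * Y $ 1" unfolding y_def Y_def by (rule scaled_dual_rescale) (use g in simp)
      then have "(cmod (y X $ 1))\<^sup>2 = vp * (cmod (Y $ 1))\<^sup>2"
        using g by (simp add: norm_mult power_mult_distrib)
      moreover have "(cmod (y X $ 1))\<^sup>2 / v X \<le> (cmod (y X $ 1))\<^sup>2 / vp"
        using F(2)[of X] g by (intro divide_left_mono) auto
      ultimately have "(cmod (y X $ 1))\<^sup>2 / v X \<le> M\<^sup>2" using Y[of 1] g by simp
      moreover have "(cmod (y X $ 2))\<^sup>2 \<le> M\<^sup>2" using Y[of 2] by (simp add: y23)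
      moreover have "sqrt (v X) * (cmod (y X $ 3))\<^sup>2 \<le> 1 * M\<^sup>2"
        using Y[of 3] F(3)[of X] F(2)[of X] g
        by (intro mult_mono) (auto simp: y23)
      ultimately show ?thesis by (simp add: N_def)
    qed
    have "N 0 \<le> 3 * M\<^sup>2 * Q"
    proof (cases "v 0 \<le> (1 + \<kappa>) * vp")
      case True
      from NX[OF this] have "N 0 \<le> 3 * M\<^sup>2 * 1" by simp
      also have "\<dots> \<le> 3 * M\<^sup>2 * Q" using Q by (intro mult_left_mono) auto
      finally show ?thesis .
    next
      case False
      have "(v \<longlongrightarrow> vp) at_top" using v by (simp add: profile_def)
      then have "\<forall>\<^sub>F x in at_top. v x < (1 + \<kappa>) * vp" by (rule order_tendstoD) (use \<kappa> g in simp)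
      then obtain b where b: "\<And>x. b \<le> x \<Longrightarrow> v x < (1 + \<kappa>) * vp" by (auto simp: eventually_at_top_linorder)
      have "\<exists>X\<ge>0. X \<le> max 0 b \<and> v X = (1 + \<kappa>) * vp"
        using IVT2[of v "max 0 b" "(1 + \<kappa>) * vp" 0] b[of "max 0 b"] False
          DERIV_isCont[OF F(1)] by auto
      then obtain X where X: "0 \<le> X" "v X = (1 + \<kappa>) * vp" by blast
      have "N 0 \<le> N X * exp (4 * (6 + 3 * Z) / c)"
        unfolding N_def y_def
      proof (rule adjoint_transition_bound[OF g v W _ _ \<nu> c X(1)])
        show "0 \<le> Re z" using z K by (auto simp: RHP_def)
        show "cmod z \<le> Z" using Z z by simp
        fix x assume x: "0 \<le> x" "x \<le> X"
        have vx: "(1 + \<kappa>) * vp \<le> v x" using F(4)[OF x(2)] X by simp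
        have "\<kappa> / (1 + \<kappa>) * v x \<le> v x - vp" using vx \<kappa> by (simp add: field_simps)
        moreover have "\<epsilon> / 2 \<le> 1 - v x" using F(4)[OF x(1)] v_0 vp by (simp add: field_simps)
        moreover have "0 \<le> v x - vp" using F(2)[of x] by simp
        ultimately have "(\<kappa> / (1 + \<kappa>) * v x) * (\<epsilon> / 2) \<le> (v x - vp) * (1 - v x)"
          using \<epsilon> by (intro mult_mono) auto
        then show "c * v x \<le> (v x - vp) * (1 - v x)" by (simp add: c_def mult_ac)
      qed
      also have "\<dots> \<le> 3 * M\<^sup>2 * Q"
        using NX[of X] X N0 by (intro mult_mono) (auto simp: Q_def)
      finally show ?thesis .
    qed
    moreover have "cmod (W 0 $ i) \<le> sqrt (2 * N 0)" for i
    proof -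
      have y0: "cmod (y 0 $ i) = cmod (W 0 $ i)" for i
        using exhaust_3[of i] by (auto simp: y_def scaled_dual_def)
      have v01: "1 / 2 \<le> v 0" "v 0 \<le> 1" using v_0 g by auto
      have "v 0 * v 0 \<le> v 0 * 1" using v01 by (intro mult_left_mono) auto
      then have sv: "1 / 2 \<le> sqrt (v 0)" using v01 by (intro order_trans[OF v01(1)] real_le_rsqrt) (auto simp: power2_eq_square)
      have "(cmod (W 0 $ 1))\<^sup>2 * 1 \<le> (cmod (W 0 $ 1))\<^sup>2 * (1 / v 0)"
        using v01 by (intro mult_left_mono) auto
      then have 1: "(cmod (W 0 $ 1))\<^sup>2 \<le> (cmod (W 0 $ 1))\<^sup>2 / v 0" by simp
      have 3: "1 / 2 * (cmod (W 0 $ 3))\<^sup>2 \<le> sqrt (v 0) * (cmod (W 0 $ 3))\<^sup>2"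
        using sv by (intro mult_right_mono) auto
      have N_0: "N 0 = (cmod (W 0 $ 1))\<^sup>2 / v 0 + (cmod (W 0 $ 2))\<^sup>2 + sqrt (v 0) * (cmod (W 0 $ 3))\<^sup>2"
        unfolding N_def y0 ..
      have "(cmod (W 0 $ i))\<^sup>2 \<le> 2 * N 0"
      proof -
        define t1 t3 where "t1 = (cmod (W 0 $ 1))\<^sup>2 / v 0" and "t3 = sqrt (v 0) * (cmod (W 0 $ 3))\<^sup>2"
        have nn: "0 \<le> t1" "0 \<le> (cmod (W 0 $ 2))\<^sup>2" "0 \<le> t3"
          using v01 by (simp_all add: t1_def t3_def)
        have arith: "a \<le> 2 * (t1 + t2 + t3)" "t2 \<le> 2 * (t1 + t2 + t3)" "b \<le> 2 * (t1 + t2 + t3)"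
          if "a \<le> t1" "1 / 2 * b \<le> t3" "0 \<le> t1" "0 \<le> t2" "0 \<le> t3" for a b t1 t2 t3 :: real
          using that by auto
        have "(cmod (W 0 $ 1))\<^sup>2 \<le> 2 * N 0" "(cmod (W 0 $ 2))\<^sup>2 \<le> 2 * N 0" "(cmod (W 0 $ 3))\<^sup>2 \<le> 2 * N 0"
          unfolding N_0 t1_def[symmetric] t3_def[symmetric]
          by (rule arith[OF 1[folded t1_def] 3[folded t3_def] nn])+
        then show ?thesis using exhaust_3[of i] by (elim disjE) simp_all
      qed
      then show ?thesis by (rule real_le_rsqrt)
    qed
    ultimately have "cmod (W 0 $ i) \<le> sqrt (2 * (3 * C0\<^sup>2 * Q)) * norm L" for i
    proof -
      assume "N 0 \<le> 3 * M\<^sup>2 * Q" and *: "\<And>i. cmod (W 0 $ i) \<le> sqrt (2 * N 0)"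
      then have "sqrt (2 * N 0) \<le> sqrt (2 * (3 * C0\<^sup>2 * Q) * (norm L)\<^sup>2)"
        by (intro real_sqrt_le_mono) (simp add: M_def power_mult_distrib mult_ac)
      also have "\<dots> = sqrt (2 * (3 * C0\<^sup>2 * Q)) * norm L" by (simp only: real_sqrt_mult real_sqrt_abs abs_norm_cancel)
      finally show ?thesis using *[of i] by linarith
    qed
    then show "norm (W 0) \<le> 3 * sqrt (2 * (3 * C0\<^sup>2 * Q)) * norm L"
      using norm_vec3_le[of "W 0" "sqrt (2 * (3 * C0\<^sup>2 * Q)) * norm L"] by (simp only: mult.assoc)
  qed
qed

lemma zero_limit_point_RHP: "at 0 within RHP \<noteq> bot"
  unfolding trivial_limit_within islimpt_approachable
proof (intro notI, elim notE, intro allI impI)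
  fix e :: real assume "0 < e"
  then show "\<exists>x'\<in>RHP. x' \<noteq> 0 \<and> dist x' 0 < e"
    by (intro bexI[of _ "of_real (e / 2)"]) (auto simp: RHP_def)
qed

lemma closed_RHP: "closed RHP"
  unfolding RHP_def by (rule closed_halfspace_Re_ge)

text \<open>Near \<open>v\<^sub>+ = 0\<close> by the normalization, elsewhere by compactness.\<close>

lemma adjoint_eigendata_bounded:
  assumes \<gamma>: "1 \<le> \<gamma>" and V: "adjoint_eigendata \<gamma> \<mu> V" and K: "compact K" "K \<subseteq> RHP" and \<epsilon>: "0 < \<epsilon>"
  obtains C where "\<And>vp z. 0 < vp \<Longrightarrow> vp \<le> 1 - \<epsilon> \<Longrightarrow> z \<in> K \<Longrightarrow> norm (V vp z) \<le> C"
proof -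
  define V0 :: "complex \<Rightarrow> complex^3" where "V0 z = vector [0, - 1, - cnj z / (of_real \<gamma> + cnj z)]" for z
  have "uniform_limit K V V0 (at_right 0)"
    using V K by (auto simp: adjoint_eigendata_def V0_def[abs_def])
  then have "\<forall>\<^sub>F vp in at_right 0. \<forall>z\<in>K. dist (V vp z) (V0 z) < 1"
    by (simp add: uniform_limit_iff)
  then obtain \<delta> where \<delta>: "0 < \<delta>" "\<And>vp z. 0 < vp \<Longrightarrow> vp < \<delta> \<Longrightarrow> z \<in> K \<Longrightarrow> dist (V vp z) (V0 z) < 1"
    by (auto simp: eventually_at_right_field)
  have V0: "norm (V0 z) \<le> 3" if "z \<in> K" for z
  proof -
    have z: "0 \<le> Re z" using that K by (auto simp: RHP_def)
    have "\<bar>Re z\<bar> \<le> \<bar>\<gamma> + Re z\<bar>" using z \<gamma> by simp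
    then have "cmod z \<le> cmod (of_real \<gamma> + cnj z)"
      unfolding cmod_def by (intro real_sqrt_le_mono) (simp add: abs_le_square_iff)
    moreover have "Re (of_real \<gamma> + cnj z) \<noteq> 0" using z \<gamma> by simp
    then have "of_real \<gamma> + cnj z \<noteq> 0" by (metis zero_complex.sel(1))
    ultimately have "cmod (- cnj z / (of_real \<gamma> + cnj z)) \<le> 1" by (simp add: norm_divide)
    then have "norm (V0 z) \<le> 3 * 1" unfolding V0_def by (intro norm_vec3_le) auto
    then show ?thesis by simp
  qed
  have "continuous_on ({0<..<1} \<times> RHP) (\<lambda>(vp, z). V vp z)" using V by (simp add: adjoint_eigendata_def)
  then have "continuous_on ({\<delta>..1 - \<epsilon>} \<times> K) (\<lambda>(vp, z). V vp z)"
    by (rule continuous_on_subset) (use \<delta> \<epsilon> K in auto)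
  then have "compact ((\<lambda>(vp, z). V vp z) ` ({\<delta>..1 - \<epsilon>} \<times> K))"
    by (intro compact_continuous_image compact_Times K) auto
  then obtain C where "\<forall>x\<in>(\<lambda>(vp, z). V vp z) ` ({\<delta>..1 - \<epsilon>} \<times> K). norm x \<le> C"
    using compact_imp_bounded bounded_iff by blast
  then have C: "\<And>vp z. \<delta> \<le> vp \<Longrightarrow> vp \<le> 1 - \<epsilon> \<Longrightarrow> z \<in> K \<Longrightarrow> norm (V vp z) \<le> C" by auto
  show ?thesis
  proof (rule that[of "max 4 C"])
    fix vp z assume *: "0 < vp" "vp \<le> 1 - \<epsilon>" "z \<in> K"
    show "norm (V vp z) \<le> max 4 C"
    proof (cases "vp < \<delta>")
      case True
      then show ?thesis
        using \<delta>(2)[of vp z] V0[of z] * norm_triangle_sub[of "V vp z" "V0 z"] by (simp add: dist_norm)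
    next
      case False
      then show ?thesis using C[of vp z] * by simp
    qed
  qed
qed

text \<open>The value at \<open>z = 0\<close> is a limit of values at nearby points, so the compact set is first enlarged by
  a half disc around \<open>0\<close>.\<close>

lemma adjoint_solution_value_bounded:
  assumes \<gamma>: "1 \<le> \<gamma>" and V: "adjoint_eigendata \<gamma> \<mu> V" and K: "compact K" "K \<subseteq> RHP" and \<epsilon>: "0 < \<epsilon>"
  obtains C where "\<And>vp z v0 v W. \<lbrakk>0 < vp; vp \<le> 1 - \<epsilon>; z \<in> K; profile \<gamma> vp v0 v; v 0 = (1 + vp) / 2;
     adjoint_solution \<gamma> vp v (\<mu> vp) (V vp) W\<rbrakk> \<Longrightarrow> norm (W z 0) \<le> C"
proof -
  define K' where "K' = K \<union> (cball 0 1 \<inter> RHP)"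
  have K': "compact K'" "K' \<subseteq> RHP"
    using K closed_RHP by (auto simp: K'_def intro!: compact_Un compact_Int_closed)
  show thesis
  proof (rule adjoint_value_bound[OF \<gamma> K' \<epsilon>], rule adjoint_eigendata_bounded[OF \<gamma> V K' \<epsilon>])
    fix C1 C2
    assume C1: "0 \<le> C1" "\<And>vp z \<mu> L v0 v W. \<lbrakk>0 < vp; vp \<le> 1 - \<epsilon>; z \<in> K'; z \<noteq> 0;
      {\<mu> \<in> eigenvalues (- cadj (Amat \<gamma> vp vp z)). Re \<mu> < 0} = {\<mu>};
      - cadj (Amat \<gamma> vp vp z) *v L = \<mu> *s L; profile \<gamma> vp v0 v; v 0 = (1 + vp) / 2;
      solves (\<lambda>x. - cadj (Amat \<gamma> vp (v x) z)) W; asymp_exp \<mu> L at_top W\<rbrakk>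
      \<Longrightarrow> norm (W 0) \<le> C1 * norm L"
      and C2: "\<And>vp z. 0 < vp \<Longrightarrow> vp \<le> 1 - \<epsilon> \<Longrightarrow> z \<in> K' \<Longrightarrow> norm (V vp z) \<le> C2"
    show thesis
    proof (rule that[of "C1 * C2"])
      fix vp z v0 v W
      assume vp: "0 < vp" "vp \<le> 1 - \<epsilon>" and z: "z \<in> K" and v: "profile \<gamma> vp v0 v" "v 0 = (1 + vp) / 2"
        and W: "adjoint_solution \<gamma> vp v (\<mu> vp) (V vp) W"
      have nz: "norm (W y 0) \<le> C1 * C2" if y: "y \<in> K'" "y \<noteq> 0" for y
      proof -
        have yR: "y \<in> RHP - {0}" "y \<in> RHP" using y K' by auto
        have vp1: "vp \<in> {0<..<1}" using vp \<epsilon> by auto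
        have ev: "eigenpair (- cadj (Amat \<gamma> vp vp y)) (\<mu> vp y) (V vp y)"
          "{\<nu> \<in> eigenvalues (- cadj (Amat \<gamma> vp vp y)). Re \<nu> < 0} = {\<mu> vp y}"
          using V vp1 yR unfolding adjoint_eigendata_def by blast+
        have "norm (W y 0) \<le> C1 * norm (V vp y)"
          by (rule C1(2)[OF vp y ev(2) _ v]) (use ev(1) W yR in \<open>auto simp: adjoint_solution_def eigenpair_def\<close>)
        also have "\<dots> \<le> C1 * C2" using C2[OF vp y(1)] C1(1) by (rule mult_left_mono)
        finally show ?thesis .
      qed
      show "norm (W z 0) \<le> C1 * C2"
      proof (cases "z = 0")
        case False
        then show ?thesis using nz[of z] z by (simp add: K'_def)
      next
        case True
        have "continuous (at 0 within RHP) (\<lambda>z. W z 0)" using W by (simp add: adjoint_solution_def)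
        then have "((\<lambda>z. norm (W z 0)) \<longlongrightarrow> norm (W 0 0)) (at 0 within RHP)"
          by (intro tendsto_norm) (simp add: continuous_within)
        moreover have "\<forall>\<^sub>F y in at 0 within RHP. norm (W y 0) \<le> C1 * C2"
          unfolding eventually_at
        proof (intro exI[of _ 1] conjI ballI impI)
          fix y assume "y \<in> RHP" "y \<noteq> 0 \<and> dist y 0 < 1"
          then show "norm (W y 0) \<le> C1 * C2" by (intro nz) (auto simp: K'_def)
        qed simp
        ultimately show ?thesis unfolding True by (rule tendsto_upperbound[OF _ _ zero_limit_point_RHP])
      qed
    qed
  qed
qed

section \<open>Behaviour near minus infinity\<close>

text \<open>The cubic is the characteristic polynomial of the coefficient matrix at \<open>v = 1\<close>.\<close>

definition sole_growing_root :: "real \<Rightarrow> complex \<Rightarrow> complex \<Rightarrow> bool" where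
  "sole_growing_root f z \<mu> \<longleftrightarrow> (\<forall>\<xi>. 0 < Re \<xi> \<longrightarrow>
     (\<xi>^3 + (z - of_real f) * \<xi>\<^sup>2 - 2 * z * \<xi> - z\<^sup>2 = 0 \<longleftrightarrow> \<xi> = \<mu>))"

lemma sole_growing_rootI:
  assumes "eigenpair (coef_matrix 1 f z) \<mu> V" "{\<nu> \<in> eigenvalues (coef_matrix 1 f z). 0 < Re \<nu>} = {\<mu>}"
  shows "sole_growing_root f z \<mu>" "0 < Re \<mu>"
proof -
  have "\<mu> \<in> {\<nu> \<in> eigenvalues (coef_matrix 1 f z). 0 < Re \<nu>}" unfolding assms(2) by simp
  then show re: "0 < Re \<mu>" by simp
  then have "\<mu> \<noteq> 0" by auto
  show "sole_growing_root f z \<mu>"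
    unfolding sole_growing_root_def
  proof (intro allI impI iffI)
    fix \<xi> assume \<xi>: "0 < Re \<xi>" "\<xi>^3 + (z - of_real f) * \<xi>\<^sup>2 - 2 * z * \<xi> - z\<^sup>2 = 0"
    have "\<xi> \<in> eigenvalues (coef_matrix 1 f z)"
      by (rule coef_matrix_eigenvalue) (use \<xi> in auto)
    then have "\<xi> \<in> {\<nu> \<in> eigenvalues (coef_matrix 1 f z). 0 < Re \<nu>}" using \<xi> by simp
    then show "\<xi> = \<mu>" unfolding assms(2) by simp
  next
    fix \<xi> assume "\<xi> = \<mu>"
    then show "\<xi>^3 + (z - of_real f) * \<xi>\<^sup>2 - 2 * z * \<xi> - z\<^sup>2 = 0"
      using coef_matrix_eigenpair(5)[OF assms(1) \<open>\<mu> \<noteq> 0\<close>] by simp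
  qed
qed

text \<open>A companion with positive real part would coincide with \<open>\<mu>\<close> and make it a double root.\<close>

lemma growing_root_companions:
  assumes sole: "sole_growing_root f z \<mu>" and \<mu>: "0 < Re \<mu>" and f: "f \<le> 1" and z: "0 \<le> Re z"
  obtains \<mu>2 \<mu>3 where "of_real f - z = \<mu> + \<mu>2 + \<mu>3" "\<mu> * \<mu>2 + \<mu> * \<mu>3 + \<mu>2 * \<mu>3 = - 2 * z" "\<mu> * \<mu>2 * \<mu>3 = z\<^sup>2"
    "Re \<mu>2 \<le> 0" "Re \<mu>3 \<le> 0"
proof -
  have root: "\<mu>^3 + (z - of_real f) * \<mu>\<^sup>2 - 2 * z * \<mu> - z\<^sup>2 = 0"
    using sole \<mu> by (simp add: sole_growing_root_def)
  then have "\<mu>^3 - (of_real f - z) * \<mu>\<^sup>2 + (- 2 * z) * \<mu> - z\<^sup>2 = 0" by algebra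
  then obtain \<mu>2 \<mu>3 where m: "of_real f - z = \<mu> + \<mu>2 + \<mu>3" "\<mu> * \<mu>2 + \<mu> * \<mu>3 + \<mu>2 * \<mu>3 = - 2 * z" "\<mu> * \<mu>2 * \<mu>3 = z\<^sup>2"
    by (rule cubic_companion_roots)
  have neg: "Re n \<le> 0" if m: "of_real f - z = \<mu> + n + k" "\<mu> * n + \<mu> * k + n * k = - 2 * z" "\<mu> * n * k = z\<^sup>2" for n k
  proof (rule ccontr)
    assume n0: "\<not> Re n \<le> 0"
    have "n^3 + (z - of_real f) * n\<^sup>2 - 2 * z * n - z\<^sup>2 = 0" using m by algebra
    then have n: "n = \<mu>" using n0 sole by (simp add: sole_growing_root_def)
    show False
    proof (rule no_double_root[where v = 1 and f = f and z = z and \<mu> = \<mu>])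
      show "\<mu>^3 + (z - of_real f) * \<mu>\<^sup>2 - 2 * of_real 1 * z * \<mu> - of_real 1 * z\<^sup>2 = 0" using root by simp
      show "3 * \<mu>\<^sup>2 + 2 * (z - of_real f) * \<mu> - 2 * of_real 1 * z = 0" using m unfolding n of_real_1 by algebra
    qed (use f z \<mu> in auto)
  qed
  have m': "of_real f - z = \<mu> + \<mu>3 + \<mu>2" "\<mu> * \<mu>3 + \<mu> * \<mu>2 + \<mu>3 * \<mu>2 = - 2 * z" "\<mu> * \<mu>3 * \<mu>2 = z\<^sup>2"
    using m by (simp_all add: algebra_simps)
  show ?thesis using that[OF m neg[OF m] neg[OF m']] .
qed

text \<open>Times \<open>\<mu>\<^sup>2\<close>, and modulo the cubic, this expression is \<open>\<mu>\<close> times the derivative of the characteristic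
  polynomial at \<open>\<mu>\<close>.\<close>

lemma growing_root_simple:
  assumes sole: "sole_growing_root f z \<mu>" and \<mu>: "0 < Re \<mu>" and f: "f \<le> 1" and z: "0 \<le> Re z"
  shows "2 * (z / \<mu>) * (1 + z / \<mu>) + \<mu> \<noteq> 0"
proof
  assume 0: "2 * (z / \<mu>) * (1 + z / \<mu>) + \<mu> = 0"
  have \<mu>0: "\<mu> \<noteq> 0" using \<mu> by auto
  have root: "\<mu>^3 + (z - of_real f) * \<mu>\<^sup>2 - 2 * z * \<mu> - z\<^sup>2 = 0"
    using sole \<mu> by (simp add: sole_growing_root_def)
  have "(2 * (z / \<mu>) * (1 + z / \<mu>) + \<mu>) * \<mu>\<^sup>2 = 2 * z * \<mu> + 2 * z\<^sup>2 + \<mu>^3"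
    using \<mu>0 by (simp add: field_simps power2_eq_square power3_eq_cube)
  then have e: "2 * z * \<mu> + 2 * z\<^sup>2 + \<mu>^3 = 0" unfolding 0 by simp
  have "\<mu> * (3 * \<mu>\<^sup>2 + 2 * (z - of_real f) * \<mu> - 2 * z) = 0" using root e by algebra
  then have p': "3 * \<mu>\<^sup>2 + 2 * (z - of_real f) * \<mu> - 2 * of_real 1 * z = 0" using \<mu>0 by simp
  show False
  proof (rule no_double_root[where v = 1 and f = f and z = z and \<mu> = \<mu>])
    show "\<mu>^3 + (z - of_real f) * \<mu>\<^sup>2 - 2 * of_real 1 * z * \<mu> - of_real 1 * z\<^sup>2 = 0" using root by simp
  qed (use p' f z \<mu> \<mu>0 in auto)
qed

text \<open>When \<open>\<beta>2\<close> is bounded away from zero, the last clause of a splitting follows from plain norm bounds.\<close>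

lemma splittingI:
  fixes B :: "complex^'n^'n"
  assumes CH: "\<And>p. B *v (B *v (B *v p)) = (\<beta>2 + \<beta>3) *s (B *v (B *v p)) - (\<beta>2 * \<beta>3) *s (B *v p)"
    and R: "1 \<le> R" "\<And>p. norm (B *v p - \<beta>2 *s p) \<le> R * norm p" "\<And>p. norm (B *v p - \<beta>3 *s p) \<le> R * norm p"
    and m: "0 < m" "m \<le> 1" "m \<le> cmod \<beta>2"
  shows "splitting B \<beta>2 \<beta>3 (R * R / m)"
  unfolding splitting_def
proof (intro conjI allI CH)
  fix p :: "complex^'n"
  have "m * R \<le> R * R" using R m by (intro mult_right_mono) auto
  then have "R \<le> R * R / m" using m by (simp add: pos_le_divide_eq mult.commute)
  then have "R * norm p \<le> R * R / m * norm p" by (rule mult_right_mono) simp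
  then show "norm (B *v p - \<beta>3 *s p) \<le> R * R / m * norm p" using R(3)[of p] by linarith
  have "B *v (B *v p) - (\<beta>2 + \<beta>3) *s (B *v p) + (\<beta>2 * \<beta>3) *s p
      = B *v (B *v p - \<beta>3 *s p) - \<beta>2 *s (B *v p - \<beta>3 *s p)"
    by (simp add: matrix_vector_mult_diff_distrib vector_scalar_commute vec_eq_iff algebra_simps)
  moreover have "norm (B *v (B *v p - \<beta>3 *s p) - \<beta>2 *s (B *v p - \<beta>3 *s p)) \<le> R * (R * norm p)"
    using R(1) by (intro order_trans[OF R(2)] mult_left_mono R(3)) auto
  ultimately have "norm (B *v (B *v p) - (\<beta>2 + \<beta>3) *s (B *v p) + (\<beta>2 * \<beta>3) *s p) \<le> R * (R * norm p)"
    by (simp only:)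
  also have "\<dots> = R * R / m * m * norm p" using m by simp
  also have "\<dots> \<le> R * R / m * cmod \<beta>2 * norm p"
    using m R by (intro mult_right_mono mult_left_mono) auto
  finally show "norm (B *v (B *v p) - (\<beta>2 + \<beta>3) *s (B *v p) + (\<beta>2 * \<beta>3) *s p) \<le> R * R / m * cmod \<beta>2 * norm p" .
qed

lemma companion_bounds:
  fixes \<mu> \<mu>2 \<mu>3 z :: complex
  assumes "cmod z \<le> Z" "cmod \<mu> \<le> Z" "\<bar>f\<bar> \<le> Z" "1 \<le> Z"
    and m: "of_real f - z = \<mu> + \<mu>2 + \<mu>3" "\<mu> * \<mu>2 + \<mu> * \<mu>3 + \<mu>2 * \<mu>3 = - 2 * z"
  shows "cmod \<mu>2 \<le> 10 * Z * Z" "cmod \<mu>3 \<le> 10 * Z * Z"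
proof -
  have ZZ: "Z \<le> Z * Z" using assms mult_left_mono[of 1 Z Z] by simp
  have s: "\<mu>2 + \<mu>3 = of_real f - z - \<mu>" using m(1) by algebra
  have s3: "cmod (\<mu>2 + \<mu>3) \<le> 3 * Z"
    unfolding s using norm_triangle_ineq4[of "of_real f - z" \<mu>] norm_triangle_ineq4[of "of_real f" z] assms by simp
  have p: "\<mu>2 * \<mu>3 = - 2 * z - \<mu> * (\<mu>2 + \<mu>3)" using m(2) by algebra
  have "cmod (\<mu>2 * \<mu>3) \<le> 2 * Z + Z * (3 * Z)"
    unfolding p using norm_triangle_ineq4[of "- 2 * z" "\<mu> * (\<mu>2 + \<mu>3)"] assms
      mult_mono[OF assms(2) s3] by (simp add: norm_mult)
  then have p5: "cmod (\<mu>2 * \<mu>3) \<le> 5 * (Z * Z)" using ZZ by linarith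
  have s5: "cmod (\<mu>2 + \<mu>3) \<le> 5 * (Z * Z)" using s3 ZZ assms(4) by linarith
  have 1: "1 \<le> 5 * (Z * Z)" using ZZ assms by linarith
  show "cmod \<mu>2 \<le> 10 * Z * Z" "cmod \<mu>3 \<le> 10 * Z * Z"
    using cmod_le_by_sum_and_product[OF s5 p5 1] cmod_le_by_sum_and_product[of \<mu>3 \<mu>2, OF _ _ 1] s5 p5
    by (simp_all add: add.commute mult.commute)
qed

lemma dual_growing_splitting:
  fixes z \<mu> :: complex
  assumes sole: "sole_growing_root f z \<mu>" and m: "0 < m" "m \<le> 1" "m \<le> Re \<mu>" and f: "f \<le> 1" and z: "0 \<le> Re z"
    and Z: "cmod z \<le> Z" "cmod \<mu> \<le> Z" "\<bar>f\<bar> \<le> Z" "1 \<le> Z"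
  obtains \<beta>2 \<beta>3 where "splitting (dual_matrix 1 z (z - of_real f) (- \<mu>)) \<beta>2 \<beta>3 ((900 * Z * Z) * (900 * Z * Z) / m)"
    "m \<le> Re \<beta>2" "m \<le> Re \<beta>3"
proof -
  have \<mu>: "0 < Re \<mu>" using m by simp
  obtain \<mu>2 \<mu>3 where c: "of_real f - z = \<mu> + \<mu>2 + \<mu>3" "\<mu> * \<mu>2 + \<mu> * \<mu>3 + \<mu>2 * \<mu>3 = - 2 * z" "\<mu> * \<mu>2 * \<mu>3 = z\<^sup>2"
    and re: "Re \<mu>2 \<le> 0" "Re \<mu>3 \<le> 0"
    using growing_root_companions[OF sole \<mu> f z] .
  note cb = companion_bounds[OF Z c(1,2)]
  have ZZ1: "Z \<le> Z * Z" using Z mult_left_mono[of 1 Z Z] by simp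
  then have ZZ: "Z \<le> Z * Z" "1 \<le> Z * Z" using Z by linarith+
  define \<beta>2 \<beta>3 where "\<beta>2 = - \<mu>2 - - \<mu>" and "\<beta>3 = - \<mu>3 - - \<mu>"
  have \<beta>: "m \<le> Re \<beta>2" "m \<le> Re \<beta>3" using m re by (auto simp: \<beta>2_def \<beta>3_def)
  have "splitting (dual_matrix 1 z (z - of_real f) (- \<mu>)) \<beta>2 \<beta>3 ((900 * Z * Z) * (900 * Z * Z) / m)"
  proof (rule splittingI)
    show "dual_matrix 1 z (z - of_real f) (- \<mu>) *v (dual_matrix 1 z (z - of_real f) (- \<mu>) *v (dual_matrix 1 z (z - of_real f) (- \<mu>) *v p)) =
      (\<beta>2 + \<beta>3) *s (dual_matrix 1 z (z - of_real f) (- \<mu>) *v (dual_matrix 1 z (z - of_real f) (- \<mu>) *v p)) -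
      (\<beta>2 * \<beta>3) *s (dual_matrix 1 z (z - of_real f) (- \<mu>) *v p)" for p
      unfolding \<beta>2_def \<beta>3_def
    proof (rule dual_matrix_cubic)
      show "z - of_real f = - \<mu> + - \<mu>2 + - \<mu>3" using c(1) by algebra
      show "- \<mu> * - \<mu>2 + - \<mu> * - \<mu>3 + - \<mu>2 * - \<mu>3 = - 2 * 1\<^sup>2 * z" using c(2) by simp
      show "- \<mu> * - \<mu>2 * - \<mu>3 = - 1\<^sup>2 * z\<^sup>2" using c(3) by simp
    qed
    have hZ: "cmod (z - of_real f) \<le> 20 * Z * Z"
      using norm_triangle_ineq4[of z "of_real f"] Z ZZ unfolding norm_of_real mult.assoc by linarith
    have b: "cmod \<beta>2 \<le> 3 * (20 * Z * Z)" "cmod \<beta>3 \<le> 3 * (20 * Z * Z)"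
    proof -
      have e: "\<beta>2 = \<mu> - \<mu>2" "\<beta>3 = \<mu> - \<mu>3" by (simp_all add: \<beta>2_def \<beta>3_def)
      show "cmod \<beta>2 \<le> 3 * (20 * Z * Z)" "cmod \<beta>3 \<le> 3 * (20 * Z * Z)"
        using norm_triangle_ineq4[of \<mu> \<mu>2] norm_triangle_ineq4[of \<mu> \<mu>3] cb Z ZZ
        unfolding e mult.assoc by linarith+
    qed
    have *: "norm (dual_matrix 1 z (z - of_real f) (- \<mu>) *v p - \<beta> *s p) \<le> 900 * Z * Z * norm p"
      if "cmod \<beta> \<le> 3 * (20 * Z * Z)" for \<beta> p
      using dual_matrix_norm_bounds[of 1 z "20 * Z * Z" "z - of_real f" "- \<mu>" \<beta> p] hZ that Z ZZ by simp
    show "norm (dual_matrix 1 z (z - of_real f) (- \<mu>) *v p - \<beta>2 *s p) \<le> 900 * Z * Z * norm p"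
      "norm (dual_matrix 1 z (z - of_real f) (- \<mu>) *v p - \<beta>3 *s p) \<le> 900 * Z * Z * norm p" for p
      using *[OF b(1)] *[OF b(2)] by auto
    show "m \<le> cmod \<beta>2" using \<beta>(1) complex_Re_le_cmod[of \<beta>2] by linarith
  qed (use m ZZ in auto)
  then show ?thesis using that \<beta> by blast
qed

text \<open>After the reflection \<open>x \<mapsto> - x\<close> the system converges exponentially to one whose matrix has the
  eigenvalue \<open>0\<close> and two others with real part at least \<open>m\<close>, so \<open>forward_converge\<close> applies. The limit is
  a kernel vector, that is, a multiple of the left eigenvector \<open>(1, 1 + z / \<mu>, \<mu>)\<close>.\<close>

lemma dual_solution_limit_at_bot:
  fixes \<gamma> \<epsilon> m M :: real and K :: "complex set"
  assumes \<gamma>: "1 \<le> \<gamma>" and K: "compact K" "K \<subseteq> RHP" and \<epsilon>: "0 < \<epsilon>" and m: "0 < m" "m \<le> 1"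
  obtains C \<kappa> where "0 \<le> C" "0 < \<kappa>"
    "\<And>vp z \<mu> v0 v W. \<lbrakk>0 < vp; vp \<le> 1 - \<epsilon>; z \<in> K; sole_growing_root (fcoef \<gamma> vp 1) z \<mu>; m \<le> Re \<mu>; cmod \<mu> \<le> M;
       profile \<gamma> vp v0 v; v 0 = (1 + vp) / 2; solves (\<lambda>x. - cadj (Amat \<gamma> vp (v x) z)) W\<rbrakk> \<Longrightarrow>
       \<exists>L. L $ 2 = (1 + z / \<mu>) * L $ 1 \<and> L $ 3 = \<mu> * L $ 1 \<and>
         (\<forall>x\<le>0. norm (scaled_dual 1 (- \<mu>) W x - L) \<le> C * exp (\<kappa> * x) * norm (W 0))"
proof -
  obtain Z0 where Z0: "\<And>z. z \<in> K \<Longrightarrow> cmod z \<le> Z0"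
    using compact_imp_bounded[OF K(1)] by (auto simp: bounded_iff)
  define Z where "Z = 1 + \<bar>M\<bar> + \<bar>Z0\<bar> + \<gamma>"
  define R where "R = (900 * Z * Z) * (900 * Z * Z) / m"
  define k where "k = 3 * (2 + \<gamma>\<^sup>2 * 2 powr \<gamma>)"
  have R0: "0 \<le> R" unfolding R_def using m by (intro divide_nonneg_pos zero_le_square)
  have k0: "0 \<le> k" by (simp add: k_def)
  show thesis
  proof (rule forward_converge[OF m(1) half_gt_zero[OF \<epsilon>] k0 R0])
    fix C \<kappa> :: real
    assume \<kappa>: "0 < \<kappa>" and C: "0 \<le> C" and conv: "\<And>(B :: complex^3^3) \<beta>2 \<beta>3 q e.
      \<lbrakk>splitting B \<beta>2 \<beta>3 R; m \<le> Re \<beta>2; m \<le> Re \<beta>3;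
       \<And>x. 0 \<le> x \<Longrightarrow> (q has_vector_derivative (- (B *v q x) - e x)) (at x);
       \<And>x. 0 \<le> x \<Longrightarrow> norm (e x) \<le> k * exp (- (\<epsilon> / 2) * x) * norm (q x)\<rbrakk> \<Longrightarrow>
      \<exists>L. B *v L = 0 \<and> (\<forall>x\<ge>0. norm (q x - L) \<le> C * exp (- \<kappa> * x) * norm (q 0))"
    show thesis
    proof (rule that[OF C \<kappa>])
      fix vp :: real and z \<mu> :: complex and v0 v and W :: "real \<Rightarrow> complex^3"
      assume vp: "0 < vp" "vp \<le> 1 - \<epsilon>" and z: "z \<in> K" and sole: "sole_growing_root (fcoef \<gamma> vp 1) z \<mu>"
        and \<mu>: "m \<le> Re \<mu>" "cmod \<mu> \<le> M" and v: "profile \<gamma> vp v0 v" and v_0: "v 0 = (1 + vp) / 2"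
        and W: "solves (\<lambda>x. - cadj (Amat \<gamma> vp (v x) z)) W"
      have g: "1 \<le> \<gamma>" "0 < vp" "vp < 1" using \<gamma> vp \<epsilon> by auto
      note F = profile_facts[OF v]
      define f where "f = fcoef \<gamma> vp 1"
      have "\<gamma> * acoef \<gamma> vp \<le> \<gamma> * 1" "0 \<le> \<gamma> * acoef \<gamma> vp"
        using acoef_bounds[OF g] g by (auto intro!: mult_left_mono)
      then have f: "f \<le> 1" "\<bar>f\<bar> \<le> \<gamma>" unfolding f_def fcoef_one using g by linarith+
      have zR: "0 \<le> Re z" using z K by (auto simp: RHP_def)
      obtain \<beta>2 \<beta>3 where \<beta>: "splitting (dual_matrix 1 z (z - of_real f) (- \<mu>)) \<beta>2 \<beta>3 R" "m \<le> Re \<beta>2" "m \<le> Re \<beta>3"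
        unfolding R_def
        by (rule dual_growing_splitting[OF sole[folded f_def] m \<mu>(1) f(1) zR, of Z])
          (use Z0[OF z] \<mu> f g in \<open>auto simp: Z_def\<close>)
      define y where "y = scaled_dual 1 (- \<mu>) W"
      define B where "B = dual_matrix 1 z (z - of_real f) (- \<mu>)"
      define e where "e x = (vector [- ((of_real (v x) - 1\<^sup>2) / 1) * y x $ 3, - (of_real (v x) - 1\<^sup>2) * y x $ 3,
        of_real (f - fcoef \<gamma> vp (v x)) * y x $ 3] :: complex^3)" for x
      have dy: "(y has_vector_derivative (B *v y t + e t)) (at t)" for t
        unfolding y_def B_def e_def by (rule scaled_dual_equation) (use W in \<open>auto simp: Amat_def\<close>)
      define q where "q x = y (- x)" for x
      have dq: "(q has_vector_derivative (- (B *v q x) - e (- x))) (at x)" for x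
      proof -
        have "((y \<circ> uminus) has_vector_derivative (- 1) *\<^sub>R (B *v y (- x) + e (- x))) (at x)"
          by (rule vector_diff_chain_at[OF _ dy]) (auto intro!: derivative_eq_intros)
        then show ?thesis by (simp add: q_def[abs_def] o_def)
      qed
      have ne: "norm (e (- x)) \<le> k * exp (- (\<epsilon> / 2) * x) * norm (q x)" if x: "0 \<le> x" for x
      proof -
        have "\<epsilon> / 2 \<le> v 0 - vp" using v_0 vp by (simp add: field_simps)
        from profile_decay_left[OF g v this, of "- x"] x
        have "1 - v (- x) \<le> (1 - v 0) * exp (- (\<epsilon> / 2) * x)" by simp
        also have "\<dots> \<le> 1 * exp (- (\<epsilon> / 2) * x)" using F(2)[of 0] g by (intro mult_right_mono) auto
        finally have d: "1 - v (- x) \<le> exp (- (\<epsilon> / 2) * x)" by simp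
        have vh: "1 / 2 \<le> v (- x)" using F(4)[of "- x" 0] x v_0 g by simp
        have v1: "0 \<le> 1 - v (- x)" using F(3)[of "- x"] by simp
        define E where "E = (2 + \<gamma>\<^sup>2 * 2 powr \<gamma>) * (1 - v (- x))"
        have "1 * (1 - v (- x)) \<le> E" unfolding E_def using v1 by (intro mult_right_mono) (auto simp: add_increasing2)
        moreover have "cmod (of_real (v (- x)) - 1) = 1 - v (- x)"
        proof -
          have "of_real (v (- x)) - 1 = complex_of_real (v (- x) - 1)" by simp
          then show ?thesis unfolding norm_of_real using v1 by (simp only: norm_of_real)
        qed
        ultimately have a: "cmod (- ((of_real (v (- x)) - 1\<^sup>2) / 1)) \<le> E" "cmod (- (of_real (v (- x)) - 1\<^sup>2)) \<le> E"
          by (simp_all add: norm_minus_commute)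
        have b: "cmod (of_real (f - fcoef \<gamma> vp (v (- x)))) \<le> E"
          unfolding norm_of_real f_def E_def by (rule fcoef_near_one[OF g vh F(3)])
        have y3: "cmod (y (- x) $ 3) \<le> norm (q x)" unfolding q_def by (rule Finite_Cartesian_Product.norm_nth_le)
        have E0: "0 \<le> E" using v1 by (simp add: E_def)
        have "norm (e (- x)) \<le> 3 * (E * norm (q x))"
          unfolding e_def
          by (rule norm_vec3_le; simp only: vector_3 norm_mult; intro mult_mono a b y3 norm_ge_zero E0)
        also have "\<dots> \<le> 3 * (((2 + \<gamma>\<^sup>2 * 2 powr \<gamma>) * exp (- (\<epsilon> / 2) * x)) * norm (q x))"
          unfolding E_def using d by (intro mult_left_mono mult_right_mono) auto
        finally show ?thesis unfolding k_def by (simp only: mult_ac)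
      qed
      obtain L where BL: "B *v L = 0" and L: "\<And>x. 0 \<le> x \<Longrightarrow> norm (q x - L) \<le> C * exp (- \<kappa> * x) * norm (q 0)"
        using conv[OF \<beta>[folded B_def] dq ne] by blast
      have \<mu>0: "\<mu> \<noteq> 0" using \<mu> m by auto
      have "\<mu> * L $ 1 - L $ 3 = 0" "- z * L $ 1 + \<mu> * L $ 2 - L $ 3 = 0"
        using BL unfolding vec_eq_iff forall_3 B_def dual_matrix_mult by auto
      then have L3: "L $ 3 = \<mu> * L $ 1" and "\<mu> * L $ 2 = (\<mu> + z) * L $ 1" by algebra+
      then have L2: "L $ 2 = (1 + z / \<mu>) * L $ 1" using \<mu>0 by (simp add: field_simps)
      have q0: "norm (q 0) = norm (W 0)"
        by (simp add: q_def y_def scaled_dual_def norm_vec_def L2_set_def sum_3)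
      show "\<exists>L. L $ 2 = (1 + z / \<mu>) * L $ 1 \<and> L $ 3 = \<mu> * L $ 1 \<and>
         (\<forall>x\<le>0. norm (scaled_dual 1 (- \<mu>) W x - L) \<le> C * exp (\<kappa> * x) * norm (W 0))"
      proof (intro exI[of _ L] conjI allI impI L2 L3)
        fix x :: real assume "x \<le> 0"
        then show "norm (scaled_dual 1 (- \<mu>) W x - L) \<le> C * exp (\<kappa> * x) * norm (W 0)"
          using L[of "- x"] unfolding q0 by (simp add: q_def y_def)
      qed
    qed
  qed
qed

lemma cdot_solutions_constant:
  assumes W: "solves A W" and Y: "solves (\<lambda>x. - cadj (A x)) Y"
  shows "cdot (W x) (Y x) = cdot (W 0) (Y 0)"
proof -
  have "((\<lambda>x. cdot (W x) (Y x)) has_vector_derivative 0) (at x)" for x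
  proof -
    have dW: "((\<lambda>x. W x $ i) has_vector_derivative (A x *v W x) $ i) (at x)" for i
      using W by (intro has_vector_derivative_vec_nth) (simp add: solves_def)
    have dY: "((\<lambda>x. cnj (Y x $ i)) has_vector_derivative cnj ((- cadj (A x) *v Y x) $ i)) (at x)" for i
      using Y by (intro bounded_linear.has_vector_derivative[OF bounded_linear_cnj] has_vector_derivative_vec_nth)
        (simp add: solves_def)
    have "((\<lambda>x. cdot (W x) (Y x)) has_vector_derivative
        (\<Sum>i\<in>UNIV. W x $ i * cnj ((- cadj (A x) *v Y x) $ i) + (A x *v W x) $ i * cnj (Y x $ i))) (at x)"
      unfolding cdot_def by (intro has_vector_derivative_sum has_vector_derivative_mult dW dY)
    moreover have "(\<Sum>i\<in>UNIV. W x $ i * cnj ((- cadj (A x) *v Y x) $ i) + (A x *v W x) $ i * cnj (Y x $ i)) = 0"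
      by (simp add: sum_3 matrix_vector_mult_def cadj_def algebra_simps)
    ultimately show ?thesis by simp
  qed
  then obtain c where "\<And>x. cdot (W x) (Y x) = c"
    using has_vector_derivative_zero_constant[of UNIV "\<lambda>x. cdot (W x) (Y x)"] by (metis UNIV_I convex_UNIV)
  then show ?thesis by simp
qed

section \<open>The inflow limit\<close>

lemma analytic_on_cnj_conj:
  assumes f: "(\<lambda>z. f (cnj z)) analytic_on S" and S: "cnj ` S = S"
  shows "(\<lambda>z. cnj (f z)) analytic_on S"
  unfolding analytic_on_def
proof
  fix x assume "x \<in> S"
  then have "cnj x \<in> S" using S by blast
  then obtain e where e: "0 < e" "(\<lambda>z. f (cnj z)) holomorphic_on ball (cnj x) e"
    using f by (auto simp: analytic_on_def)
  have "cnj ` ball x e = ball (cnj x) e"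
  proof (intro equalityI subsetI)
    fix y assume "y \<in> ball (cnj x) e"
    then have "cnj y \<in> ball x e"
      by (simp add: dist_norm) (metis complex_cnj_cnj complex_cnj_diff complex_mod_cnj)
    then show "y \<in> cnj ` ball x e" by (metis complex_cnj_cnj imageI)
  next
    fix y assume "y \<in> cnj ` ball x e"
    then show "y \<in> ball (cnj x) e" by (auto simp: dist_norm simp flip: complex_cnj_diff)
  qed
  then have "(cnj \<circ> (\<lambda>z. f (cnj z)) \<circ> cnj) holomorphic_on ball x e"
    using e by (intro holomorphic_on_compose_cnj_cnj) auto
  then show "\<exists>e>0. (\<lambda>z. cnj (f z)) holomorphic_on ball x e" using e(1) by (auto simp: o_def)
qed

lemma cnj_RHP: "cnj ` RHP = RHP"
proof (intro equalityI subsetI)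
  fix z assume "z \<in> RHP"
  then show "z \<in> cnj ` RHP" by (intro image_eqI[of _ _ "cnj z"]) (auto simp: RHP_def)
qed (auto simp: RHP_def)

lemma analytic_on_imp_continuous_on: "f analytic_on S \<Longrightarrow> continuous_on S f"
  by (rule holomorphic_on_imp_continuous_on[OF analytic_imp_holomorphic])

lemma solves_smult:
  assumes "solves B W"
  shows "solves B (\<lambda>x. c *s W x)"
  using assms unfolding solves_def by (auto intro!: has_vector_derivative_smult_const simp: vector_scalar_commute)

text \<open>The eigenvalue \<open>\<mu>\<close> expressed through its eigenvector, by the third row of the matrix. Analyticity and
  joint continuity are assumed of the eigenvector, and this formula transfers them.\<close>

definition shock_root :: "real \<Rightarrow> (real \<Rightarrow> complex \<Rightarrow> complex^3) \<Rightarrow> real \<Rightarrow> complex \<Rightarrow> complex" where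
  "shock_root \<gamma> V vp z = (V vp z $ 1 + V vp z $ 2) / V vp z $ 3 + of_real (fcoef \<gamma> vp 1) - z"

text \<open>The pairing of the right eigenvector with the left eigenvector \<open>(1, 1 + z / \<mu>, \<mu>)\<close>.\<close>

definition shock_weight :: "real \<Rightarrow> (real \<Rightarrow> complex \<Rightarrow> complex^3) \<Rightarrow> real \<Rightarrow> complex \<Rightarrow> complex" where
  "shock_weight \<gamma> V vp z = V vp z $ 3 *
     (2 * (z / shock_root \<gamma> V vp z) * (1 + z / shock_root \<gamma> V vp z) + shock_root \<gamma> V vp z)"

lemma shock_eigendata_facts:
  assumes \<gamma>: "1 \<le> \<gamma>" and V: "shock_eigendata \<gamma> \<mu> V" and vp: "0 \<le> vp" "vp < 1" and z: "z \<in> RHP"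
  shows "shock_root \<gamma> V vp z = \<mu> vp z" "V vp z $ 3 \<noteq> 0" "0 < Re (\<mu> vp z)" "sole_growing_root (fcoef \<gamma> vp 1) z (\<mu> vp z)"
    "shock_weight \<gamma> V vp z \<noteq> 0"
    "V vp z $ 2 = z / \<mu> vp z * V vp z $ 3" "V vp z $ 1 = z / \<mu> vp z * (1 + z / \<mu> vp z) * V vp z $ 3"
proof -
  have vp': "vp \<in> {0..<1}" using vp by simp
  have ep: "eigenpair (coef_matrix 1 (fcoef \<gamma> vp 1) z) (\<mu> vp z) (V vp z)"
    "{\<nu> \<in> eigenvalues (coef_matrix 1 (fcoef \<gamma> vp 1) z). 0 < Re \<nu>} = {\<mu> vp z}"
    using V vp' z unfolding shock_eigendata_def Amat_def by blast+
  show re: "0 < Re (\<mu> vp z)" and sole: "sole_growing_root (fcoef \<gamma> vp 1) z (\<mu> vp z)"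
    using sole_growing_rootI[OF ep] by auto
  then have \<mu>0: "\<mu> vp z \<noteq> 0" by auto
  note c = coef_matrix_eigenpair[OF ep(1) \<mu>0]
  show v3: "V vp z $ 3 \<noteq> 0" and "V vp z $ 2 = z / \<mu> vp z * V vp z $ 3"
    "V vp z $ 1 = z / \<mu> vp z * (1 + z / \<mu> vp z) * V vp z $ 3" by (rule c)+
  show root: "shock_root \<gamma> V vp z = \<mu> vp z" using c(4) by (simp add: shock_root_def)
  have "0 \<le> acoef \<gamma> vp" using acoef_bounds(1)[OF \<gamma>, of vp] vp by (cases "vp = 0") (auto simp: acoef_def)
  then have f: "fcoef \<gamma> vp 1 \<le> 1" using \<gamma> by (simp add: fcoef_one)
  show "shock_weight \<gamma> V vp z \<noteq> 0"
    unfolding shock_weight_def root using growing_root_simple[OF sole re f] z v3 by (auto simp: RHP_def)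
qed

lemma shock_root_analytic:
  assumes \<gamma>: "1 \<le> \<gamma>" and V: "shock_eigendata \<gamma> \<mu> V" and vp: "0 \<le> vp" "vp < 1"
  shows "shock_root \<gamma> V vp analytic_on RHP" "shock_weight \<gamma> V vp analytic_on RHP"
proof -
  have Va: "(\<lambda>z. V vp z $ i) analytic_on RHP" for i
    using V vp unfolding shock_eigendata_def by auto
  note F = shock_eigendata_facts[OF \<gamma> V vp]
  show a: "shock_root \<gamma> V vp analytic_on RHP"
    unfolding shock_root_def[abs_def] by (intro analytic_intros Va) (use F in auto)
  have "shock_root \<gamma> V vp z \<noteq> 0" if "z \<in> RHP" for z
    using F(1,3)[OF that] by auto
  then show "shock_weight \<gamma> V vp analytic_on RHP"
    unfolding shock_weight_def[abs_def] by (intro analytic_intros Va a)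
qed

lemma shock_root_continuous:
  assumes \<gamma>: "1 \<le> \<gamma>" and V: "shock_eigendata \<gamma> \<mu> V"
  shows "continuous_on ({0..<1} \<times> RHP) (\<lambda>(vp, z). shock_root \<gamma> V vp z)"
    "continuous_on ({0..<1} \<times> RHP) (\<lambda>(vp, z). shock_weight \<gamma> V vp z)"
proof -
  have "continuous_on ({0..<1} \<times> RHP) (\<lambda>x. V (fst x) (snd x))"
    using V unfolding shock_eigendata_def by (simp add: case_prod_beta')
  then have Vc: "continuous_on ({0..<1} \<times> RHP) (\<lambda>x. V (fst x) (snd x) $ i)" for i
    by (rule continuous_on_component)
  have p: "continuous_on {0..<1} (\<lambda>x :: real. x powr \<gamma>)"
    using \<gamma> by (intro continuous_on_powr' continuous_on_id continuous_on_const) auto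
  have "1 - x powr \<gamma> \<noteq> 0" if "x \<in> {0..<1}" for x :: real
    using that powr_lt_one[OF \<gamma>, of x] by (cases "x = 0") auto
  then have "continuous_on {0..<1} (acoef \<gamma>)"
    unfolding acoef_def[abs_def]
    by (intro continuous_on_mult continuous_on_divide continuous_on_diff continuous_on_const continuous_on_id p) auto
  then have "continuous_on ({0..<1} \<times> RHP) (\<lambda>x. acoef \<gamma> (fst x))"
    by (rule continuous_on_compose2[OF _ continuous_on_fst[OF continuous_on_id]]) auto
  then have fc: "continuous_on ({0..<1} \<times> RHP) (\<lambda>x. fcoef \<gamma> (fst x) 1)"
    unfolding fcoef_one by (intro continuous_intros)
  have root: "continuous_on ({0..<1} \<times> RHP) (\<lambda>x. shock_root \<gamma> V (fst x) (snd x))"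
    unfolding shock_root_def
    by (intro continuous_intros Vc fc) (use shock_eigendata_facts(2)[OF \<gamma> V] in auto)
  then show "continuous_on ({0..<1} \<times> RHP) (\<lambda>(vp, z). shock_root \<gamma> V vp z)" by (simp add: case_prod_beta')
  have "shock_root \<gamma> V (fst x) (snd x) \<noteq> 0" if "x \<in> {0..<1} \<times> RHP" for x
    using shock_eigendata_facts(1,3)[OF \<gamma> V, of "fst x" "snd x"] that by auto
  then have "continuous_on ({0..<1} \<times> RHP) (\<lambda>x. shock_weight \<gamma> V (fst x) (snd x))"
    unfolding shock_weight_def by (intro continuous_intros Vc root) auto
  then show "continuous_on ({0..<1} \<times> RHP) (\<lambda>(vp, z). shock_weight \<gamma> V vp z)" by (simp add: case_prod_beta')
qed

lemma compact_positive_lower_bound: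
  fixes f :: "'a::topological_space \<Rightarrow> real"
  assumes K: "compact K" and f: "continuous_on K f" "\<And>x. x \<in> K \<Longrightarrow> 0 < f x"
  obtains m where "0 < m" "m \<le> 1" "\<And>x. x \<in> K \<Longrightarrow> m \<le> f x"
proof (cases "K = {}")
  case False
  then obtain x where x: "x \<in> K" "\<And>y. y \<in> K \<Longrightarrow> f x \<le> f y"
    using continuous_attains_inf[OF K _ f(1)] by blast
  show ?thesis by (rule that[of "min 1 (f x)"]) (use x f in \<open>auto intro: order_trans[OF min.cobounded2]\<close>)
qed (use that[of 1] in auto)

text \<open>The pairing is constant in \<open>x\<close>, and the exponential factors of the two solutions cancel, so it equals
  the pairing of the limits.\<close>

lemma evans_value_at_limit:
  fixes W Y :: "real \<Rightarrow> complex^3"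
  assumes W: "solves A W" "asymp_exp \<mu> V at_bot W" and Y: "solves (\<lambda>x. - cadj (A x)) Y"
    and L: "(scaled_dual 1 (- \<mu>) Y \<longlongrightarrow> L) at_bot"
  shows "cdot (W 0) (Y 0) = (\<Sum>i\<in>UNIV. V $ i * L $ i)"
proof -
  have "((\<lambda>x. \<Sum>i\<in>UNIV. (exp (- \<mu> * of_real x) *s W x) $ i * scaled_dual 1 (- \<mu>) Y x $ i) \<longlongrightarrow> (\<Sum>i\<in>UNIV. V $ i * L $ i)) at_bot"
    using W(2) L unfolding asymp_exp_def by (intro tendsto_sum tendsto_mult tendsto_vec_nth)
  moreover have "(\<Sum>i\<in>UNIV. (exp (- \<mu> * of_real x) *s W x) $ i * scaled_dual 1 (- \<mu>) Y x $ i) = cdot (W 0) (Y 0)" for x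
  proof -
    have "exp (\<mu> * of_real x) * exp (- \<mu> * of_real x) = 1" by (simp flip: exp_add)
    then have *: "(exp (- \<mu> * of_real x) * a) * (exp (\<mu> * of_real x) * b) = a * b" for a b by (metis mult.assoc mult.commute mult.left_neutral)
    have "(\<Sum>i\<in>UNIV. (exp (- \<mu> * of_real x) *s W x) $ i * scaled_dual 1 (- \<mu>) Y x $ i) = cdot (W x) (Y x)"
      unfolding cdot_def sum_3 scaled_dual_def vector_3 vector_smult_component minus_minus div_by_1 * ..
    then show ?thesis using cdot_solutions_constant[OF W(1) Y, of x] by simp
  qed
  ultimately have "((\<lambda>x :: real. cdot (W 0) (Y 0)) \<longlongrightarrow> (\<Sum>i\<in>UNIV. V $ i * L $ i)) at_bot" by simp
  then show ?thesis by (simp add: tendsto_const_iff)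
qed

text \<open>For \<open>z \<noteq> 0\<close> both sides solve the same system with the same behaviour at \<open>+\<infinity>\<close>. At \<open>z = 0\<close>
  that behaviour need not single out a solution, and the identity follows by continuity.\<close>

lemma inflow_solution_eq_translate:
  assumes \<gamma>: "1 \<le> \<gamma>" and V: "adjoint_eigendata \<gamma> \<mu> V" and vp: "0 < vp" "vp < 1"
    and v: "profile \<gamma> vp v0 v" "\<And>x. v x = u (x + t)" and z: "z \<in> RHP"
    and W: "adjoint_solution \<gamma> vp v (\<mu> vp) (V vp) W" and Wu: "adjoint_solution \<gamma> vp u (\<mu> vp) (V vp) Wu"
  shows "W z 0 = exp (- \<mu> vp z * of_real t) *s Wu z t"
proof -
  have vp': "vp \<in> {0<..<1}" using vp by simp
  have nz: "W y 0 = exp (- \<mu> vp y * of_real t) *s Wu y t" if y: "y \<in> RHP" "y \<noteq> 0" for y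
  proof -
    have yR: "y \<in> RHP - {0}" using y by simp
    have ev: "{\<nu> \<in> eigenvalues (- cadj (Amat \<gamma> vp vp y)). Re \<nu> < 0} = {\<mu> vp y}"
      using V vp' yR unfolding adjoint_eigendata_def by blast
    have "solves (\<lambda>x. - cadj (Amat \<gamma> vp (u x) y)) (Wu y)" using Wu y unfolding adjoint_solution_def by blast
    from solves_smult[OF solves_shift[OF this, of t]]
    have 2: "solves (\<lambda>x. - cadj (Amat \<gamma> vp (v x) y)) (\<lambda>x. exp (- \<mu> vp y * of_real t) *s Wu y (x + t))"
      by (simp add: v(2))
    have "W y 0 = exp (- \<mu> vp y * of_real t) *s Wu y (0 + t)"
    proof (rule adjoint_solution_unique[OF \<gamma> vp y ev v(1) _ _ 2])
      show "solves (\<lambda>x. - cadj (Amat \<gamma> vp (v x) y)) (W y)" "asymp_exp (\<mu> vp y) (V vp y) at_top (W y)"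
        using W yR y unfolding adjoint_solution_def by blast+
      show "asymp_exp (\<mu> vp y) (V vp y) at_top (\<lambda>x. exp (- \<mu> vp y * of_real t) *s Wu y (x + t))"
        using Wu yR unfolding adjoint_solution_def by (intro asymp_exp_shift filterlim_shift_at_top) blast
    qed
    then show ?thesis by simp
  qed
  show ?thesis
  proof (cases "z = 0")
    case False
    then show ?thesis using nz z by simp
  next
    case True
    have "(\<lambda>z. \<mu> vp (cnj z)) analytic_on RHP" using V vp' unfolding adjoint_eigendata_def by blast
    then have "(\<lambda>z. cnj (\<mu> vp z)) analytic_on RHP" using cnj_RHP by (rule analytic_on_cnj_conj)
    then have "continuous_on RHP (\<lambda>z. cnj (cnj (\<mu> vp z)))"
      by (intro continuous_on_cnj analytic_on_imp_continuous_on)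
    then have \<mu>: "((\<lambda>z. \<mu> vp z) \<longlongrightarrow> \<mu> vp 0) (at 0 within RHP)"
      using z True by (simp add: continuous_on_def)
    have "((\<lambda>z. W z 0) \<longlongrightarrow> W 0 0) (at 0 within RHP)" "((\<lambda>z. Wu z t) \<longlongrightarrow> Wu 0 t) (at 0 within RHP)"
      using W Wu unfolding adjoint_solution_def by (simp_all add: continuous_within)
    note lims = this
    have "((\<lambda>z. exp (- \<mu> vp z * of_real t) *s Wu z t) \<longlongrightarrow> exp (- \<mu> vp 0 * of_real t) *s Wu 0 t) (at 0 within RHP)"
      by (rule vec_tendstoI) (auto intro!: tendsto_intros lims \<mu>)
    moreover have "\<forall>\<^sub>F y in at 0 within RHP. exp (- \<mu> vp y * of_real t) *s Wu y t = W y 0"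
      unfolding eventually_at using nz by (intro exI[of _ 1]) auto
    ultimately have "((\<lambda>z. W z 0) \<longlongrightarrow> exp (- \<mu> vp 0 * of_real t) *s Wu 0 t) (at 0 within RHP)"
      by (rule Lim_transform_eventually)
    with lims(1) show ?thesis unfolding True by (rule tendsto_unique[OF zero_limit_point_RHP])
  qed
qed

text \<open>After translation, \<open>c_in D_in\<close> is the weight times the first component of \<open>exp (\<mu> t) Y t\<close>, while the
  shock Evans function is the weight times the first component of its limit as \<open>t \<rightarrow> -\<infinity>\<close>. The
  difference is \<open>O(exp (\<kappa> t))\<close>, with constants from compactness of \<open>[0, 1 - \<epsilon>] \<times> K\<close> and from
  the bound on \<open>Y 0\<close>.\<close>

lemma inflow_limit:
  fixes \<gamma> \<epsilon> :: real and K :: "complex set"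
  assumes gamma: "1 \<le> \<gamma>"
    and K: "compact K" "K \<subseteq> RHP" and \<epsilon>: "0 < \<epsilon>" "\<epsilon> < 1"
    and vh: "\<And>vp v0. 0 < vp \<Longrightarrow> vp < v0 \<Longrightarrow> v0 < 1 \<Longrightarrow> profile \<gamma> vp v0 (vh vp v0)"
    and Vp: "adjoint_eigendata \<gamma> \<mu>p Vp"
    and Win: "\<And>vp v0. 0 < vp \<Longrightarrow> vp < v0 \<Longrightarrow> v0 < 1 \<Longrightarrow>
                adjoint_solution \<gamma> vp (vh vp v0) (\<mu>p vp) (Vp vp) (Win vp v0)"
    and vc: "\<And>vp. 0 < vp \<Longrightarrow> vp < 1 \<Longrightarrow> vc vp 0 = (1 + vp) / 2"
            "\<And>vp v0. 0 < vp \<Longrightarrow> vp < v0 \<Longrightarrow> v0 < 1 \<Longrightarrow> translate_of (vc vp) (vh vp v0)"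
    and Vm: "shock_eigendata \<gamma> \<mu>m Vm"
    and Wm: "\<And>vp. 0 < vp \<Longrightarrow> vp < 1 \<Longrightarrow>
                shock_solution \<gamma> vp (vc vp) (\<mu>m vp) (Vm vp) (Wm vp)"
    and Wp: "\<And>vp. 0 < vp \<Longrightarrow> vp < 1 \<Longrightarrow>
                adjoint_solution \<gamma> vp (vc vp) (\<mu>p vp) (Vp vp) (Wp vp)"
  shows "\<exists>c_in :: complex \<Rightarrow> real \<Rightarrow> real \<Rightarrow> complex.
     (\<forall>v0 vp. 0 < vp \<and> vp < v0 \<and> v0 < 1 \<longrightarrow>
        (\<lambda>z. c_in z v0 vp) analytic_on RHP \<and> (\<forall>z\<in>RHP. c_in z v0 vp \<noteq> 0)) \<and>
     uniform_limit (K \<times> {0<..1 - \<epsilon>})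
       (\<lambda>v0 (z, vp). c_in z v0 vp * D_in (Win vp v0) z)
       (\<lambda>(z, vp). D_shock (Wm vp) (Wp vp) z)
       (at_left 1)"
proof -
  define t where "t vp v0 = (SOME t. \<forall>x. vh vp v0 x = vc vp (x + t))" for vp v0
  have t: "vh vp v0 x = vc vp (x + t vp v0)" if h: "0 < vp" "vp < v0" "v0 < 1" for vp v0 x
  proof -
    obtain s where "\<And>x. vc vp x = vh vp v0 (x + s)" using vc(2)[OF h] by (auto simp: translate_of_def)
    then have "\<forall>x. vh vp v0 x = vc vp (x + (- s))" by simp
    then have "\<exists>t. \<forall>x. vh vp v0 x = vc vp (x + t)" by blast
    then have "\<forall>x. vh vp v0 x = vc vp (x + t vp v0)" unfolding t_def by (rule someI_ex)
    then show ?thesis by blast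
  qed
  have prof: "profile \<gamma> vp (vc vp 0) (vc vp)" if vp: "0 < vp" "vp < 1" for vp
  proof -
    define v0 where "v0 = (1 + vp) / 2"
    have v0: "vp < v0" "v0 < 1" using vp by (auto simp: v0_def)
    obtain s where s: "\<And>x. vc vp x = vh vp v0 (x + s)" using vc(2)[OF vp(1) v0] by (auto simp: translate_of_def)
    have "profile \<gamma> vp (vh vp v0 s) (\<lambda>x. vh vp v0 (x + s))" by (rule profile_translate[OF vh[OF vp(1) v0]])
    moreover have "(\<lambda>x. vh vp v0 (x + s)) = vc vp" using s by (auto simp: fun_eq_iff)
    moreover have "vh vp v0 s = vc vp 0" using s[of 0] by simp
    ultimately show ?thesis by simp
  qed
  note F = shock_eigendata_facts[OF gamma Vm]
  have sub: "{0..1 - \<epsilon>} \<times> K \<subseteq> {0..<1} \<times> RHP" using \<epsilon> K by auto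
  have cK: "compact ({0..1 - \<epsilon>} \<times> K)" by (intro compact_Times K) auto
  note rc = continuous_on_subset[OF shock_root_continuous(1)[OF gamma Vm] sub]
  note wc = continuous_on_subset[OF shock_root_continuous(2)[OF gamma Vm] sub]
  have pos: "0 < Re (case x of (vp, z) \<Rightarrow> shock_root \<gamma> Vm vp z)" if "x \<in> {0..1 - \<epsilon>} \<times> K" for x
    using F(1,3)[of "fst x" "snd x"] subsetD[OF sub that] by (auto simp: case_prod_beta')
  have rc': "continuous_on ({0..1 - \<epsilon>} \<times> K) (\<lambda>x. Re (case x of (vp, z) \<Rightarrow> shock_root \<gamma> Vm vp z))"
    by (rule continuous_on_Re[OF rc])
  obtain m where m: "0 < m" "m \<le> 1"
    "\<And>x. x \<in> {0..1 - \<epsilon>} \<times> K \<Longrightarrow> m \<le> Re (case x of (vp, z) \<Rightarrow> shock_root \<gamma> Vm vp z)"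
    using compact_positive_lower_bound[OF cK rc' pos] by blast
  obtain M where "0 \<le> M" and M: "\<And>x. x \<in> {0..1 - \<epsilon>} \<times> K \<Longrightarrow> cmod (case x of (vp, z) \<Rightarrow> shock_root \<gamma> Vm vp z) \<le> M"
    using compact_norm_bound[OF cK rc] by blast
  obtain Nb where Nb: "0 \<le> Nb" "\<And>x. x \<in> {0..1 - \<epsilon>} \<times> K \<Longrightarrow> cmod (case x of (vp, z) \<Rightarrow> shock_weight \<gamma> Vm vp z) \<le> Nb"
    using compact_norm_bound[OF cK wc] by blast
  obtain C1 where C1: "\<And>vp z v0 v W. \<lbrakk>0 < vp; vp \<le> 1 - \<epsilon>; z \<in> K; profile \<gamma> vp v0 v; v 0 = (1 + vp) / 2;
     adjoint_solution \<gamma> vp v (\<mu>p vp) (Vp vp) W\<rbrakk> \<Longrightarrow> norm (W z 0) \<le> C1"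
    using adjoint_solution_value_bounded[OF gamma Vp K \<epsilon>(1)] by blast
  obtain C \<kappa> where C: "0 \<le> C" and \<kappa>: "0 < \<kappa>" and lim:
    "\<And>vp z \<mu> v0 v W. \<lbrakk>0 < vp; vp \<le> 1 - \<epsilon>; z \<in> K; sole_growing_root (fcoef \<gamma> vp 1) z \<mu>; m \<le> Re \<mu>; cmod \<mu> \<le> M;
       profile \<gamma> vp v0 v; v 0 = (1 + vp) / 2; solves (\<lambda>x. - cadj (Amat \<gamma> vp (v x) z)) W\<rbrakk> \<Longrightarrow>
       \<exists>L. L $ 2 = (1 + z / \<mu>) * L $ 1 \<and> L $ 3 = \<mu> * L $ 1 \<and>
         (\<forall>x\<le>0. norm (scaled_dual 1 (- \<mu>) W x - L) \<le> C * exp (\<kappa> * x) * norm (W 0))"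
    using dual_solution_limit_at_bot[OF gamma K \<epsilon>(1) m(1,2), of M] by blast
  (* The exponential undoes the translation of the decaying solution and the growth at minus infinity. *)
  define c_in where "c_in z v0 vp = exp ((cnj (\<mu>p vp z) + shock_root \<gamma> Vm vp z) * of_real (t vp v0)) * shock_weight \<gamma> Vm vp z" for z v0 vp
  have error: "cmod (c_in z v0 vp * D_in (Win vp v0) z - D_shock (Wm vp) (Wp vp) z) \<le> Nb * (C * C1) * exp (\<kappa> * t vp v0)"
    if z: "z \<in> K" and vp: "0 < vp" "vp \<le> 1 - \<epsilon>" and v0: "vp < v0" "v0 < 1" and t0: "t vp v0 \<le> 0" for z v0 vp
  proof -
    have vp1: "vp < 1" "vp \<in> {0..1 - \<epsilon>}" using vp \<epsilon> by auto
    have zR: "z \<in> RHP" using z K by auto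
    have mem: "(vp, z) \<in> {0..1 - \<epsilon>} \<times> K" using vp z by simp
    define \<mu> where "\<mu> = \<mu>m vp z"
    have root: "shock_root \<gamma> Vm vp z = \<mu>" unfolding \<mu>_def by (rule F(1)) (use vp vp1 zR in auto)
    have sole: "sole_growing_root (fcoef \<gamma> vp 1) z \<mu>" unfolding \<mu>_def by (rule F(4)) (use vp vp1 zR in auto)
    have V2: "Vm vp z $ 2 = z / \<mu> * Vm vp z $ 3" unfolding \<mu>_def by (rule F(6)) (use vp vp1 zR in auto)
    have V1: "Vm vp z $ 1 = z / \<mu> * (1 + z / \<mu>) * Vm vp z $ 3" unfolding \<mu>_def by (rule F(7)) (use vp vp1 zR in auto)
    have \<mu>m: "m \<le> Re \<mu>" "cmod \<mu> \<le> M" using m(3)[OF mem] M[OF mem] root by simp_all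
    have Y: "solves (\<lambda>x. - cadj (Amat \<gamma> vp (vc vp x) z)) (Wp vp z)"
      using Wp[OF vp(1) vp1(1)] zR unfolding adjoint_solution_def by blast
    obtain L where L: "L $ 2 = (1 + z / \<mu>) * L $ 1" "L $ 3 = \<mu> * L $ 1"
      and Lx: "\<And>x. x \<le> 0 \<Longrightarrow> norm (scaled_dual 1 (- \<mu>) (Wp vp z) x - L) \<le> C * exp (\<kappa> * x) * norm (Wp vp z 0)"
      using lim[OF vp z sole \<mu>m prof[OF vp(1) vp1(1)] vc(1)[OF vp(1) vp1(1)] Y] by blast
    have null: "((\<lambda>x. C * exp (\<kappa> * x) * norm (Wp vp z 0)) \<longlongrightarrow> 0) at_bot"
      using exp_decay_at_bot[OF \<kappa>, of "C * norm (Wp vp z 0)"] by (simp add: mult_ac)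
    have "((\<lambda>x. scaled_dual 1 (- \<mu>) (Wp vp z) x - L) \<longlongrightarrow> 0) at_bot"
      by (rule Lim_null_comparison[OF eventually_at_bot_linorderI[of 0] null]) (rule Lx)
    then have "(scaled_dual 1 (- \<mu>) (Wp vp z) \<longlongrightarrow> L) at_bot" by (simp only: Lim_null[of _ L])
    moreover have "solves (\<lambda>x. Amat \<gamma> vp (vc vp x) z) (Wm vp z)" "asymp_exp \<mu> (Vm vp z) at_bot (Wm vp z)"
      using Wm[OF vp(1) vp1(1)] zR unfolding shock_solution_def \<mu>_def by blast+
    ultimately have "D_shock (Wm vp) (Wp vp) z = (\<Sum>i\<in>UNIV. Vm vp z $ i * L $ i)"
      unfolding D_shock_def using evans_value_at_limit[OF _ _ Y] by blast
    also have "\<dots> = shock_weight \<gamma> Vm vp z * L $ 1"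
    proof -
      have "w * (1 + w) * a * l + w * a * ((1 + w) * l) + a * (\<mu> * l) = a * (2 * w * (1 + w) + \<mu>) * l" for w a l
        by algebra
      then show ?thesis unfolding sum_3 V1 V2 L shock_weight_def root .
    qed
    finally have Ds: "D_shock (Wm vp) (Wp vp) z = shock_weight \<gamma> Vm vp z * L $ 1" .
    define \<tau> where "\<tau> = t vp v0"
    have "Win vp v0 z 0 = exp (- \<mu>p vp z * of_real \<tau>) *s Wp vp z \<tau>"
      unfolding \<tau>_def
      by (rule inflow_solution_eq_translate[OF gamma Vp vp(1) vp1(1) vh[OF vp(1) v0] t[OF vp(1) v0] zR Win[OF vp(1) v0] Wp[OF vp(1) vp1(1)]])
    then have "D_in (Win vp v0) z = exp (- cnj (\<mu>p vp z) * of_real \<tau>) * cnj (Wp vp z \<tau> $ 1)"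
      by (simp add: D_in_def cdot_def sum_3 exp_cnj)
    then have "c_in z v0 vp * D_in (Win vp v0) z = shock_weight \<gamma> Vm vp z * scaled_dual 1 (- \<mu>) (Wp vp z) \<tau> $ 1"
      by (simp add: c_in_def root scaled_dual_def distrib_right exp_add exp_minus \<tau>_def)
    then have "cmod (c_in z v0 vp * D_in (Win vp v0) z - D_shock (Wm vp) (Wp vp) z)
        = cmod (shock_weight \<gamma> Vm vp z) * cmod ((scaled_dual 1 (- \<mu>) (Wp vp z) \<tau> - L) $ 1)"
      unfolding Ds by (simp add: right_diff_distrib flip: norm_mult)
    also have "\<dots> \<le> Nb * (C * exp (\<kappa> * \<tau>) * norm (Wp vp z 0))"
      using Nb(2)[OF mem] order_trans[OF Finite_Cartesian_Product.norm_nth_le Lx[of \<tau>]] t0 Nb(1) by (intro mult_mono) (auto simp: \<tau>_def)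
    also have "\<dots> \<le> Nb * (C * exp (\<kappa> * \<tau>) * C1)"
      using C1[OF vp z prof[OF vp(1) vp1(1)] vc(1)[OF vp(1) vp1(1)] Wp[OF vp(1) vp1(1)]] Nb(1) C
      by (intro mult_left_mono) auto
    finally show ?thesis by (simp add: \<tau>_def mult_ac)
  qed
  have shift: "t vp v0 \<le> 0" "\<epsilon> / 2 * exp (t vp v0) \<le> 1 - v0"
    if vp: "0 < vp" "vp \<le> 1 - \<epsilon>" and v0: "1 - \<epsilon> / 2 < v0" "v0 < 1" for vp v0
  proof -
    have vp1: "vp < 1" "vp < v0" using vp v0 \<epsilon> by auto
    note P = prof[OF vp(1) vp1(1)]
    have "vh vp v0 0 = v0" using vh[OF vp(1) vp1(2) v0(2)] by (simp add: profile_def)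
    then have vt: "vc vp (t vp v0) = v0" using t[OF vp(1) vp1(2) v0(2), of 0] by simp
    show t0: "t vp v0 \<le> 0"
    proof (rule ccontr)
      assume "\<not> t vp v0 \<le> 0"
      then have "vc vp (t vp v0) \<le> vc vp 0" using profile_facts(4)[OF P] by simp
      then show False using vt vc(1)[OF vp(1) vp1(1)] vp v0 by simp
    qed
    have "\<epsilon> / 2 * exp (t vp v0) \<le> (1 - vc vp 0) * exp (t vp v0)"
      using vc(1)[OF vp(1) vp1(1)] vp by (intro mult_right_mono) auto
    also have "\<dots> \<le> (1 - v0) * exp (0 - t vp v0) * exp (t vp v0)"
      using profile_lower_left[OF gamma vp(1) vp1(1) P t0] vt by (intro mult_right_mono) auto
    also have "\<dots> = 1 - v0" by (simp flip: exp_add)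
    finally show "\<epsilon> / 2 * exp (t vp v0) \<le> 1 - v0" .
  qed
  show ?thesis
  proof (intro exI[of _ c_in] conjI allI impI ballI; (elim conjE)?)
    fix v0 vp :: real assume v: "0 < vp" "vp < v0" "v0 < 1"
    then have vp: "0 \<le> vp" "vp < 1" "vp \<in> {0<..<1}" by auto
    have "(\<lambda>z. \<mu>p vp (cnj z)) analytic_on RHP" using Vp vp unfolding adjoint_eigendata_def by blast
    then have a: "(\<lambda>z. cnj (\<mu>p vp z)) analytic_on RHP" using cnj_RHP by (rule analytic_on_cnj_conj)
    show "(\<lambda>z. c_in z v0 vp) analytic_on RHP"
      unfolding c_in_def
      by (intro analytic_intros a shock_root_analytic[OF gamma Vm vp(1,2)])
    show "c_in z v0 vp \<noteq> 0" if "z \<in> RHP" for z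
      using F(5)[OF vp(1,2) that] by (simp add: c_in_def)
  next
    show "uniform_limit (K \<times> {0<..1 - \<epsilon>})
       (\<lambda>v0 (z, vp). c_in z v0 vp * D_in (Win vp v0) z)
       (\<lambda>(z, vp). D_shock (Wm vp) (Wp vp) z) (at_left 1)"
      unfolding uniform_limit_iff
    proof (intro allI impI)
      fix e :: real assume e: "0 < e"
      define B where "B = Nb * (C * C1)"
      have "\<forall>\<^sub>F T in at_bot. B * exp (\<kappa> * T) < e"
        using exp_decay_at_bot[OF \<kappa>] e by (rule order_tendstoD)
      then obtain T where T: "\<And>x. x \<le> T \<Longrightarrow> B * exp (\<kappa> * x) < e" by (auto simp: eventually_at_bot_linorder)
      (* If 1 - v0 < epsilon / 2 * exp T, then the shift t is below T for every vp <= 1 - epsilon. *)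
      define \<delta> where "\<delta> = min (\<epsilon> / 2) (\<epsilon> / 2 * exp T)"
      have \<delta>: "0 < \<delta>" using \<epsilon> by (simp add: \<delta>_def)
      have "\<forall>\<^sub>F v0 in at_left 1. v0 \<in> {1 - \<delta><..<1}" by (rule eventually_at_left_real) (use \<delta> in simp)
      then show "\<forall>\<^sub>F v0 in at_left 1. \<forall>x\<in>K \<times> {0<..1 - \<epsilon>}.
        dist (case x of (z, vp) \<Rightarrow> c_in z v0 vp * D_in (Win vp v0) z) (case x of (z, vp) \<Rightarrow> D_shock (Wm vp) (Wp vp) z) < e"
      proof eventually_elim
        case (elim v0)
        show ?case
        proof (clarify)
          fix z vp assume z: "z \<in> K" and "vp \<in> {0<..1 - \<epsilon>}"
          then have vp: "0 < vp" "vp \<le> 1 - \<epsilon>" by auto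
          have v0: "1 - \<epsilon> / 2 < v0" "v0 < 1" "1 - v0 < \<epsilon> / 2 * exp T" using elim by (auto simp: \<delta>_def)
          note s = shift[OF vp v0(1,2)]
          have "\<epsilon> / 2 * exp (t vp v0) < \<epsilon> / 2 * exp T" using s(2) v0(3) by linarith
          then have tT: "t vp v0 \<le> T" using \<epsilon> by simp
          have "vp < v0" using vp v0 \<epsilon> by linarith
          from error[OF z vp this v0(2) s(1)] T[OF tT]
          show "dist (c_in z v0 vp * D_in (Win vp v0) z) (D_shock (Wm vp) (Wp vp) z) < e"
            by (simp add: dist_norm B_def)
        qed
      qed
    qed
  qed
qed

section \<open>The limiting system\<close>

text \<open>Only the value at \<open>0\<close> and the equation are given, so uniqueness has to be proved: the quantity \<open>q\<close>
  vanishes at \<open>0\<close> and satisfies a linear equation.\<close>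

lemma logistic_solution:
  fixes v :: "real \<Rightarrow> real"
  assumes v: "\<And>x. (v has_real_derivative v x * (v x - 1)) (at x)" and v0: "v 0 = 1 / 2"
  shows "v x = 1 / (1 + exp x)"
proof -
  define q where "q x = v x * (1 + exp x) - 1" for x
  have dq: "(q has_real_derivative v x * q x) (at x)" for x
    unfolding q_def by (auto intro!: derivative_eq_intros v simp: algebra_simps)
  have dq2: "((\<lambda>x. (q x)\<^sup>2) has_real_derivative 2 * v x * (q x)\<^sup>2) (at x)" for x
    by (rule DERIV_cong[OF DERIV_power[OF dq, of 2]]) (simp add: power2_eq_square)
  have cont: "continuous_on S v" for S
    by (intro continuous_at_imp_continuous_on) (auto intro!: DERIV_isCont[OF v])
  obtain M where M: "\<And>y. y \<in> {- \<bar>x\<bar>..\<bar>x\<bar>} \<Longrightarrow> norm (v y) \<le> M"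
    using compact_norm_bound[OF compact_Icc cont, of "- \<bar>x\<bar>" "\<bar>x\<bar>"] by blast
  have b: "2 * v y * (q y)\<^sup>2 \<le> 2 * M * (q y)\<^sup>2" "- (2 * M * (q y)\<^sup>2) \<le> 2 * v y * (q y)\<^sup>2"
    if "- \<bar>x\<bar> \<le> y" "y \<le> \<bar>x\<bar>" for y
  proof -
    have "\<bar>v y\<bar> \<le> M" using M[of y] that by simp
    then show "2 * v y * (q y)\<^sup>2 \<le> 2 * M * (q y)\<^sup>2" by (intro mult_right_mono) auto
    have "- (2 * M) * (q y)\<^sup>2 \<le> 2 * v y * (q y)\<^sup>2" using \<open>\<bar>v y\<bar> \<le> M\<close> by (intro mult_right_mono) auto
    then show "- (2 * M * (q y)\<^sup>2) \<le> 2 * v y * (q y)\<^sup>2" by simp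
  qed
  have \<Phi>: "((\<lambda>x. 2 * M * x) has_real_derivative 2 * M) (at x)" for x
    by (auto intro!: derivative_eq_intros)
  have q0: "q 0 = 0" by (simp add: q_def v0)
  have "(q x)\<^sup>2 \<le> 0"
  proof (cases "0 \<le> x")
    case True
    from gronwall_forward[OF this dq2 \<Phi> b(1)] True show ?thesis by (simp add: q0)
  next
    case False
    then have "x \<le> 0" by simp
    from gronwall_backward[OF this dq2 \<Phi> b(2)] this show ?thesis by (simp add: q0)
  qed
  then have "v x * (1 + exp x) = 1" by (simp add: q_def)
  moreover have "0 < 1 + exp x" by (simp add: add_pos_pos)
  ultimately show ?thesis by (simp add: field_simps)
qed

definition logistic :: "real \<Rightarrow> real" where
  "logistic x = 1 / (1 + exp x)"

lemma logistic_bounds: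
  "0 < logistic x" "logistic x < 1" "logistic x \<le> exp (- x)" "1 - logistic x \<le> exp x"
proof -
  have p: "0 < 1 + exp x" by (simp add: add_pos_pos)
  then show "0 < logistic x" "logistic x < 1" by (auto simp: logistic_def)
  have "1 / (1 + exp x) \<le> 1 / exp x" by (intro divide_left_mono) (auto simp: add_pos_pos)
  then show "logistic x \<le> exp (- x)" by (simp add: logistic_def exp_minus divide_inverse)
  have "1 - logistic x = exp x / (1 + exp x)" using p by (simp add: logistic_def field_simps)
  also have "\<dots> \<le> exp x / 1" by (intro divide_left_mono) (auto simp: add_pos_pos)
  finally show "1 - logistic x \<le> exp x" by simp
qed

lemma logistic_less_iff: "logistic x < logistic y \<longleftrightarrow> y < x"
  by (simp add: logistic_def divide_less_cancel frac_less2 add_pos_pos divide_strict_left_mono field_simps)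

lemma coef_growing_splitting:
  fixes z \<mu> :: complex
  assumes sole: "sole_growing_root 1 z \<mu>" and m: "0 < m" "m \<le> 1" "m \<le> Re \<mu>" and z: "0 \<le> Re z"
    and Z: "cmod z \<le> Z" "cmod \<mu> \<le> Z" "1 \<le> Z"
  obtains \<beta>2 \<beta>3 where "splitting (mat \<mu> - coef_matrix 1 1 z) \<beta>2 \<beta>3 ((900 * Z * Z) * (900 * Z * Z) / m)"
    "m \<le> Re \<beta>2" "m \<le> Re \<beta>3" "cmod \<beta>3 \<le> (900 * Z * Z) * (900 * Z * Z) / m"
proof -
  have \<mu>: "0 < Re \<mu>" using m by simp
  obtain \<mu>2 \<mu>3 where c: "of_real 1 - z = \<mu> + \<mu>2 + \<mu>3" "\<mu> * \<mu>2 + \<mu> * \<mu>3 + \<mu>2 * \<mu>3 = - 2 * z" "\<mu> * \<mu>2 * \<mu>3 = z\<^sup>2"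
    and re: "Re \<mu>2 \<le> 0" "Re \<mu>3 \<le> 0"
    using growing_root_companions[OF sole \<mu> order_refl z] .
  have "\<bar>1 :: real\<bar> \<le> Z" using Z by simp
  note cb = companion_bounds[OF Z(1,2) this Z(3) c(1,2)]
  have ZZ1: "Z \<le> Z * Z" using Z mult_left_mono[of 1 Z Z] by simp
  then have ZZ: "Z \<le> Z * Z" "1 \<le> Z * Z" using Z by linarith+
  define \<beta>2 \<beta>3 where "\<beta>2 = \<mu> - \<mu>2" and "\<beta>3 = \<mu> - \<mu>3"
  have \<beta>: "m \<le> Re \<beta>2" "m \<le> Re \<beta>3" using m re by (auto simp: \<beta>2_def \<beta>3_def)
  let ?A = "coef_matrix 1 1 z"
  have * : "norm ((mat \<mu> - ?A) *v p - (\<mu> - \<xi>) *s p) \<le> 900 * Z * Z * norm p" if "cmod \<xi> \<le> 10 * Z * Z" for \<xi> p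
  proof -
    have e: "(mat \<mu> - ?A) *v p - (\<mu> - \<xi>) *s p = vector
      [\<xi> * p $ 1 + (- z) * p $ 2 + (- z) * p $ 3, 0 * p $ 1 + \<xi> * p $ 2 + (- z) * p $ 3,
       (- 1) * p $ 1 + (- 1) * p $ 2 + (\<xi> - 1 + z) * p $ 3]"
    proof -
      have "mat \<mu> *v p = \<mu> *s p"
        by (simp add: vec_eq_iff forall_3 matrix_vector_mult_def mat_def sum_3)
      then show ?thesis
        by (simp add: matrix_vector_mult_diff_rdistrib vec_eq_iff forall_3 coef_matrix_mult algebra_simps)
    qed
    have b: "cmod \<xi> \<le> 20 * (Z * Z)" "cmod (- z) \<le> 20 * (Z * Z)" "cmod 0 \<le> 20 * (Z * Z)" "cmod (- 1) \<le> 20 * (Z * Z)"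
      "cmod (\<xi> - 1 + z) \<le> 20 * (Z * Z)"
      using that Z ZZ norm_triangle_ineq[of "\<xi> - 1" z] norm_triangle_ineq4[of \<xi> 1]
      unfolding mult.assoc norm_minus_cancel norm_zero norm_one by linarith+
    have "norm ((mat \<mu> - ?A) *v p - (\<mu> - \<xi>) *s p) \<le> 3 * (3 * (20 * (Z * Z)) * norm p)"
      unfolding e by (rule norm_vec3_le) (simp_all only: vector_3, (intro cmod_row_le b)+)
    also have "\<dots> \<le> 900 * Z * Z * norm p"
      using mult_right_mono[of "180 * (Z * Z)" "900 * (Z * Z)" "norm p"] ZZ by simp
    finally show ?thesis .
  qed
  have "splitting (mat \<mu> - ?A) \<beta>2 \<beta>3 ((900 * Z * Z) * (900 * Z * Z) / m)"
  proof (rule splittingI)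
    show "(mat \<mu> - ?A) *v ((mat \<mu> - ?A) *v ((mat \<mu> - ?A) *v p)) =
      (\<beta>2 + \<beta>3) *s ((mat \<mu> - ?A) *v ((mat \<mu> - ?A) *v p)) - (\<beta>2 * \<beta>3) *s ((mat \<mu> - ?A) *v p)" for p
      unfolding \<beta>2_def \<beta>3_def by (rule coef_matrix_cubic) (use c in auto)
    show "norm ((mat \<mu> - ?A) *v p - \<beta>2 *s p) \<le> 900 * Z * Z * norm p"
      "norm ((mat \<mu> - ?A) *v p - \<beta>3 *s p) \<le> 900 * Z * Z * norm p" for p
      unfolding \<beta>2_def \<beta>3_def using *[OF cb(1)] *[OF cb(2)] by auto
    show "m \<le> cmod \<beta>2" using \<beta>(1) complex_Re_le_cmod[of \<beta>2] by linarith
    show "1 \<le> 900 * Z * Z" using ZZ by simp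
  qed (use m in auto)
  moreover have "cmod \<beta>3 \<le> (900 * Z * Z) * (900 * Z * Z) / m"
  proof -
    have "cmod \<beta>3 \<le> 900 * Z * Z"
      using norm_triangle_ineq4[of \<mu> \<mu>3] cb Z ZZ unfolding \<beta>3_def mult.assoc by linarith
    also have "\<dots> \<le> (900 * Z * Z) * (900 * Z * Z) / m"
    proof -
      have "m \<le> 900 * Z * Z" using m ZZ by simp
      then have "(900 * Z * Z) * m \<le> (900 * Z * Z) * (900 * Z * Z)" using ZZ by (intro mult_left_mono) auto
      then show ?thesis using m by (simp only: pos_le_divide_eq)
    qed
    finally show ?thesis .
  qed
  ultimately show ?thesis using that \<beta> by blast
qed

lemma Amat0_mult:
  "(Amat0 v z *v p) $ 1 = z * p $ 2 + z * p $ 3"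
  "(Amat0 v z *v p) $ 2 = z * p $ 3"
  "(Amat0 v z *v p) $ 3 = of_real v * p $ 1 + of_real v * p $ 2 + (of_real (2 * v - 1) - z) * p $ 3"
  by (simp_all only: Amat0_def coef_matrix_mult)

text \<open>\<open>tail_bound\<close> after the reflection \<open>x \<mapsto> - x\<close>, with \<open>B = \<mu> - A\<close> and \<open>A\<close> the matrix at \<open>-\<infinity>\<close>. The
  point \<open>- X\<close> is chosen so that the perturbation, of size \<open>18 exp (- X)\<close>, is small enough.\<close>

lemma limit_tail_bound:
  fixes m Z :: real
  assumes m: "0 < m" "m \<le> 1" and Z: "1 \<le> Z"
  obtains X C where "0 \<le> X" "0 \<le> C"
    "\<And>z \<mu> L W. \<lbrakk>sole_growing_root 1 z \<mu>; m \<le> Re \<mu>; 0 \<le> Re z; cmod z \<le> Z; cmod \<mu> \<le> Z;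
       Amat0 1 z *v L = \<mu> *s L; solves (\<lambda>x. Amat0 (logistic x) z) W; asymp_exp \<mu> L at_bot W\<rbrakk>
       \<Longrightarrow> norm (W (- X)) \<le> C * norm L"
proof -
  define R where "R = (900 * Z * Z) * (900 * Z * Z) / m"
  have ZZ: "1 \<le> Z * Z" using Z mult_mono[of 1 Z 1 Z] by simp
  have R0: "0 \<le> R" unfolding R_def using m by (intro divide_nonneg_pos zero_le_square)
  define D where "D = 3 * R / 1 + 1"
  define k where "k = m / 2 / D"
  have D: "0 < D" using R0 by (simp add: D_def)
  then have k: "0 < k" "k * D \<le> m / 2" using m by (simp_all add: k_def)
  define X where "X = max 0 (- ln (k / 18))"
  have X0: "0 \<le> X" by (simp add: X_def)
  have kX: "18 * exp (- X) \<le> k"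
  proof -
    have "- X \<le> ln (k / 18)" by (simp add: X_def)
    then have "exp (- X) \<le> k / 18" using k by (metis exp_le_cancel_iff exp_ln half_gt_zero_iff divide_pos_pos zero_less_numeral)
    then show ?thesis by simp
  qed
  show thesis
  proof (rule that[OF X0, of "2 * R / m"])
    show "0 \<le> 2 * R / m" using R0 m by simp
    fix z \<mu> :: complex and L :: "complex^3" and W :: "real \<Rightarrow> complex^3"
    assume sole: "sole_growing_root 1 z \<mu>" and \<mu>: "m \<le> Re \<mu>" and z: "0 \<le> Re z" and b: "cmod z \<le> Z" "cmod \<mu> \<le> Z"
      and L: "Amat0 1 z *v L = \<mu> *s L" and W: "solves (\<lambda>x. Amat0 (logistic x) z) W" and as: "asymp_exp \<mu> L at_bot W"
    obtain \<beta>2 \<beta>3 where \<beta>: "splitting (mat \<mu> - coef_matrix 1 1 z) \<beta>2 \<beta>3 R" "m \<le> Re \<beta>2" "m \<le> Re \<beta>3" "cmod \<beta>3 \<le> R"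
      unfolding R_def by (rule coef_growing_splitting[OF sole m \<mu> z b Z])
    define B where "B = mat \<mu> - coef_matrix 1 1 z"
    have A1: "Amat0 1 z = coef_matrix 1 1 z" by (simp add: Amat0_def)
    have Bp: "B *v p = \<mu> *s p - Amat0 1 z *v p" for p
    proof -
      have "mat \<mu> *v p = \<mu> *s p"
        by (simp add: vec_eq_iff forall_3 matrix_vector_mult_def mat_def sum_3)
      then show ?thesis by (simp add: B_def A1 matrix_vector_mult_diff_rdistrib)
    qed
    define y where "y x = exp (\<mu> * of_real x) *s W (- x)" for x
    define e where "e x = Amat0 1 z *v y x - Amat0 (logistic (- x)) z *v y x" for x
    have dy: "(y has_vector_derivative (B *v y x + e x)) (at x)" for x
    proof -
      have "((W \<circ> uminus) has_vector_derivative (- 1) *\<^sub>R (Amat0 (logistic (- x)) z *v W (- x))) (at x)"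
        by (rule vector_diff_chain_at) (use W in \<open>auto intro!: derivative_eq_intros simp: solves_def\<close>)
      then have dW: "((\<lambda>x. W (- x)) has_vector_derivative - (Amat0 (logistic (- x)) z *v W (- x))) (at x)"
        by (simp add: o_def)
      have "((\<lambda>x. exp (\<mu> * complex_of_real x)) has_vector_derivative \<mu> * exp (\<mu> * complex_of_real x)) (at x)"
        using has_vector_derivative_cexp[of \<mu> 0] by simp
      from has_vector_derivative_smult[OF this dW] show ?thesis
        unfolding y_def[abs_def]
        by (rule has_vector_derivative_eq_rhs)
          (simp add: Bp e_def y_def vector_scalar_commute vec_eq_iff algebra_simps)
    qed
    have "((\<lambda>x. exp (- \<mu> * of_real (- x)) *s W (- x)) \<longlongrightarrow> L) at_top"
      using as unfolding asymp_exp_def by (rule filterlim_compose[OF _ filterlim_uminus_at_bot_at_top])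
    then have yL: "(y \<longlongrightarrow> L) at_top" by (simp add: y_def[abs_def])
    have BL: "B *v L = 0" by (simp add: Bp L)
    have ne: "norm (e x) \<le> k * exp (- 1 * (x - X)) * norm (y x)" if x: "X \<le> x" for x
    proof -
      define d where "d = 1 - logistic (- x)"
      have d: "0 \<le> d" "d \<le> exp (- x)" using logistic_bounds[of "- x"] by (auto simp: d_def)
      have e3: "e x = vector [0 * y x $ 1 + 0 * y x $ 2 + 0 * y x $ 3, 0 * y x $ 1 + 0 * y x $ 2 + 0 * y x $ 3,
        of_real d * y x $ 1 + of_real d * y x $ 2 + of_real (2 * d) * y x $ 3]"
        by (simp add: e_def vec_eq_iff forall_3 Amat0_mult d_def algebra_simps)
      have "cmod 0 \<le> 2 * d" "cmod (of_real d) \<le> 2 * d" "cmod (of_real (2 * d)) \<le> 2 * d" using d by simp_all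
      then have "norm (e x) \<le> 3 * (3 * (2 * d) * norm (y x))"
        unfolding e3 by (intro norm_vec3_le) (simp_all only: vector_3, (intro cmod_row_le; assumption)+)
      also have "\<dots> = 18 * d * norm (y x)" by simp
      also have "\<dots> \<le> 18 * exp (- x) * norm (y x)" using d by (intro mult_right_mono) auto
      also have "\<dots> = 18 * exp (- X) * exp (- 1 * (x - X)) * norm (y x)" by (simp flip: exp_add)
      also have "\<dots> \<le> k * exp (- 1 * (x - X)) * norm (y x)" using kX by (intro mult_right_mono) auto
      finally show ?thesis .
    qed
    have "norm (y X) \<le> 2 * R / m * norm L"
      by (rule tail_bound[OF \<beta>(1)[folded B_def] _ _ m(1) \<beta>(3,4) dy ne _ _ k(2)[unfolded D_def] yL BL order_refl])
        (use \<beta> m k in auto)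
    moreover have "norm (W (- X)) \<le> norm (y X)"
    proof -
      have "1 * norm (W (- X)) \<le> exp (Re \<mu> * X) * norm (W (- X))"
        using \<mu> m X0 by (intro mult_right_mono) auto
      then show ?thesis by (simp add: y_def norm_smult_vec)
    qed
    ultimately show "norm (W (- X)) \<le> 2 * R / m * norm L" by linarith
  qed
qed

lemma Amat0_bound:
  assumes "0 \<le> v" "v \<le> 1"
  shows "cmod (Amat0 v z $ i $ j) \<le> cmod z + 1"
proof -
  have "cmod (of_real (2 * v - 1) - z) \<le> cmod (complex_of_real (2 * v - 1)) + cmod z" by (rule norm_triangle_ineq4)
  also have "cmod (complex_of_real (2 * v - 1)) \<le> 1" unfolding norm_of_real using assms by simp
  finally have "cmod (of_real (2 * v - 1) - z) \<le> cmod z + 1" by simp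
  then show ?thesis
    using assms exhaust_3[of i] exhaust_3[of j] by (auto simp: Amat0_def coef_matrix_def add_increasing)
qed

lemma limit_solution_crude_growth:
  assumes W: "solves (\<lambda>x. Amat0 (logistic x) z) W" and z: "cmod z \<le> Z" and X: "0 \<le> X"
  shows "norm (W 0) \<le> exp (9 * (Z + 1) * X) * norm (W (- X))"
proof -
  let ?A = "\<lambda>x. Amat0 (logistic x) z"
  have d: "((\<lambda>x. (norm (W x))\<^sup>2) has_real_derivative 2 * inner (W x) (?A x *v W x)) (at x)" for x
    using W by (intro norm_sq_has_real_derivative) (simp add: solves_def)
  have le: "2 * inner (W x) (?A x *v W x) \<le> (2 * (9 * (Z + 1))) * (norm (W x))\<^sup>2" for x
  proof -
    have "norm (?A x *v W x) \<le> 9 * (cmod z + 1) * norm (W x)"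
      by (rule matrix_norm_bound, rule Amat0_bound) (use logistic_bounds[of x] in auto)
    also have "\<dots> \<le> 9 * (Z + 1) * norm (W x)" using z by (intro mult_right_mono) auto
    finally have "norm (W x) * norm (?A x *v W x) \<le> norm (W x) * (9 * (Z + 1) * norm (W x))"
      by (rule mult_left_mono) simp
    then have "inner (W x) (?A x *v W x) \<le> norm (W x) * (9 * (Z + 1) * norm (W x))"
      using norm_cauchy_schwarz order_trans by blast
    then have "2 * inner (W x) (?A x *v W x) \<le> 2 * (norm (W x) * (9 * (Z + 1) * norm (W x)))"
      by (rule mult_left_mono) simp
    also have "\<dots> = (2 * (9 * (Z + 1))) * (norm (W x))\<^sup>2" by (simp only: power2_eq_square mult_ac)
    finally show ?thesis .
  qed
  have "(norm (W 0))\<^sup>2 \<le> (norm (W (- X)))\<^sup>2 * exp ((2 * (9 * (Z + 1))) * 0 - (2 * (9 * (Z + 1))) * (- X))"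
    by (rule gronwall_forward[OF _ d _ le]) (use X in \<open>auto intro!: derivative_eq_intros\<close>)
  also have "\<dots> = (exp (9 * (Z + 1) * X) * norm (W (- X)))\<^sup>2"
    using exp_of_nat_mult[of 2 "9 * (Z + 1) * X"] unfolding power_mult_distrib by (simp add: mult_ac)
  finally show ?thesis by (rule power2_le_imp_le) simp
qed

text \<open>Young's inequality for the cross terms in \<open>limit_solution_forward\<close>, where \<open>h = exp (- x / 4)\<close>; the
  weights are balanced so that every term gains a factor \<open>h\<close>.\<close>

lemma forward_energy_estimate:
  fixes h a b c z :: real
  assumes h: "0 < h" "h \<le> 1" and nn: "0 \<le> a" "0 \<le> b" "0 \<le> c" "0 \<le> z" "z \<le> Z"
  shows "2 * h^4 * a * (z * (b + c)) + 2 * b * (z * c) + 4 * h^4 * (c\<^sup>2 / h\<^sup>2) + 2 / h\<^sup>2 * c * (h^4 * (a + b))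
    \<le> (6 + 3 * Z) * h * (h^4 * a\<^sup>2 + b\<^sup>2 + c\<^sup>2 / h\<^sup>2)"
proof -
  define \<alpha> where "\<alpha> = h\<^sup>2 * a"
  define \<zeta> where "\<zeta> = c / h"
  define N where "N = \<alpha>\<^sup>2 + b\<^sup>2 + \<zeta>\<^sup>2"
  have c: "c = h * \<zeta>" using h by (simp add: \<zeta>_def)
  have pos: "0 \<le> \<alpha>" "0 \<le> \<zeta>" using nn h by (simp_all add: \<alpha>_def \<zeta>_def)
  have N: "2 * (\<alpha> * \<zeta>) \<le> N" "2 * (\<alpha> * b) \<le> N" "2 * (b * \<zeta>) \<le> N" "\<zeta>\<^sup>2 \<le> N" "0 \<le> N"
    using sum_squares_bound[of \<alpha> \<zeta>] sum_squares_bound[of \<alpha> b] sum_squares_bound[of b \<zeta>]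
      zero_le_power2[of \<alpha>] zero_le_power2[of b] zero_le_power2[of \<zeta>] unfolding N_def by linarith+
  have hp: "h\<^sup>2 \<le> h" "h^3 \<le> h" "h^4 \<le> h"
    using h power_decreasing[of 1 2 h] power_decreasing[of 1 3 h] power_decreasing[of 1 4 h] by auto
  have t1: "2 * h^4 * a * (z * (b + c)) \<le> 2 * (Z * (h * N))"
  proof -
    have "2 * h^4 * a * (z * (b + c)) = z * (h\<^sup>2 * (2 * (\<alpha> * b))) + z * (h^3 * (2 * (\<alpha> * \<zeta>)))"
      by (simp add: \<alpha>_def c algebra_simps power4_eq_xxxx power3_eq_cube power2_eq_square)
    also have "\<dots> \<le> Z * (h * N) + Z * (h * N)" using N h hp nn pos by (intro add_mono mult_mono) auto
    finally show ?thesis by (simp only: mult_2)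
  qed
  have t2: "2 * b * (z * c) \<le> Z * (h * N)"
  proof -
    have "2 * b * (z * c) = z * (h * (2 * (b * \<zeta>)))" by (simp add: c)
    also have "\<dots> \<le> Z * (h * N)" using N h nn pos by (intro mult_mono) auto
    finally show ?thesis .
  qed
  have t3: "4 * h^4 * (c\<^sup>2 / h\<^sup>2) \<le> 4 * (h * N)"
  proof -
    have "4 * h^4 * (c\<^sup>2 / h\<^sup>2) = 4 * (h^4 * \<zeta>\<^sup>2)" by (simp add: \<zeta>_def power_divide)
    also have "\<dots> \<le> 4 * (h * N)" using N h hp by (intro mult_left_mono mult_mono) auto
    finally show ?thesis .
  qed
  have t4: "2 / h\<^sup>2 * c * (h^4 * (a + b)) \<le> 2 * (h * N)"
  proof -
    have "2 / h\<^sup>2 * c * (h^4 * (a + b)) = h * (2 * (\<alpha> * \<zeta>)) + h^3 * (2 * (b * \<zeta>))"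
      using h by (simp add: \<alpha>_def c field_simps power4_eq_xxxx power3_eq_cube power2_eq_square)
    also have "\<dots> \<le> h * N + h * N" using N h hp nn pos by (intro add_mono mult_mono) auto
    finally show ?thesis by (simp only: mult_2)
  qed
  have "h^4 * a\<^sup>2 + b\<^sup>2 + c\<^sup>2 / h\<^sup>2 = N"
    using h by (simp add: N_def \<alpha>_def \<zeta>_def power_divide power_mult_distrib)
  moreover have "2 * h^4 * a * (z * (b + c)) + 2 * b * (z * c) + 4 * h^4 * (c\<^sup>2 / h\<^sup>2) + 2 / h\<^sup>2 * c * (h^4 * (a + b))
    \<le> (6 + 3 * Z) * (h * N)"
    using add_mono[OF add_mono[OF add_mono[OF t1 t2] t3] t4] by (simp add: algebra_simps)
  ultimately show ?thesis by (simp add: mult.assoc)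
qed

text \<open>As \<open>x \<rightarrow> \<infinity>\<close> the profile vanishes, the third component is damped, and the first may grow
  linearly. The energy \<open>N\<close> allows this growth through the weight \<open>exp (- x)\<close> and expects decay of the
  third component through \<open>exp (x / 2)\<close>. It satisfies \<open>N' \<le> (6 + 3 Z) exp (- x / 4) N\<close>, hence is
  bounded, and the second component, whose derivative is \<open>z\<close> times the third, converges.\<close>

lemma limit_solution_forward:
  fixes W :: "real \<Rightarrow> complex^3"
  assumes W: "solves (\<lambda>x. Amat0 (logistic x) z) W" and z: "0 \<le> Re z" "cmod z \<le> Z"
  defines "P \<equiv> exp (2 * (6 + 3 * Z)) * norm (W 0)"
  obtains l where "\<And>x. 0 \<le> x \<Longrightarrow> cmod (W x $ 1) \<le> P * exp (x / 2)"
    "\<And>x. 0 \<le> x \<Longrightarrow> cmod (W x $ 3) \<le> P * exp (- (1 / 4) * x)"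
    "((\<lambda>x. W x $ 2) \<longlongrightarrow> l) at_top"
    "\<And>x. 0 \<le> x \<Longrightarrow> cmod (W x $ 2 - l) \<le> 4 * Z * P * exp (- (1 / 4) * x)"
proof -
  have Z0: "0 \<le> Z" using z norm_ge_zero order_trans by blast
  define w1 where "w1 x = W x $ 1" for x
  define w2 where "w2 x = W x $ 2" for x
  define w3 where "w3 x = W x $ 3" for x
  define v where "v = logistic"
  define d3 where "d3 x = of_real (v x) * w1 x + of_real (v x) * w2 x + (of_real (2 * v x - 1) - z) * w3 x" for x
  have dW: "((\<lambda>x. W x $ i) has_vector_derivative (Amat0 (logistic x) z *v W x) $ i) (at x)" for x i
    using W by (intro has_vector_derivative_vec_nth) (simp add: solves_def)
  have d1: "(w1 has_vector_derivative (z * w2 x + z * w3 x)) (at x)"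
    and d2: "(w2 has_vector_derivative (z * w3 x)) (at x)"
    and d3: "(w3 has_vector_derivative d3 x) (at x)" for x
    using dW[of 1 x] dW[of 2 x] dW[of 3 x]
    by (simp_all only: Amat0_mult w1_def[abs_def] w2_def[abs_def] w3_def[abs_def] d3_def v_def)
  define N where "N x = exp (- x) * (cmod (w1 x))\<^sup>2 + (cmod (w2 x))\<^sup>2 + exp (x / 2) * (cmod (w3 x))\<^sup>2" for x
  define N' where "N' x = (- exp (- x) * (cmod (w1 x))\<^sup>2 + 2 * inner (w1 x) (z * w2 x + z * w3 x) * exp (- x))
    + 2 * inner (w2 x) (z * w3 x)
    + (exp (x / 2) / 2 * (cmod (w3 x))\<^sup>2 + 2 * inner (w3 x) (d3 x) * exp (x / 2))" for x
  have dN: "(N has_real_derivative N' x) (at x)" for x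
    unfolding N_def N'_def
    by (intro DERIV_add DERIV_mult norm_sq_has_real_derivative d1 d2 d3) (auto intro!: derivative_eq_intros)
  have inner_c: "inner p (\<beta> * p) = Re \<beta> * (cmod p)\<^sup>2" for p \<beta> :: complex
    unfolding cmod_power2 by (simp add: inner_complex_def algebra_simps power2_eq_square)
  have inner_le: "inner p q \<le> cmod p * cmod q" for p q :: complex
    by (rule norm_cauchy_schwarz)
  have key: "N' x \<le> (6 + 3 * Z) * exp (- (1 / 4) * x) * N x" if x: "0 \<le> x" for x
  proof -
    define h where "h = exp (- (1 / 4) * x)"
    have h: "0 < h" "h \<le> 1" using x by (auto simp: h_def)
    have h2: "h\<^sup>2 = exp (- (x / 2))" using exp_of_nat_mult[of 2 "- (1 / 4) * x"] by (simp add: h_def)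
    have "exp (of_nat 4 * (- (1 / 4) * x)) = h^4" unfolding h_def by (rule exp_of_nat_mult)
    then have h4: "exp (- x) = h^4" by simp
    have "exp (x / 2) * h\<^sup>2 = 1" unfolding h2 by (simp flip: exp_add)
    then have "exp (x / 2) = 1 / h\<^sup>2" using h(1) by (simp add: eq_divide_eq)
    note hh = h4 this
    define a b c where "a = cmod (w1 x)" and "b = cmod (w2 x)" and "c = cmod (w3 x)"
    have nn: "0 \<le> a" "0 \<le> b" "0 \<le> c" by (simp_all add: a_def b_def c_def)
    have v: "0 \<le> v x" "v x \<le> h^4" using logistic_bounds[of x] hh by (auto simp: v_def)
    have i1: "inner (w1 x) (z * w2 x + z * w3 x) \<le> a * (cmod z * (b + c))"
    proof -
      have "cmod (z * w2 x + z * w3 x) \<le> cmod z * (b + c)"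
        using norm_triangle_ineq[of "z * w2 x" "z * w3 x"] by (simp add: b_def c_def norm_mult distrib_left)
      then have "cmod (w1 x) * cmod (z * w2 x + z * w3 x) \<le> a * (cmod z * (b + c))"
        unfolding a_def by (rule mult_left_mono) simp
      then show ?thesis using inner_le[of "w1 x" "z * w2 x + z * w3 x"] by linarith
    qed
    have i2: "inner (w2 x) (z * w3 x) \<le> b * (cmod z * c)"
      using inner_le[of "w2 x" "z * w3 x"] by (simp add: b_def c_def norm_mult)
    have i3: "inner (w3 x) (d3 x) \<le> c * (h^4 * (a + b)) + (2 * h^4 - 1) * c\<^sup>2"
    proof -
      have "inner (w3 x) (of_real (v x) * w1 x + of_real (v x) * w2 x) \<le> c * (h^4 * (a + b))"
      proof -
        have "cmod (of_real (v x) * w1 x + of_real (v x) * w2 x) \<le> v x * (a + b)"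
          using norm_triangle_ineq[of "of_real (v x) * w1 x" "of_real (v x) * w2 x"] v
          by (simp add: a_def b_def norm_mult distrib_left)
        also have "\<dots> \<le> h^4 * (a + b)" using v nn by (intro mult_right_mono) auto
        finally have "cmod (w3 x) * cmod (of_real (v x) * w1 x + of_real (v x) * w2 x) \<le> c * (h^4 * (a + b))"
          unfolding c_def by (rule mult_left_mono) simp
        then show ?thesis using inner_le order_trans by blast
      qed
      moreover have "inner (w3 x) ((of_real (2 * v x - 1) - z) * w3 x) \<le> (2 * h^4 - 1) * c\<^sup>2"
        unfolding inner_c c_def using v z by (intro mult_right_mono) auto
      ultimately show ?thesis by (simp add: d3_def inner_add_right)
    qed
    have "N' x \<le> (0 + 2 * (a * (cmod z * (b + c))) * exp (- x)) + 2 * (b * (cmod z * c))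
      + (exp (x / 2) / 2 * c\<^sup>2 + 2 * (c * (h^4 * (a + b)) + (2 * h^4 - 1) * c\<^sup>2) * exp (x / 2))"
      unfolding N'_def c_def[symmetric]
      by (intro add_mono mult_right_mono mult_left_mono i1 i2 i3 order_refl) auto
    also have "\<dots> = 2 * h^4 * a * (cmod z * (b + c)) + 2 * b * (cmod z * c) + 4 * h^4 * (c\<^sup>2 / h\<^sup>2)
        + 2 / h\<^sup>2 * c * (h^4 * (a + b)) - 3 / 2 * (c\<^sup>2 / h\<^sup>2)"
    proof -
      define i where "i = 1 / h\<^sup>2"
      have i: "c\<^sup>2 / h\<^sup>2 = c\<^sup>2 * i" "2 / h\<^sup>2 = 2 * i" "exp (x / 2) = i" by (simp_all add: i_def hh)
      show ?thesis unfolding i hh(1) by (simp add: algebra_simps)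
    qed
    also have "\<dots> \<le> 2 * h^4 * a * (cmod z * (b + c)) + 2 * b * (cmod z * c) + 4 * h^4 * (c\<^sup>2 / h\<^sup>2)
        + 2 / h\<^sup>2 * c * (h^4 * (a + b))" by simp
    also have "\<dots> \<le> (6 + 3 * Z) * h * (h^4 * a\<^sup>2 + b\<^sup>2 + c\<^sup>2 / h\<^sup>2)"
      by (rule forward_energy_estimate) (use h nn z in auto)
    also have "h^4 * a\<^sup>2 + b\<^sup>2 + c\<^sup>2 / h\<^sup>2 = N x"
      unfolding N_def hh by (simp add: a_def b_def c_def)
    finally show ?thesis by (simp add: h_def)
  qed
  have N0: "N 0 = (norm (W 0))\<^sup>2"
    by (simp add: N_def w1_def w2_def w3_def norm_vec_def L2_set_def sum_3)
  have Nx: "N x \<le> P\<^sup>2" if x: "0 \<le> x" for x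
  proof -
    have "N x \<le> N 0 * exp (- 4 * (6 + 3 * Z) * exp (- (1 / 4) * x) - - 4 * (6 + 3 * Z) * exp (- (1 / 4) * 0))"
    proof (rule gronwall_forward[OF x dN _ key])
      show "((\<lambda>b. - 4 * (6 + 3 * Z) * exp (- (1 / 4) * b)) has_real_derivative (6 + 3 * Z) * exp (- (1 / 4) * y)) (at y)" for y
        by (auto intro!: derivative_eq_intros simp: field_simps)
    qed auto
    also have "\<dots> \<le> N 0 * exp (4 * (6 + 3 * Z))"
    proof (intro mult_left_mono)
      have "0 \<le> 4 * (6 + 3 * Z) * exp (- (1 / 4) * x)" using Z0 by simp
      moreover have "- 4 * (6 + 3 * Z) * exp (- (1 / 4) * x) - - 4 * (6 + 3 * Z) * exp (- (1 / 4) * 0)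
          = 4 * (6 + 3 * Z) - 4 * (6 + 3 * Z) * exp (- (1 / 4) * x)"
        by (simp add: algebra_simps)
      ultimately show "exp (- 4 * (6 + 3 * Z) * exp (- (1 / 4) * x) - - 4 * (6 + 3 * Z) * exp (- (1 / 4) * 0)) \<le> exp (4 * (6 + 3 * Z))"
        by (simp only: exp_le_cancel_iff diff_le_eq le_add_same_cancel1)
    qed (simp add: N0)
    also have "\<dots> = P\<^sup>2"
      using exp_of_nat_mult[of 2 "2 * (6 + 3 * Z)"] unfolding N0 P_def power_mult_distrib
      by (simp add: mult.commute)
    finally show ?thesis .
  qed
  have P0: "0 \<le> P" by (simp add: P_def)
  have w1P: "cmod (w1 x) \<le> P * exp (x / 2)" if x: "0 \<le> x" for x
  proof (rule power2_le_imp_le)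
    have "exp (- x) * (cmod (w1 x))\<^sup>2 \<le> N x" by (simp add: N_def)
    also have "\<dots> \<le> P\<^sup>2" by (rule Nx[OF x])
    finally have "exp x * (exp (- x) * (cmod (w1 x))\<^sup>2) \<le> exp x * P\<^sup>2" by (rule mult_left_mono) simp
    moreover have "exp x * (exp (- x) * (cmod (w1 x))\<^sup>2) = (cmod (w1 x))\<^sup>2"
      by (simp flip: mult.assoc exp_add)
    moreover have "(exp (x / 2))\<^sup>2 = exp x" using exp_of_nat_mult[of 2 "x / 2"] by simp
    ultimately show "(cmod (w1 x))\<^sup>2 \<le> (P * exp (x / 2))\<^sup>2"
      unfolding power_mult_distrib by (simp only: mult.commute)
  qed (use P0 in simp)
  have w3P: "cmod (w3 x) \<le> P * exp (- (1 / 4) * x)" if x: "0 \<le> x" for x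
  proof (rule power2_le_imp_le)
    have "exp (x / 2) * (cmod (w3 x))\<^sup>2 \<le> N x" by (simp add: N_def)
    also have "\<dots> \<le> P\<^sup>2" by (rule Nx[OF x])
    finally have "exp (- (x / 2)) * (exp (x / 2) * (cmod (w3 x))\<^sup>2) \<le> exp (- (x / 2)) * P\<^sup>2" by (rule mult_left_mono) simp
    moreover have "exp (- (x / 2)) * (exp (x / 2) * (cmod (w3 x))\<^sup>2) = (cmod (w3 x))\<^sup>2"
      by (simp flip: mult.assoc exp_add)
    moreover have "(exp (- (1 / 4) * x))\<^sup>2 = exp (- (x / 2))" using exp_of_nat_mult[of 2 "- (1 / 4) * x"] by simp
    ultimately show "(cmod (w3 x))\<^sup>2 \<le> (P * exp (- (1 / 4) * x))\<^sup>2"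
      unfolding power_mult_distrib by (simp only: mult.commute)
  qed (use P0 in simp)
  have "norm (z * w3 x) \<le> (Z * P) * exp (- (1 / 4) * x)" if x: "0 \<le> x" for x
    unfolding norm_mult mult.assoc using z w3P[OF x] Z0 by (intro mult_mono) auto
  from exp_small_derivative_converges[OF d2 this] obtain l where l: "(w2 \<longlongrightarrow> l) at_top"
    "\<And>x. 0 \<le> x \<Longrightarrow> norm (w2 x - l) \<le> Z * P / (1 / 4) * exp (- (1 / 4) * x)"
    by (metis zero_less_divide_1_iff zero_less_numeral)
  show ?thesis
    by (rule that[of l]) (use w1P w3P l in \<open>simp_all add: w1_def w2_def[abs_def] w3_def mult_ac\<close>)
qed

text \<open>As for the decaying adjoint solution: the difference has the asymptotic vector \<open>0\<close>, so it vanishes at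
  some point by \<open>limit_tail_bound\<close>.\<close>

lemma limit_solution_unique:
  assumes sole: "sole_growing_root 1 z \<mu>" "0 < Re \<mu>" and z: "0 \<le> Re z"
    and W1: "solves (\<lambda>x. Amat0 (logistic x) z) W1" "asymp_exp \<mu> V at_bot W1"
    and W2: "solves (\<lambda>x. Amat0 (logistic x) z) W2" "asymp_exp \<mu> V at_bot W2"
  shows "W1 x = W2 x"
proof -
  define U where "U x = W1 x - W2 x" for x
  have U: "solves (\<lambda>x. Amat0 (logistic x) z) U"
    using solves_diff_smult[OF W1(1) W2(1), of 1] by (simp add: U_def[abs_def])
  have U0: "asymp_exp \<mu> 0 at_bot U"
    using asymp_exp_diff[OF W1(2) W2(2)] by (simp add: U_def[abs_def])
  define Z where "Z = 1 + cmod z + cmod \<mu>"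
  have Z: "1 \<le> Z" "cmod z \<le> Z" "cmod \<mu> \<le> Z" by (auto simp: Z_def)
  have m: "0 < min 1 (Re \<mu>)" "min 1 (Re \<mu>) \<le> 1" "min 1 (Re \<mu>) \<le> Re \<mu>" using sole by auto
  obtain X C where "0 \<le> X" "0 \<le> C" and *: "\<And>z \<mu>' L W. \<lbrakk>sole_growing_root 1 z \<mu>'; min 1 (Re \<mu>) \<le> Re \<mu>'; 0 \<le> Re z; cmod z \<le> Z; cmod \<mu>' \<le> Z;
       Amat0 1 z *v L = \<mu>' *s L; solves (\<lambda>x. Amat0 (logistic x) z) W; asymp_exp \<mu>' L at_bot W\<rbrakk>
       \<Longrightarrow> norm (W (- X)) \<le> C * norm L"
    using limit_tail_bound[OF m(1,2) Z(1)] by blast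
  from *[OF sole(1) m(3) z Z(2,3) _ U U0] have "U (- X) = 0" by simp
  have "U x = 0"
    by (rule bounded_solves_zero[OF U Amat0_bound \<open>U (- X) = 0\<close>]) (use logistic_bounds in \<open>auto simp: less_imp_le\<close>)
  then show ?thesis by (simp add: U_def)
qed

text \<open>The derivative of the first component carries the factor \<open>logistic x \<le> exp (- x)\<close>.\<close>

lemma limit_adjoint_first_component_decay:
  fixes Y :: "real \<Rightarrow> complex^3"
  assumes Y: "solves (\<lambda>x. - cadj (Amat0 (logistic x) z)) Y" and lim: "(Y \<longlongrightarrow> L) at_top" and L: "L $ 1 = 0"
  obtains M where "\<And>x. 0 \<le> x \<Longrightarrow> cmod (Y x $ 1) \<le> M * exp (- x)"
proof -
  have dY: "((\<lambda>x. cnj (Y x $ 1)) has_vector_derivative (- of_real (logistic x) * cnj (Y x $ 3))) (at x)" for x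
    using adjoint_components(1)[of logistic "\<lambda>x. 2 * logistic x - 1" z Y x] Y by (simp add: Amat0_def)
  have "isCont Y x" for x
    using Y unfolding solves_def by (blast intro: has_vector_derivative_continuous)
  then obtain M where M: "\<And>x. 0 \<le> x \<Longrightarrow> norm (Y x) \<le> M" using bounded_on_ray[OF _ lim, of 0] by blast
  have "norm (- of_real (logistic x) * cnj (Y x $ 3)) \<le> M * exp (- 1 * x)" if "0 \<le> x" for x
  proof -
    have "cmod (Y x $ 3) \<le> M" using Finite_Cartesian_Product.norm_nth_le[of "Y x" 3] M[OF that] by linarith
    then have "\<bar>logistic x\<bar> * cmod (Y x $ 3) \<le> exp (- x) * M"
      using logistic_bounds[of x] by (intro mult_mono) auto
    then show ?thesis by (simp add: norm_mult mult.commute)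
  qed
  from exp_small_derivative_converges[OF dY this zero_less_one] obtain l where
    l: "((\<lambda>x. cnj (Y x $ 1)) \<longlongrightarrow> l) at_top" "\<And>x. 0 \<le> x \<Longrightarrow> norm (cnj (Y x $ 1) - l) \<le> M / 1 * exp (- 1 * x)"
    by blast
  have "((\<lambda>x. cnj (Y x $ 1)) \<longlongrightarrow> cnj (L $ 1)) at_top" by (intro tendsto_cnj tendsto_vec_nth lim)
  with l(1) have "l = 0" using L by (metis tendsto_unique trivial_limit_at_top_linorder complex_cnj_zero)
  then have "cmod (Y x $ 1) \<le> M * exp (- x)" if "0 \<le> x" for x using l(2)[OF that] by simp
  then show ?thesis by (rule that)
qed

text \<open>The pairing is constant, so it equals its limit as \<open>x \<rightarrow> \<infinity>\<close>. The first components contribute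
  \<open>O(exp (- x / 2))\<close>, the third ones tend to zero, and the second ones give \<open>- l\<close>.\<close>

lemma limit_shock_evans_value:
  fixes W Y :: "real \<Rightarrow> complex^3"
  assumes W: "solves (\<lambda>x. Amat0 (logistic x) z) W" and Y: "solves (\<lambda>x. - cadj (Amat0 (logistic x) z)) Y"
    and lim: "(Y \<longlongrightarrow> vector [0, - 1, c]) at_top"
    and W1: "\<And>x. 0 \<le> x \<Longrightarrow> cmod (W x $ 1) \<le> P * exp (x / 2)"
    and W3: "\<And>x. 0 \<le> x \<Longrightarrow> cmod (W x $ 3) \<le> P * exp (- (1 / 4) * x)"
    and W2: "((\<lambda>x. W x $ 2) \<longlongrightarrow> l) at_top"
  shows "cdot (W 0) (Y 0) = - l"
proof -
  note decay = exp_decay_at_top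
  obtain M where M: "\<And>x. 0 \<le> x \<Longrightarrow> cmod (Y x $ 1) \<le> M * exp (- x)"
    using limit_adjoint_first_component_decay[OF Y lim] by auto
  have bound1: "norm (W x $ 1 * cnj (Y x $ 1)) \<le> (P * M) * exp (- (1 / 2) * x)" if x: "0 \<le> x" for x
  proof -
    have "norm (W x $ 1 * cnj (Y x $ 1)) \<le> (P * exp (x / 2)) * (M * exp (- x))"
      unfolding norm_mult complex_mod_cnj
      using W1[OF x] M[OF x] order_trans[OF norm_ge_zero W1[OF x]] by (intro mult_mono) auto
    also have "\<dots> = (P * M) * (exp (x / 2) * exp (- x))" by simp
    also have "exp (x / 2) * exp (- x) = exp (- (1 / 2) * x)" by (simp flip: exp_add)
    finally show ?thesis .
  qed
  have 1: "((\<lambda>x. W x $ 1 * cnj (Y x $ 1)) \<longlongrightarrow> 0) at_top"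
    by (rule Lim_null_comparison[OF eventually_at_top_linorderI[of 0] decay[of "1 / 2" "P * M"]])
      (use bound1 in auto)
  have w3: "((\<lambda>x. W x $ 3) \<longlongrightarrow> 0) at_top"
    by (rule Lim_null_comparison[OF eventually_at_top_linorderI[of 0] decay[of "1 / 4" P]]) (use W3 in auto)
  have Yi: "((\<lambda>x. cnj (Y x $ i)) \<longlongrightarrow> cnj ((vector [0, - 1, c] :: complex^3) $ i)) at_top" for i :: 3
    by (intro tendsto_cnj tendsto_vec_nth lim)
  have "((\<lambda>x. W x $ 1 * cnj (Y x $ 1) + W x $ 2 * cnj (Y x $ 2) + W x $ 3 * cnj (Y x $ 3)) \<longlongrightarrow>
      0 + l * cnj ((vector [0, - 1, c] :: complex^3) $ 2) + 0 * cnj ((vector [0, - 1, c] :: complex^3) $ 3)) at_top"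
    by (intro tendsto_add tendsto_mult 1 W2 w3 Yi)
  moreover have "W x $ 1 * cnj (Y x $ 1) + W x $ 2 * cnj (Y x $ 2) + W x $ 3 * cnj (Y x $ 3) = cdot (W 0) (Y 0)" for x
    using cdot_solutions_constant[OF W Y, of x] by (simp add: cdot_def sum_3)
  ultimately show ?thesis by (simp add: tendsto_const_iff)
qed

section \<open>The outflow limit\<close>

text \<open>After translation to \<open>\<tau> = t v0\<close>, the quantity \<open>c_out D0_out\<close> is
  \<open>- (W \<tau> $ 2) - \<rho> * (W \<tau> $ 3)\<close> with \<open>\<rho> = z / (z + v0 (1 - v0))\<close>. Since \<open>|\<rho>| \<le> 1\<close> on the right half-plane
  (also at \<open>z = 0\<close>, where \<open>\<rho> = 0\<close>), this tends to \<open>- l\<close> as \<open>\<tau> \<rightarrow> \<infinity>\<close>, uniformly.\<close>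

lemma outflow_limit:
  fixes K :: "complex set"
  assumes K: "compact K" "K \<subseteq> RHP"
    and vh0: "\<And>v0. 0 < v0 \<Longrightarrow> v0 < 1 \<Longrightarrow> profile0 v0 (vh0 v0)"
    and V0: "limit_eigendata \<mu>0 V0"
    and Wout: "\<And>v0. 0 < v0 \<Longrightarrow> v0 < 1 \<Longrightarrow> limit_solution (vh0 v0) \<mu>0 V0 (Wout v0)"
    and vc0: "vc0 0 = 1 / 2"
             "\<And>v0. 0 < v0 \<Longrightarrow> v0 < 1 \<Longrightarrow> translate_of vc0 (vh0 v0)"
    and W0m: "limit_solution vc0 \<mu>0 V0 W0m"
    and W0p: "limit_adjoint_solution vc0 W0p"
  shows "\<exists>c_out :: complex \<Rightarrow> real \<Rightarrow> complex.
     (\<forall>v0. 0 < v0 \<and> v0 < 1 \<longrightarrow>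
        (\<lambda>z. c_out z v0) analytic_on RHP \<and> (\<forall>z\<in>RHP. c_out z v0 \<noteq> 0)) \<and>
     uniform_limit K
       (\<lambda>v0 z. c_out z v0 * D0_out (vh0 v0) (Wout v0) z)
       (\<lambda>z. D_shock W0m W0p z)
       (at_right 0)"
proof -
  have vc: "vc0 = logistic"
  proof
    obtain s where s: "\<And>x. vc0 x = vh0 (1 / 2) (x + s)" using vc0(2)[of "1 / 2"] by (auto simp: translate_of_def)
    have "(vc0 has_real_derivative vc0 x * (vc0 x - 1)) (at x)" for x
    proof -
      have "(vh0 (1 / 2) has_real_derivative vh0 (1 / 2) (x + s) * (vh0 (1 / 2) (x + s) - 1)) (at (x + s))"
        using vh0[of "1 / 2"] by (simp add: profile0_def)
      then show ?thesis unfolding DERIV_shift s[symmetric] by (simp add: s[abs_def])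
    qed
    then show "vc0 x = logistic x" for x unfolding logistic_def using vc0(1) by (rule logistic_solution)
  qed
  define t where "t v0 = (SOME t. \<forall>x. vh0 v0 x = logistic (x + t))" for v0
  have t: "vh0 v0 x = logistic (x + t v0)" if v0: "0 < v0" "v0 < 1" for v0 x
  proof -
    obtain s where "\<And>x. vc0 x = vh0 v0 (x + s)" using vc0(2)[OF v0] by (auto simp: translate_of_def)
    then have "\<forall>x. vh0 v0 x = logistic (x + (- s))" unfolding vc by simp
    then have "\<exists>t. \<forall>x. vh0 v0 x = logistic (x + t)" by blast
    then have "\<forall>x. vh0 v0 x = logistic (x + t v0)" unfolding t_def by (rule someI_ex)
    then show ?thesis by blast
  qed
  have ep: "eigenpair (coef_matrix 1 1 z) (\<mu>0 z) (V0 z)" "{\<nu> \<in> eigenvalues (coef_matrix 1 1 z). 0 < Re \<nu>} = {\<mu>0 z}"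
    if "z \<in> RHP" for z
    using V0 that unfolding limit_eigendata_def Amat0_def by auto
  have Va: "(\<lambda>z. V0 z $ i) analytic_on RHP" for i using V0 by (simp add: limit_eigendata_def)
  define root where "root z = (V0 z $ 1 + V0 z $ 2) / V0 z $ 3 + 1 - z" for z
  have sole: "sole_growing_root 1 z (\<mu>0 z)" and re: "0 < Re (\<mu>0 z)" if "z \<in> RHP" for z
    using sole_growing_rootI[OF ep[OF that]] by auto
  have V3: "V0 z $ 3 \<noteq> 0" and root: "root z = \<mu>0 z" if z: "z \<in> RHP" for z
  proof -
    have "\<mu>0 z \<noteq> 0" using re[OF z] by auto
    from coef_matrix_eigenpair(1,4)[OF ep(1)[OF z] this] show "V0 z $ 3 \<noteq> 0" "root z = \<mu>0 z"
      by (simp_all add: root_def)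
  qed
  have root_analytic: "root analytic_on RHP"
    unfolding root_def[abs_def] by (intro analytic_intros Va V3)
  have rc: "continuous_on K root"
    by (rule continuous_on_subset[OF analytic_on_imp_continuous_on[OF root_analytic] K(2)])
  have rpos: "0 < Re (root z)" if "z \<in> K" for z using root re that K by auto
  obtain m where m: "0 < m" "m \<le> 1" "\<And>z. z \<in> K \<Longrightarrow> m \<le> Re (root z)"
    using compact_positive_lower_bound[OF K(1) continuous_on_Re[OF rc] rpos] by blast
  obtain M1 where M1: "0 \<le> M1" "\<And>z. z \<in> K \<Longrightarrow> cmod (root z) \<le> M1"
    using compact_norm_bound[OF K(1) rc] by blast
  obtain M2 where M2: "0 \<le> M2" "\<And>z. z \<in> K \<Longrightarrow> cmod z \<le> M2"
    using compact_norm_bound[OF K(1) continuous_on_id] by auto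
  have "continuous_on K V0"
    unfolding continuous_on_def
    using continuous_on_subset[OF analytic_on_imp_continuous_on[OF Va] K(2)]
    by (auto simp: continuous_on_def intro!: vec_tendstoI)
  then obtain M3 where M3: "0 \<le> M3" "\<And>z. z \<in> K \<Longrightarrow> norm (V0 z) \<le> M3"
    using compact_norm_bound[OF K(1)] by blast
  define Z where "Z = 1 + M1 + M2"
  have Z: "1 \<le> Z" "\<And>z. z \<in> K \<Longrightarrow> cmod z \<le> Z" "\<And>z. z \<in> K \<Longrightarrow> cmod (root z) \<le> Z"
    using M1 M2 by (auto simp: Z_def add_increasing add_increasing2)
  obtain X C where X: "0 \<le> X" "0 \<le> C" and tail:
    "\<And>z \<mu> L W. \<lbrakk>sole_growing_root 1 z \<mu>; m \<le> Re \<mu>; 0 \<le> Re z; cmod z \<le> Z; cmod \<mu> \<le> Z;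
       Amat0 1 z *v L = \<mu> *s L; solves (\<lambda>x. Amat0 (logistic x) z) W; asymp_exp \<mu> L at_bot W\<rbrakk>
       \<Longrightarrow> norm (W (- X)) \<le> C * norm L"
    using limit_tail_bound[OF m(1,2) Z(1)] by blast
  (* A bound for W 0 from the tail near minus infinity, carried across [- X, 0] and then into the forward
     estimates. *)
  define Q where "Q = exp (2 * (6 + 3 * Z)) * (exp (9 * (Z + 1) * X) * (C * M3))"
  have Q0: "0 \<le> Q" using X M3 by (simp add: Q_def)
  define c_out where "c_out z v0 = exp (root z * of_real (t v0))" for z v0
  have error: "cmod (c_out z v0 * D0_out (vh0 v0) (Wout v0) z - D_shock W0m W0p z) \<le> (4 * Z + 1) * Q * exp (- (1 / 4) * t v0)"
    if z: "z \<in> K" and v0: "0 < v0" "v0 < 1" and t0: "0 \<le> t v0" for z v0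
  proof -
    have zR: "z \<in> RHP" "0 \<le> Re z" using z K by (auto simp: RHP_def)
    define \<mu> where "\<mu> = root z"
    have \<mu>0: "\<mu>0 z = \<mu>" using root[OF zR(1)] by (simp add: \<mu>_def)
    define W where "W = W0m z"
    have W: "solves (\<lambda>x. Amat0 (logistic x) z) W" "asymp_exp \<mu> (V0 z) at_bot W"
      using W0m zR(1) unfolding limit_solution_def vc W_def \<mu>0[symmetric] by blast+
    have "Amat0 1 z *v V0 z = \<mu> *s V0 z" using ep(1)[OF zR(1)] by (simp add: eigenpair_def Amat0_def \<mu>0)
    then have "norm (W (- X)) \<le> C * norm (V0 z)"
      using tail[OF _ _ zR(2) Z(2)[OF z] _ _ W] sole[OF zR(1)] m(3)[OF z] Z(3)[OF z] by (simp add: \<mu>0 \<mu>_def)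
    also have "\<dots> \<le> C * M3" using M3(2)[OF z] X(2) by (rule mult_left_mono)
    finally have "exp (9 * (Z + 1) * X) * norm (W (- X)) \<le> exp (9 * (Z + 1) * X) * (C * M3)"
      by (rule mult_left_mono) simp
    with limit_solution_crude_growth[OF W(1) Z(2)[OF z] X(1)]
    have "norm (W 0) \<le> exp (9 * (Z + 1) * X) * (C * M3)" by linarith
    then have PQ: "exp (2 * (6 + 3 * Z)) * norm (W 0) \<le> Q" unfolding Q_def by (rule mult_left_mono) simp
    obtain l where l: "\<And>x. 0 \<le> x \<Longrightarrow> cmod (W x $ 1) \<le> exp (2 * (6 + 3 * Z)) * norm (W 0) * exp (x / 2)"
      "\<And>x. 0 \<le> x \<Longrightarrow> cmod (W x $ 3) \<le> exp (2 * (6 + 3 * Z)) * norm (W 0) * exp (- (1 / 4) * x)"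
      "((\<lambda>x. W x $ 2) \<longlongrightarrow> l) at_top"
      "\<And>x. 0 \<le> x \<Longrightarrow> cmod (W x $ 2 - l) \<le> 4 * Z * (exp (2 * (6 + 3 * Z)) * norm (W 0)) * exp (- (1 / 4) * x)"
      using limit_solution_forward[OF W(1) zR(2) Z(2)[OF z]] by blast
    have Y: "solves (\<lambda>x. - cadj (Amat0 (logistic x) z)) (W0p z)" "(W0p z \<longlongrightarrow> vector [0, - 1, cnj z / cnj (- 1 - z)]) at_top"
      using W0p zR(1) unfolding limit_adjoint_solution_def vc by blast+
    have D: "D_shock W0m W0p z = - l"
      unfolding D_shock_def W_def[symmetric] by (rule limit_shock_evans_value[OF W(1) Y l(1,2,3)])
    define \<tau> where "\<tau> = t v0"
    have Wt: "W x = exp (\<mu> * of_real \<tau>) *s Wout v0 z (x - \<tau>)" for x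
    proof (rule limit_solution_unique[OF _ _ zR(2) W])
      show "sole_growing_root 1 z \<mu>" "0 < Re \<mu>" using sole[OF zR(1)] re[OF zR(1)] by (simp_all add: \<mu>0)
      have S: "solves (\<lambda>x. Amat0 (vh0 v0 x) z) (Wout v0 z)" "asymp_exp \<mu> (V0 z) at_bot (Wout v0 z)"
        using Wout[OF v0] zR(1) unfolding limit_solution_def \<mu>0[symmetric] by blast+
      show "solves (\<lambda>x. Amat0 (logistic x) z) (\<lambda>x. exp (\<mu> * of_real \<tau>) *s Wout v0 z (x - \<tau>))"
        using solves_smult[OF solves_shift[OF S(1), of "- \<tau>"]] by (simp add: t[OF v0] \<tau>_def)
      show "asymp_exp \<mu> (V0 z) at_bot (\<lambda>x. exp (\<mu> * of_real \<tau>) *s Wout v0 z (x - \<tau>))"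
        using asymp_exp_shift[OF S(2) filterlim_shift_at_bot, of "- \<tau>"] by simp
    qed
    have W\<tau>: "W \<tau> = exp (\<mu> * of_real \<tau>) *s Wout v0 z 0" using Wt[of \<tau>] by simp
    define d where "d = v0 * (v0 - 1)"
    have d0: "d \<le> 0" using v0 by (simp add: d_def mult_nonneg_nonpos)
    have "(vh0 v0 has_real_derivative vh0 v0 0 * (vh0 v0 0 - 1)) (at 0)" "vh0 v0 0 = v0"
      using vh0[OF v0] unfolding profile0_def by blast+
    then have d: "deriv (vh0 v0) 0 = d" by (simp add: DERIV_imp_deriv d_def)
    define \<rho> where "\<rho> = z / (z - of_real d)"
    have \<rho>: "cmod \<rho> \<le> 1"
    proof -
      have "\<bar>Re z\<bar> \<le> \<bar>Re z - d\<bar>" using zR(2) d0 by simp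
      then have "cmod z \<le> cmod (z - of_real d)"
        unfolding cmod_def by (intro real_sqrt_le_mono) (simp add: abs_le_square_iff)
      then show ?thesis by (simp add: \<rho>_def norm_divide divide_le_eq_1)
    qed
    have D0: "D0_out (vh0 v0) (Wout v0) z = - (Wout v0 z 0 $ 2) - \<rho> * (Wout v0 z 0 $ 3)"
      by (simp add: D0_out_def cdot_def sum_3 d \<rho>_def)
    have cc: "c_out z v0 = exp (\<mu> * of_real \<tau>)" by (simp add: c_out_def \<mu>_def \<tau>_def)
    have "c_out z v0 * D0_out (vh0 v0) (Wout v0) z - D_shock W0m W0p z = - (W \<tau> $ 2 - l) - \<rho> * W \<tau> $ 3"
      unfolding D W\<tau> D0 cc vector_smult_component by algebra
    then have "cmod (c_out z v0 * D0_out (vh0 v0) (Wout v0) z - D_shock W0m W0p z) \<le> cmod (W \<tau> $ 2 - l) + cmod \<rho> * cmod (W \<tau> $ 3)"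
      using norm_triangle_ineq4[of "- (W \<tau> $ 2 - l)" "\<rho> * W \<tau> $ 3"] by (simp add: norm_mult norm_minus_commute)
    also have "\<dots> \<le> 4 * Z * Q * exp (- (1 / 4) * \<tau>) + 1 * (Q * exp (- (1 / 4) * \<tau>))"
    proof (intro add_mono mult_mono)
      have \<tau>0: "0 \<le> \<tau>" using t0 by (simp add: \<tau>_def)
      show "cmod (W \<tau> $ 2 - l) \<le> 4 * Z * Q * exp (- (1 / 4) * \<tau>)"
        by (rule order_trans[OF l(4)[OF \<tau>0]]) (use PQ Z(1) in \<open>intro mult_right_mono mult_left_mono; simp\<close>)
      show "cmod (W \<tau> $ 3) \<le> Q * exp (- (1 / 4) * \<tau>)"
        by (rule order_trans[OF l(2)[OF \<tau>0]]) (use PQ in \<open>intro mult_right_mono; simp\<close>)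
    qed (use \<rho> in auto)
    also have "\<dots> = (4 * Z + 1) * Q * exp (- (1 / 4) * t v0)" by (simp add: \<tau>_def algebra_simps)
    finally show ?thesis .
  qed
  show ?thesis
  proof (intro exI[of _ c_out] conjI allI impI ballI; (elim conjE)?)
    show "(\<lambda>z. c_out z v0) analytic_on RHP" for v0
      unfolding c_out_def by (intro analytic_intros root_analytic)
    show "c_out z v0 \<noteq> 0" for z v0 by (simp add: c_out_def)
    show "uniform_limit K (\<lambda>v0 z. c_out z v0 * D0_out (vh0 v0) (Wout v0) z) (\<lambda>z. D_shock W0m W0p z) (at_right 0)"
      unfolding uniform_limit_iff
    proof (intro allI impI)
      fix e :: real assume e: "0 < e"
      define B where "B = (4 * Z + 1) * Q"
      have "((\<lambda>T. B * exp (- (1 / 4) * T)) \<longlongrightarrow> 0) at_top" by (rule exp_decay_at_top) simp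
      then have "\<forall>\<^sub>F T in at_top. B * exp (- (1 / 4) * T) < e" using e by (rule order_tendstoD)
      then obtain T where T: "\<And>x. T \<le> x \<Longrightarrow> B * exp (- (1 / 4) * x) < e" by (auto simp: eventually_at_top_linorder)
      have "0 < logistic (max 0 T)" by (rule logistic_bounds)
      then have "\<forall>\<^sub>F v0 in at_right 0. v0 \<in> {0<..<logistic (max 0 T)}" by (rule eventually_at_right_real)
      then show "\<forall>\<^sub>F v0 in at_right 0. \<forall>z\<in>K. dist (c_out z v0 * D0_out (vh0 v0) (Wout v0) z) (D_shock W0m W0p z) < e"
      proof eventually_elim
        case (elim v0)
        then have v0: "0 < v0" "v0 < 1" using logistic_bounds(2)[of "max 0 T"] by auto
        have "vh0 v0 0 = v0" using vh0[OF v0] by (simp add: profile0_def)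
        then have "logistic (t v0) < logistic (max 0 T)" using t[OF v0, of 0] elim by simp
        then have tT: "0 \<le> t v0" "T \<le> t v0" by (simp_all add: logistic_less_iff)
        show ?case
        proof
          fix z assume "z \<in> K"
          from error[OF this v0 tT(1)] T[OF tT(2)]
          show "dist (c_out z v0 * D0_out (vh0 v0) (Wout v0) z) (D_shock W0m W0p z) < e"
            by (simp add: dist_norm B_def)
        qed
      qed
    qed
  qed
qed

section \<open>Limits of the inflow and outflow Evans functions\<close>

theorem theorem3p3:
  fixes \<gamma> :: real and K :: "complex set"
    and vh :: "real \<Rightarrow> real \<Rightarrow> real \<Rightarrow> real"
    and vc :: "real \<Rightarrow> real \<Rightarrow> real"
    and \<mu>p \<mu>m :: "real \<Rightarrow> complex \<Rightarrow> complex"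
    and Vp Vm :: "real \<Rightarrow> complex \<Rightarrow> complex^3"
    and Win :: "real \<Rightarrow> real \<Rightarrow> complex \<Rightarrow> real \<Rightarrow> complex^3"
    and Wm Wp :: "real \<Rightarrow> complex \<Rightarrow> real \<Rightarrow> complex^3"
    and vh0 :: "real \<Rightarrow> real \<Rightarrow> real"
    and vc0 :: "real \<Rightarrow> real"
    and \<mu>0 :: "complex \<Rightarrow> complex"
    and V0 :: "complex \<Rightarrow> complex^3"
    and Wout :: "real \<Rightarrow> complex \<Rightarrow> real \<Rightarrow> complex^3"
    and W0m W0p :: "complex \<Rightarrow> real \<Rightarrow> complex^3"
  assumes gamma: "1 \<le> \<gamma>"
    and K: "compact K" "K \<subseteq> RHP"
    \<comment> \<open>inflow problem, parameters \<open>v\<^sub>+\<close> and \<open>v\<^sub>0\<close>\<close>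
    and vh: "\<And>vp v0. 0 < vp \<Longrightarrow> vp < v0 \<Longrightarrow> v0 < 1 \<Longrightarrow> profile \<gamma> vp v0 (vh vp v0)"
    and Vp: "adjoint_eigendata \<gamma> \<mu>p Vp"
    and Win: "\<And>vp v0. 0 < vp \<Longrightarrow> vp < v0 \<Longrightarrow> v0 < 1 \<Longrightarrow>
                adjoint_solution \<gamma> vp (vh vp v0) (\<mu>p vp) (Vp vp) (Win vp v0)"
    \<comment> \<open>viscous shock, parameter \<open>v\<^sub>+\<close>\<close>
    and vc: "\<And>vp. 0 < vp \<Longrightarrow> vp < 1 \<Longrightarrow> vc vp 0 = (1 + vp) / 2"
            "\<And>vp v0. 0 < vp \<Longrightarrow> vp < v0 \<Longrightarrow> v0 < 1 \<Longrightarrow> translate_of (vc vp) (vh vp v0)"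
    and Vm: "shock_eigendata \<gamma> \<mu>m Vm"
    and Wm: "\<And>vp. 0 < vp \<Longrightarrow> vp < 1 \<Longrightarrow>
                shock_solution \<gamma> vp (vc vp) (\<mu>m vp) (Vm vp) (Wm vp)"
    and Wp: "\<And>vp. 0 < vp \<Longrightarrow> vp < 1 \<Longrightarrow>
                adjoint_solution \<gamma> vp (vc vp) (\<mu>p vp) (Vp vp) (Wp vp)"
    \<comment> \<open>limiting outflow problem, parameter \<open>v\<^sub>0\<close>\<close>
    and vh0: "\<And>v0. 0 < v0 \<Longrightarrow> v0 < 1 \<Longrightarrow> profile0 v0 (vh0 v0)"
    and V0: "limit_eigendata \<mu>0 V0"
    and Wout: "\<And>v0. 0 < v0 \<Longrightarrow> v0 < 1 \<Longrightarrow> limit_solution (vh0 v0) \<mu>0 V0 (Wout v0)"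
    \<comment> \<open>limiting viscous shock\<close>
    and vc0: "vc0 0 = 1 / 2"
             "\<And>v0. 0 < v0 \<Longrightarrow> v0 < 1 \<Longrightarrow> translate_of vc0 (vh0 v0)"
    and W0m: "limit_solution vc0 \<mu>0 V0 W0m"
    and W0p: "limit_adjoint_solution vc0 W0p"
  shows "(\<forall>\<epsilon>::real. 0 < \<epsilon> \<and> \<epsilon> < 1 \<longrightarrow>
            (\<exists>c_in :: complex \<Rightarrow> real \<Rightarrow> real \<Rightarrow> complex.
               (\<forall>v0 vp. 0 < vp \<and> vp < v0 \<and> v0 < 1 \<longrightarrow>
                  (\<lambda>z. c_in z v0 vp) analytic_on RHP \<and> (\<forall>z\<in>RHP. c_in z v0 vp \<noteq> 0)) \<and>
               uniform_limit (K \<times> {0<..1 - \<epsilon>})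
                 (\<lambda>v0 (z, vp). c_in z v0 vp * D_in (Win vp v0) z)
                 (\<lambda>(z, vp). D_shock (Wm vp) (Wp vp) z)
                 (at_left 1))) \<and>
         (\<forall>r::real. 0 < r \<longrightarrow>
            (\<exists>c_out :: complex \<Rightarrow> real \<Rightarrow> complex.
               (\<forall>v0. 0 < v0 \<and> v0 < 1 \<longrightarrow>
                  (\<lambda>z. c_out z v0) analytic_on RHP \<and> (\<forall>z\<in>RHP. c_out z v0 \<noteq> 0)) \<and>
               uniform_limit {z \<in> K. r \<le> cmod z}
                 (\<lambda>v0 z. c_out z v0 * D0_out (vh0 v0) (Wout v0) z)
                 (\<lambda>z. D_shock W0m W0p z)
                 (at_right 0)))"
proof (intro conjI allI impI)
  fix \<epsilon> :: real assume "0 < \<epsilon> \<and> \<epsilon> < 1"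
  then show "\<exists>c_in :: complex \<Rightarrow> real \<Rightarrow> real \<Rightarrow> complex.
       (\<forall>v0 vp. 0 < vp \<and> vp < v0 \<and> v0 < 1 \<longrightarrow>
          (\<lambda>z. c_in z v0 vp) analytic_on RHP \<and> (\<forall>z\<in>RHP. c_in z v0 vp \<noteq> 0)) \<and>
       uniform_limit (K \<times> {0<..1 - \<epsilon>})
         (\<lambda>v0 (z, vp). c_in z v0 vp * D_in (Win vp v0) z)
         (\<lambda>(z, vp). D_shock (Wm vp) (Wp vp) z) (at_left 1)"
    by (intro inflow_limit[OF gamma K _ _ vh Vp Win vc Vm Wm Wp]) auto
next
  fix r :: real
  obtain c_out :: "complex \<Rightarrow> real \<Rightarrow> complex" where
    c_out: "\<forall>v0. 0 < v0 \<and> v0 < 1 \<longrightarrow> (\<lambda>z. c_out z v0) analytic_on RHP \<and> (\<forall>z\<in>RHP. c_out z v0 \<noteq> 0)"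
    "uniform_limit K (\<lambda>v0 z. c_out z v0 * D0_out (vh0 v0) (Wout v0) z) (\<lambda>z. D_shock W0m W0p z) (at_right 0)"
    using outflow_limit[OF K vh0 V0 Wout vc0 W0m W0p] by blast
  have "uniform_limit {z \<in> K. r \<le> cmod z}
         (\<lambda>v0 z. c_out z v0 * D0_out (vh0 v0) (Wout v0) z) (\<lambda>z. D_shock W0m W0p z) (at_right 0)"
    by (rule uniform_limit_on_subset[OF c_out(2)]) auto
  with c_out(1) show "\<exists>c_out :: complex \<Rightarrow> real \<Rightarrow> complex.
       (\<forall>v0. 0 < v0 \<and> v0 < 1 \<longrightarrow>
          (\<lambda>z. c_out z v0) analytic_on RHP \<and> (\<forall>z\<in>RHP. c_out z v0 \<noteq> 0)) \<and>
       uniform_limit {z \<in> K. r \<le> cmod z}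
         (\<lambda>v0 z. c_out z v0 * D0_out (vh0 v0) (Wout v0) z)
         (\<lambda>z. D_shock W0m W0p z) (at_right 0)"
    by blast
qed

end
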